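(* Let $n\ge1$, let $p,q,t\in\mathbb{C}^\ast$ with $|p|<1$, $|q|<1$, $|t|<1$, and suppose that $|p|<|t|^{2n-2}$. Under the balancing condition $a_1\cdots a_6\,t^{2n-2}=pq$, the integral $I(a_1,\ldots,a_6)$ satisfies the system of $q$-difference equations $$ I(a_1,\ldots,a_5,a_6)=I(a_1,\ldots,qa_k,\ldots,a_5,q^{-1}a_6) \prod_{i=1}^{n}\ \prod_{\substack{1\le m\le 5\\ m\ne k}} \frac{\theta(q^{-1}a_ma_6t^{i-1};p)}{\theta(a_ma_kt^{i-1};p)} $$ for $k=1,\ldots,5$ (where on the right-hand side $a_k$ is replaced by $qa_k$ and $a_6$ by $q^{-1}a_6$, the other arguments being unchanged), provided that $|a_1|<1,\ldots,|a_5|<1$ and $|a_6|<|q|$.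
   Context: $\mathbb{C}^\ast=\mathbb{C}\setminus\{0\}$; $a_1,\ldots,a_6\in\mathbb{C}^\ast$. Notation: $(u;p)_\infty=\prod_{\mu\ge 0}(1-p^\mu u)$, $(u;p,q)_\infty=\prod_{\mu,\nu\ge 0}(1-p^\mu q^\nu u)$, $\theta(u;p)=(u;p)_\infty(p/u;p)_\infty$, and $\Gamma(u;p,q)=(pqu^{-1};p,q)_\infty/(u;p,q)_\infty$ (Ruijsenaars elliptic gamma function), which satisfies $\Gamma(qu;p,q)=\theta(u;p)\Gamma(u;p,q)$. Double signs indicate the product over all possible sign choices, e.g. $\Gamma(az^{\pm1};p,q)=\Gamma(az;p,q)\Gamma(az^{-1};p,q)$, and $\Gamma(tz^{\pm1}w^{\pm1};p,q)$ is a product of four factors. Define $$ \Psi(a_1,\ldots,a_6;z)=\prod_{i=1}^{n}\frac{\prod_{m=1}^{6}\Gamma(a_mz_i^{\pm 1};p,q)}{\Gamma(z_i^{\pm2};p,q)}\prod_{1\le j<k\le n}\frac{\Gamma(tz_j^{\pm1}z_k^{\pm1};p,q)}{\Gamma(z_j^{\pm1}z_k^{\pm1};p,q)}, $$ and, for $|a_m|<1$ $(m=1,\ldots,6)$, $$ I(a_1,\ldots,a_6)=\frac{1}{(2\pi\sqrt{-1})^n}\int_{\mathbb{T}^n}\Psi(a_1,\ldots,a_6;z)\frac{dz_1\cdots dz_n}{z_1\cdots z_n}, $$ where $\mathbb{T}^n=\{z\in(\mathbb{C}^\ast)^n : |z_i|=1\ (i=1,\ldots,n)\}$ with each circle positively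 oriented. The identity is understood as an identity of meromorphic functions of the parameters on the balancing hypersurface (i.e. at points where the denominators do not vanish). *)

theory Defs
  imports "HOL-Analysis.Analysis"
begin

text \<open>
  \<^const>\<open>prodinf\<close> admits finitely many vanishing factors (its value is then \<open>0\<close>), so the two
  definitions below are correct at the zeros as well.
\<close>

definition qpoch :: "complex \<Rightarrow> complex \<Rightarrow> complex" where
  "qpoch u p = (\<Prod>\<mu>. 1 - p ^ \<mu> * u)"

text \<open>
  For \<open>|p|, |q| < 1\<close> the double product converges absolutely, so it may be taken iteratively.
\<close>

definition qpoch2 :: "complex \<Rightarrow> complex \<Rightarrow> complex \<Rightarrow> complex" where
  "qpoch2 u p q = (\<Prod>\<mu>. \<Prod>\<nu>. 1 - p ^ \<mu> * q ^ \<nu> * u)"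

definition theta :: "complex \<Rightarrow> complex \<Rightarrow> complex" where
  "theta u p = qpoch u p * qpoch (p / u) p"

definition egamma :: "complex \<Rightarrow> complex \<Rightarrow> complex \<Rightarrow> complex" where
  "egamma u p q = qpoch2 (p * q / u) p q / qpoch2 u p q"

text \<open>
  Parameters \<open>a\<^sub>1, \<dots>, a\<^sub>6\<close> and variables \<open>z\<^sub>1, \<dots>, z\<^sub>n\<close> are functions on \<open>nat\<close>, used only at the
  indices \<open>1..6\<close> and \<open>1..n\<close>. Double signs are products over exponents \<open>r, s \<in> {1, -1}\<close>.
  At the poles of the gamma factors in the denominators (such as \<open>z\<^sub>i\<^sup>2 = 1\<close>), division by zero
  yields \<open>0\<close> for \<^const>\<open>egamma\<close> and again \<open>0\<close> for its reciprocal, which is the analytic value of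
  the reciprocal.
\<close>

definition Psi ::
  "nat \<Rightarrow> complex \<Rightarrow> complex \<Rightarrow> complex \<Rightarrow> (nat \<Rightarrow> complex) \<Rightarrow> (nat \<Rightarrow> complex) \<Rightarrow> complex" where
  "Psi n p q t a z =
    (\<Prod>i=1..n.
       (\<Prod>m=1..6. \<Prod>s\<in>{1, -1::int}. egamma (a m * z i powi s) p q) /
       (\<Prod>s\<in>{1, -1::int}. egamma (z i powi (2 * s)) p q)) *
    (\<Prod>k=1..n. \<Prod>j=1..<k.
       (\<Prod>r\<in>{1, -1::int}. \<Prod>s\<in>{1, -1::int}. egamma (t * z j powi r * z k powi s) p q) /
       (\<Prod>r\<in>{1, -1::int}. \<Prod>s\<in>{1, -1::int}. egamma (z j powi r * z k powi s) p q))"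

text \<open>
  The integral of \<open>f(z) dz\<^sub>1 \<dots> dz\<^sub>n\<close> over the torus, pulled back along \<open>z\<^sub>i = exp(\<i> x\<^sub>i)\<close>,
  \<open>x \<in> [0, 2\<pi>]\<^sup>n\<close>, so that \<open>dz\<^sub>i = \<i> exp(\<i> x\<^sub>i) dx\<^sub>i\<close>.
\<close>

definition torus_integral :: "nat \<Rightarrow> ((nat \<Rightarrow> complex) \<Rightarrow> complex) \<Rightarrow> complex" where
  "torus_integral n f =
    (LINT x : ({1..n} \<rightarrow>\<^sub>E {0..2 * pi}) | (\<Pi>\<^sub>M i\<in>{1..n}. lborel).
       f (\<lambda>i. cis (x i)) * (\<Prod>i=1..n. \<i> * cis (x i)))"

definition BC_integral ::
  "nat \<Rightarrow> complex \<Rightarrow> complex \<Rightarrow> complex \<Rightarrow> (nat \<Rightarrow> complex) \<Rightarrow> complex" where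
  "BC_integral n p q t a =
    1 / (2 * of_real pi * \<i>) ^ n * torus_integral n (\<lambda>z. Psi n p q t a z / (\<Prod>i=1..n. z i))"

end

theory Submission
  imports Defs "HOL-Complex_Analysis.Complex_Analysis"
begin

text \<open>
  Put \<open>b\<^sub>m = a\<^sub>m\<close> for \<open>m \<le> 5\<close> and \<open>b\<^sub>6 = a\<^sub>6 / q\<close>, so that \<open>b\<^sub>1 \<cdots> b\<^sub>6 t\<^sup>2\<^sup>n\<^sup>-\<^sup>2 = p\<close>, and write \<open>\<langle>f\<rangle>\<close>
  for the integral of \<open>f\<close> over the torus against the weight \<open>\<Psi>(b; z)\<close> and
  \<open>v\<^sub>x(z) = \<theta>(xz) \<theta>(x/z)\<close>. Because of \<open>\<Gamma>(qu) = \<theta>(u) \<Gamma>(u)\<close> the two integrals of the theorem are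
  \<open>\<langle>\<Prod>\<^sub>i v\<^sub>a'(z\<^sub>i)\<rangle>\<close> and \<open>\<langle>\<Prod>\<^sub>i v\<^sub>a(z\<^sub>i)\<rangle>\<close> with \<open>a = b\<^sub>k\<close> and \<open>a' = b\<^sub>6\<close>. A linear relation between these
  two averages is needed, with explicit coefficients.

  Relations come from Cauchy's theorem. Let
  \<open>U\<^sub>i(w) = \<Prod>\<^sub>m \<theta>(b\<^sub>m w) / (w \<theta>(w\<^sup>2)) \<cdot> \<Prod>\<^sub>j\<^sub>\<noteq>\<^sub>i v\<^sub>t\<^sub>w(z\<^sub>j) / v\<^sub>w(z\<^sub>j)\<close>. Multiplied by the weight, \<open>U\<^sub>i(1/z\<^sub>i)\<close> is, up to
  a factor independent of \<open>z\<^sub>i = y\<close>, a function \<open>G(y)\<close> that is holomorphic on the annulus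
  \<open>|q| \<le> |y| \<le> 1\<close> and satisfies \<open>G(qy) = - G(1/y)\<close>. Shifting the circle of integration by \<open>q\<close>
  shows that its integral is \<open>0\<close> (lemma \<open>kernel_average\<close>). Hence the ``coboundary''
  \<open>F = \<Sum>\<^sub>i (U\<^sub>i(z\<^sub>i) + U\<^sub>i(1/z\<^sub>i)) g(z\<^sub>j : j \<noteq> i)\<close> satisfies \<open>\<langle>F\<rangle> = 0\<close> for every test function \<open>g\<close> in
  \<open>n - 1\<close> variables (lemma \<open>coboundary_average\<close>).

  For \<open>g\<close> a combination of products \<open>\<Prod>\<^sub>j v\<^sub>x(z\<^sub>j)\<close> the poles of the summands cancel, and the
  balancing condition makes \<open>F\<close>, in each variable, a function invariant under \<open>z \<mapsto> 1/z\<close> with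
  \<open>F(pz) = F(z) / (p z\<^sup>2)\<close>. Such a function is determined by its values at two points, because an odd
  theta function has a limited number of zeros (lemmas \<open>odd_quasi_periodic_eq_0\<close> and
  \<open>defect_interpolation\<close>). Applied to one variable after the other, this shows that \<open>F\<close> is
  determined by its values at the \<open>n + 1\<close> points
  \<open>\<zeta>\<^sub>r = (a, at, \<dots>, at\<^sup>r\<^sup>-\<^sup>1, a', a't, \<dots>, a't\<^sup>n\<^sup>-\<^sup>r\<^sup>-\<^sup>1)\<close> (lemma \<open>defect_eq_0\<close>). At \<open>\<zeta>\<^sub>r\<close> all summands
  vanish except those for the last power of \<open>t\<close> in either group (lemma \<open>coboundary_at_nodes\<close>),
  so a triangular system yields \<open>g\<close> for which \<open>F(\<zeta>\<^sub>r) = 0\<close> whenever \<open>0 < r < n\<close>. Since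
  \<open>\<Prod>\<^sub>i v\<^sub>a(z\<^sub>i)\<close> vanishes at \<open>\<zeta>\<^sub>r\<close> for \<open>r > 0\<close> and \<open>\<Prod>\<^sub>i v\<^sub>a'(z\<^sub>i)\<close> for \<open>r < n\<close>, this \<open>F\<close> equals
  \<open>c \<Prod>\<^sub>i v\<^sub>a(z\<^sub>i) + d \<Prod>\<^sub>i v\<^sub>a'(z\<^sub>i)\<close>. The ratio \<open>- c/d\<close> is a product of theta functions that collapses
  to the one in the theorem (lemmas \<open>theta_quotient_identity\<close> and \<open>coboundary_relation\<close>).

  The interpolation needs \<open>a/a'\<close>, \<open>a\<^sup>2\<close> and \<open>a'\<^sup>2\<close> to lie outside \<open>p\<^sup>\<int> t\<^sup>\<int>\<close>. The remaining parameters
  are limits of these along \<open>(a/s, a's)\<close> with \<open>s \<rightarrow> 1\<close>, and both sides of the identity are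
  continuous.
\<close>

section \<open>Infinite products with geometric decay\<close>

text \<open>
  Both the rows of the double product and the double product itself, as the product of its rows,
  are of this form.
\<close>

lemma geometric_product:
  fixes f :: "nat \<Rightarrow> complex \<Rightarrow> complex"
  assumes holo: "\<And>k. f k holomorphic_on UNIV" and r: "0 \<le> r" "r < (1::real)"
    and bound: "\<And>R. \<exists>C. \<forall>k. \<forall>u\<in>cball 0 R. norm (f k u - 1) \<le> C * r ^ k"
  shows "convergent_prod (\<lambda>k. f k u)"
    and "(\<lambda>u. \<Prod>k. f k u) holomorphic_on UNIV"
proof -
  have conv: "convergent_prod (\<lambda>k. f k u)" for u
  proof -
    obtain C where C: "\<And>k. norm (f k u - 1) \<le> C * r ^ k"
      using bound[of "norm u"] by (metis mem_cball_0 order_refl)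
    have "summable (\<lambda>k. norm (f k u - 1))"
      by (rule summable_comparison_test'[where g = "\<lambda>k. C * r ^ k" and N = 0])
         (use C r in \<open>auto intro!: summable_mult summable_geometric\<close>)
    then show ?thesis
      by (intro abs_convergent_prod_imp_convergent_prod summable_imp_abs_convergent_prod)
  qed
  then show "convergent_prod (\<lambda>k. f k u)" .
  show "(\<lambda>u. \<Prod>k. f k u) holomorphic_on UNIV"
  proof (rule holomorphic_uniform_sequence[where f = "\<lambda>n u. \<Prod>k<n. f k u"])
    fix x :: complex
    obtain C where C: "\<And>k u. u \<in> cball 0 (norm x + 1) \<Longrightarrow> norm (f k u - 1) \<le> C * r ^ k"
      using bound[of "norm x + 1"] by meson
    have "uniformly_convergent_on (cball 0 (norm x + 1)) (\<lambda>N u. \<Prod>n<N. f n u)"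
    proof (rule uniformly_convergent_on_prod')
      show "uniformly_convergent_on (cball 0 (norm x + 1)) (\<lambda>N u. \<Sum>n<N. norm (f n u - 1))"
        by (rule Weierstrass_m_test'[where M = "\<lambda>k. C * r ^ k"])
           (use C r in \<open>auto intro!: summable_mult summable_geometric\<close>)
      show "continuous_on (cball 0 (norm x + 1)) (f n)" for n
        using holo[of n] holomorphic_on_imp_continuous_on continuous_on_subset by blast
    qed auto
    then obtain l where l: "uniform_limit (cball 0 (norm x + 1)) (\<lambda>N u. \<Prod>n<N. f n u) l sequentially"
      by (auto simp: uniformly_convergent_on_def)
    have eq: "l u = (\<Prod>k. f k u)" if "u \<in> cball 0 (norm x + 1)" for u
    proof -
      have "(\<lambda>N. \<Prod>n<N. f n u) \<longlonglongrightarrow> l u"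
        using tendsto_uniform_limitI[OF l that] .
      moreover have "(\<lambda>N. \<Prod>n<N. f n u) \<longlonglongrightarrow> (\<Prod>k. f k u)"
        using convergent_prod_LIMSEQ[OF conv[of u]] LIMSEQ_lessThan_iff_atMost[of "prod (\<lambda>k. f k u)"]
        by simp
      ultimately show ?thesis by (rule LIMSEQ_unique)
    qed
    have "cball x 1 \<subseteq> cball 0 (norm x + 1)"
      by (auto simp: dist_norm) (smt (verit) norm_minus_commute norm_triangle_sub)
    then have "uniform_limit (cball x 1) (\<lambda>N u. \<Prod>n<N. f n u) (\<lambda>u. \<Prod>k. f k u) sequentially"
      using uniform_limit_on_subset[OF l] eq
      by (metis (no_types, lifting) subsetD uniform_limit_cong')
    then show "\<exists>d>0. cball x d \<subseteq> UNIV \<and>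
        uniform_limit (cball x d) (\<lambda>n u. \<Prod>k<n. f k u) (\<lambda>u. \<Prod>k. f k u) sequentially"
      by (intro exI[of _ 1]) auto
  qed (auto intro!: holomorphic_intros holo)
qed

section \<open>q-shifted factorials\<close>

context
  fixes p :: complex assumes p: "norm p < 1"
begin

lemma qpoch_bound: "\<exists>C. \<forall>k. \<forall>u\<in>cball 0 R. norm ((1 - p ^ k * u) - 1) \<le> C * norm p ^ k"
proof (intro exI[of _ R] allI ballI)
  fix k and u :: complex assume "u \<in> cball 0 R"
  then show "norm (1 - p ^ k * u - 1) \<le> R * norm p ^ k"
    by (simp add: norm_mult norm_power mult.commute[of R] mult_left_mono)
qed

lemma qpoch_convergent: "convergent_prod (\<lambda>k. 1 - p ^ k * u)"
  by (rule geometric_product(1)[where r = "norm p", OF _ _ p qpoch_bound])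
     (auto intro!: holomorphic_intros)

lemma qpoch_holomorphic_UNIV: "(\<lambda>u. qpoch u p) holomorphic_on UNIV"
  unfolding qpoch_def
  by (rule geometric_product(2)[where r = "norm p", OF _ _ p qpoch_bound])
     (auto intro!: holomorphic_intros)

lemma qpoch_holomorphic:
  assumes "g holomorphic_on S" shows "(\<lambda>u. qpoch (g u) p) holomorphic_on S"
  using holomorphic_on_compose[OF assms holomorphic_on_subset[OF qpoch_holomorphic_UNIV]]
  by (auto simp: o_def)

lemma qpoch_step: "qpoch u p = (1 - u) * qpoch (p * u) p"
proof -
  have "(\<lambda>k. 1 - p ^ k * u) has_prod qpoch u p"
    unfolding qpoch_def using qpoch_convergent by blast
  moreover have "(\<lambda>k. 1 - p ^ Suc k * u) has_prod qpoch (p * u) p"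
    unfolding qpoch_def using convergent_prod_has_prod[OF qpoch_convergent[of "p * u"]]
    by (simp add: mult_ac)
  then have "(\<lambda>k. 1 - p ^ k * u) has_prod (qpoch (p * u) p * (1 - p ^ 0 * u))"
    using has_prod_Suc_imp[of "\<lambda>k. 1 - p ^ k * u"] by simp
  ultimately show ?thesis
    using has_prod_unique2 by fastforce
qed

lemma qpoch_eq_0_iff: "qpoch u p = 0 \<longleftrightarrow> (\<exists>k. p ^ k * u = 1)"
proof -
  have "(\<lambda>k. 1 - p ^ k * u) has_prod qpoch u p"
    unfolding qpoch_def using qpoch_convergent by blast
  from has_prod_eq_0_iff[OF this] show ?thesis by auto
qed

lemma qpoch_nonzero: assumes "norm u < 1" shows "qpoch u p \<noteq> 0"
proof
  assume "qpoch u p = 0"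
  then obtain k where "p ^ k * u = 1" by (auto simp: qpoch_eq_0_iff)
  then have "norm p ^ k * norm u = 1" by (metis norm_mult norm_one norm_power)
  moreover have "norm p ^ k * norm u \<le> 1 * norm u"
    using p by (intro mult_right_mono power_le_one) auto
  ultimately show False using assms by auto
qed

text \<open>
  This estimate makes the rows \<open>(p\<^sup>\<mu>u; q)\<close> of the double product tend to \<open>1\<close> geometrically.
\<close>

lemma qpoch_near_1: "\<exists>C. \<forall>u\<in>cball 0 R. norm (qpoch u p - 1) \<le> C * norm u"
proof -
  define h where "h = (\<lambda>u. if u = 0 then deriv (\<lambda>u. qpoch u p) 0
                           else (qpoch u p - qpoch 0 p) / (u - 0))"
  have "h holomorphic_on UNIV"
    unfolding h_def by (rule pole_lemma_open) (auto intro!: qpoch_holomorphic_UNIV)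
  then have "continuous_on (cball 0 R) h"
    using holomorphic_on_imp_continuous_on continuous_on_subset by blast
  then have "bounded (h ` cball 0 R)"
    by (intro compact_imp_bounded compact_continuous_image) auto
  then obtain C where C: "\<And>u. u \<in> cball 0 R \<Longrightarrow> norm (h u) \<le> C"
    unfolding bounded_iff by blast
  have q0: "qpoch 0 p = 1" by (simp add: qpoch_def)
  have "norm (qpoch u p - 1) \<le> C * norm u" if "u \<in> cball 0 R" for u
  proof (cases "u = 0")
    case False
    then have "qpoch u p - 1 = h u * u" by (simp add: h_def q0)
    then show ?thesis using C[OF that] by (simp add: norm_mult mult_right_mono)
  qed (simp add: q0)
  then show ?thesis by blast
qed

end

section \<open>Double products\<close>

context
  fixes p q :: complex assumes p: "norm p < 1" and q: "norm q < 1"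
begin

lemma qpoch2_rows: "qpoch2 u p q = (\<Prod>\<mu>. qpoch (p ^ \<mu> * u) q)"
  by (simp add: qpoch2_def qpoch_def mult_ac)

lemma qpoch2_bound:
  "\<exists>C. \<forall>k. \<forall>u\<in>cball 0 R. norm (qpoch (p ^ k * u) q - 1) \<le> C * norm p ^ k"
proof -
  obtain C where C: "\<And>u. u \<in> cball 0 R \<Longrightarrow> norm (qpoch u q - 1) \<le> C * norm u"
    using qpoch_near_1[OF q] by blast
  show ?thesis
  proof (intro exI[of _ "\<bar>C\<bar> * R"] allI ballI)
    fix k and u :: complex assume u: "u \<in> cball 0 R"
    have 1: "norm (p ^ k * u) \<le> 1 * norm u"
      unfolding norm_mult norm_power using p by (intro mult_right_mono power_le_one) auto
    then have "norm (qpoch (p ^ k * u) q - 1) \<le> C * norm (p ^ k * u)"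
      using u by (intro C) auto
    also have "\<dots> \<le> \<bar>C\<bar> * norm (p ^ k * u)" by (intro mult_right_mono) auto
    also have "\<dots> \<le> \<bar>C\<bar> * (norm p ^ k * R)"
      unfolding norm_mult norm_power using u by (intro mult_left_mono) auto
    finally show "norm (qpoch (p ^ k * u) q - 1) \<le> \<bar>C\<bar> * R * norm p ^ k" by (simp add: mult_ac)
  qed
qed

lemma qpoch2_convergent: "convergent_prod (\<lambda>k. qpoch (p ^ k * u) q)"
  by (rule geometric_product(1)[where r = "norm p", OF _ _ p qpoch2_bound])
     (auto intro!: holomorphic_intros qpoch_holomorphic q)

lemma qpoch2_holomorphic_UNIV: "(\<lambda>u. qpoch2 u p q) holomorphic_on UNIV"
  unfolding qpoch2_rows
  by (rule geometric_product(2)[where r = "norm p", OF _ _ p qpoch2_bound])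
     (auto intro!: holomorphic_intros qpoch_holomorphic q)

lemma qpoch2_holomorphic:
  assumes "g holomorphic_on S" shows "(\<lambda>u. qpoch2 (g u) p q) holomorphic_on S"
  using holomorphic_on_compose[OF assms holomorphic_on_subset[OF qpoch2_holomorphic_UNIV]]
  by (auto simp: o_def)

lemma qpoch2_step_p: "qpoch2 u p q = qpoch u q * qpoch2 (p * u) p q"
proof -
  have "(\<lambda>k. qpoch (p ^ k * u) q) has_prod qpoch2 u p q"
    unfolding qpoch2_rows using qpoch2_convergent by blast
  moreover have "(\<lambda>k. qpoch (p ^ Suc k * u) q) has_prod qpoch2 (p * u) p q"
    unfolding qpoch2_rows using convergent_prod_has_prod[OF qpoch2_convergent[of "p * u"]]
    by (simp add: mult_ac)
  then have "(\<lambda>k. qpoch (p ^ k * u) q) has_prod (qpoch2 (p * u) p q * qpoch (p ^ 0 * u) q)"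
    using has_prod_Suc_imp[of "\<lambda>k. qpoch (p ^ k * u) q"] by simp
  ultimately show ?thesis
    using has_prod_unique2 by fastforce
qed

text \<open>
  The double product is iterated over rows; here the first factor of every row is split off.
\<close>

lemma qpoch2_step_q: "qpoch2 u p q = qpoch u p * qpoch2 (q * u) p q"
proof -
  have row: "qpoch (p ^ k * u) q = (1 - p ^ k * u) * qpoch (p ^ k * (q * u)) q" for k
    unfolding mult.left_commute[of "p ^ k" q u] by (rule qpoch_step[OF q])
  have "qpoch2 u p q = (\<Prod>k. (1 - p ^ k * u) * qpoch (p ^ k * (q * u)) q)"
    by (simp only: qpoch2_rows row)
  also have "\<dots> = (\<Prod>k. 1 - p ^ k * u) * (\<Prod>k. qpoch (p ^ k * (q * u)) q)"
    by (rule prodinf_mult[OF qpoch_convergent[OF p] qpoch2_convergent, symmetric])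
  finally show ?thesis by (simp only: qpoch2_rows qpoch_def[of u p])
qed

lemma qpoch2_nonzero: assumes "norm u < 1" shows "qpoch2 u p q \<noteq> 0"
proof -
  have "qpoch (p ^ k * u) q \<noteq> 0" for k
  proof (rule qpoch_nonzero[OF q])
    have "norm p ^ k * norm u \<le> 1 * norm u"
      using p by (intro mult_right_mono power_le_one) auto
    then show "norm (p ^ k * u) < 1" using assms by (simp add: norm_mult norm_power)
  qed
  moreover have "(\<lambda>k. qpoch (p ^ k * u) q) has_prod qpoch2 u p q"
    unfolding qpoch2_rows using qpoch2_convergent by blast
  note has_prod_eq_0_iff[OF this]
  ultimately show ?thesis by auto
qed

end

section \<open>The theta function\<close>

lemma theta_at_1: "norm p < 1 \<Longrightarrow> theta 1 p = 0"
  unfolding theta_def using qpoch_eq_0_iff[of p 1] by (auto intro!: exI[of _ 0])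

context
  fixes p :: complex assumes p: "norm p < 1" "p \<noteq> 0"
begin

lemma theta_times_p: assumes "u \<noteq> 0" shows "theta (p * u) p = - theta u p / u"
proof -
  have 1: "theta (p * u) p = qpoch (p * u) p * ((1 - 1 / u) * qpoch (p / u) p)"
    using qpoch_step[OF p(1), of "1 / u"] p by (simp add: theta_def)
  have 2: "theta u p = (1 - u) * qpoch (p * u) p * qpoch (p / u) p"
    using qpoch_step[OF p(1), of u] by (simp add: theta_def)
  show ?thesis unfolding 1 2 using assms by (simp add: field_simps)
qed

lemma theta_inverse: assumes "u \<noteq> 0" shows "theta (1 / u) p = - theta u p / u"
proof -
  have 1: "theta (1 / u) p = (1 - 1 / u) * qpoch (p / u) p * qpoch (p * u) p"
    using qpoch_step[OF p(1), of "1 / u"] by (simp add: theta_def)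
  have 2: "theta u p = (1 - u) * qpoch (p * u) p * qpoch (p / u) p"
    using qpoch_step[OF p(1), of u] by (simp add: theta_def)
  show ?thesis unfolding 1 2 using assms by (simp add: field_simps)
qed

lemma theta_holomorphic:
  assumes "g holomorphic_on S" "\<And>z. z \<in> S \<Longrightarrow> g z \<noteq> 0"
  shows "(\<lambda>z. theta (g z) p) holomorphic_on S"
  unfolding theta_def by (intro holomorphic_intros qpoch_holomorphic p assms)

lemma theta_eq_0_iff: assumes "u \<noteq> 0" shows "theta u p = 0 \<longleftrightarrow> (\<exists>k::int. u = p powi k)"
proof
  assume "theta u p = 0"
  then consider k where "p ^ k * u = 1" | k where "p ^ k * (p / u) = 1"
    unfolding theta_def using qpoch_eq_0_iff[OF p(1)] by auto
  then show "\<exists>k::int. u = p powi k"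
  proof cases
    case 1
    then have "u = p powi (- int k)" using p by (simp add: power_int_minus field_simps)
    then show ?thesis by blast
  next
    case 2
    then have "u = p powi (int (Suc k))" using p assms
      by (simp add: power_int_def field_simps nat_add_distrib)
    then show ?thesis by blast
  qed
next
  assume "\<exists>k::int. u = p powi k"
  then obtain k :: int where k: "u = p powi k" by blast
  show "theta u p = 0"
  proof (cases "k \<le> 0")
    case True
    then have "p ^ nat (- k) * u = 1" using p k by (auto simp: power_int_def power_inverse)
    then have "qpoch u p = 0" using qpoch_eq_0_iff[OF p(1)] by blast
    then show ?thesis by (simp add: theta_def)
  next
    case False
    then obtain m where "k = int (Suc m)" by (metis gr0_implies_Suc not_le pos_int_cases)
    then have "p ^ m * (p / u) = 1" using p k by (simp del: of_nat_Suc)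
    then have "qpoch (p / u) p = 0" using qpoch_eq_0_iff[OF p(1)] by blast
    then show ?thesis by (simp add: theta_def)
  qed
qed

end

section \<open>The elliptic gamma function\<close>

context
  fixes p q :: complex assumes p: "norm p < 1" "p \<noteq> 0" and q: "norm q < 1" "q \<noteq> 0"
begin

lemma egamma_times_q:
  assumes "u \<noteq> 0" "norm u < 1"
  shows "egamma (q * u) p q = theta u p * egamma u p q"
proof -
  have "norm (q * u) < 1"
    using assms q norm_mult_less[of q 1 u 1] by simp
  then have "qpoch2 (q * u) p q \<noteq> 0" "qpoch u p \<noteq> 0"
    using qpoch2_nonzero qpoch_nonzero p q assms by auto
  then show ?thesis
    using qpoch2_step_q[OF p(1) q(1), of u] qpoch2_step_q[OF p(1) q(1), of "p / u"] q
    by (simp add: egamma_def theta_def field_simps)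
qed

text \<open>
  Every \<open>(u; p, q)\<close> is the product of a row, a column and \<open>(pqu; p, q)\<close>, and the last factor
  cancels against the numerators of the gamma functions, which do not vanish for \<open>|u| = 1\<close>. At
  \<open>u = 1\<close> the left-hand side is \<open>1 / 0 = 0\<close>, in agreement with the double zero on the right.
\<close>

lemma inverse_egamma_reflection:
  assumes "norm u = 1"
  shows "1 / (egamma u p q * egamma (1 / u) p q) = theta (1 / u) p * theta u q"
proof -
  have u0: "u \<noteq> 0" using assms by auto
  have "norm (p * q) < 1" using p q norm_mult_less[of p 1 q 1] by simp
  then have "norm (p * q * u) < 1" "norm (p * q / u) < 1"
    using assms by (simp_all add: norm_mult norm_divide)
  then have nz: "qpoch2 (p * q * u) p q \<noteq> 0" "qpoch2 (p * q / u) p q \<noteq> 0"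
    using qpoch2_nonzero p q by auto
  have "qpoch2 u p q = qpoch u q * (qpoch (p * u) p * qpoch2 (p * q * u) p q)"
    using qpoch2_step_p[OF p(1) q(1), of u] qpoch2_step_q[OF p(1) q(1), of "p * u"]
    by (simp add: mult_ac)
  moreover have "qpoch2 (1 / u) p q = qpoch (1 / u) p * (qpoch (q / u) q * qpoch2 (p * q / u) p q)"
    using qpoch2_step_q[OF p(1) q(1), of "1 / u"] qpoch2_step_p[OF p(1) q(1), of "q / u"]
    by (simp add: mult_ac)
  moreover have "egamma u p q * egamma (1 / u) p q =
      qpoch2 (p * q / u) p q / qpoch2 u p q * (qpoch2 (p * q * u) p q / qpoch2 (1 / u) p q)"
    by (simp add: egamma_def)
  ultimately show ?thesis
    using nz by (simp add: theta_def)
qed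

lemma egamma_holomorphic:
  assumes "g holomorphic_on S" "\<And>z. z \<in> S \<Longrightarrow> g z \<noteq> 0" "\<And>z. z \<in> S \<Longrightarrow> norm (g z) < 1"
  shows "(\<lambda>z. egamma (g z) p q) holomorphic_on S"
  unfolding egamma_def
  by (intro holomorphic_intros qpoch2_holomorphic p q assms) (use assms p q qpoch2_nonzero in auto)

end

section \<open>Quasi-periodic functions are determined by few zeros\<close>

text \<open>
  At the zeros of \<open>g\<close> the quotient is continued by \<open>f' / g'\<close>.
\<close>

lemma holomorphic_quotient:
  assumes S: "open S" and f: "f holomorphic_on S" and g: "g holomorphic_on S"
    and zeros: "\<And>z. z \<in> S \<Longrightarrow> g z = 0 \<Longrightarrow> f z = 0 \<and> deriv g z \<noteq> 0"
  obtains h where "h holomorphic_on S" "\<And>z. z \<in> S \<Longrightarrow> f z = g z * h z"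
proof
  define h where "h = (\<lambda>z. if g z = 0 then deriv f z / deriv g z else f z / g z)"
  show "f z = g z * h z" if "z \<in> S" for z
    using zeros[OF that] by (auto simp: h_def)
  show "h holomorphic_on S"
  proof (rule holomorphic_onI, rule field_differentiable_at_within)
    fix z assume z: "z \<in> S"
    define F where "F = (\<lambda>w. if w = z then deriv f z else (f w - f z) / (w - z))"
    define G where "G = (\<lambda>w. if w = z then deriv g z else (g w - g z) / (w - z))"
    have FG: "F holomorphic_on S" "G holomorphic_on S"
      unfolding F_def G_def by (rule pole_lemma_open[OF f S], rule pole_lemma_open[OF g S])
    show "h field_differentiable at z"
    proof (cases "g z = 0")
      case False
      define T where "T = {w \<in> S. g w \<noteq> 0}"
      have "open T" unfolding T_def
        using continuous_open_preimage[OF holomorphic_on_imp_continuous_on[OF g] S, of "-{0}"]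
        by (auto simp: vimage_def Int_def open_Compl)
      have "(\<lambda>w. f w / g w) holomorphic_on T"
        unfolding T_def by (intro holomorphic_intros holomorphic_on_subset[OF f] holomorphic_on_subset[OF g]) auto
      then have "h holomorphic_on T"
        by (rule holomorphic_transform) (auto simp: h_def T_def)
      then show ?thesis
        using \<open>open T\<close> False z by (auto simp: T_def intro: holomorphic_on_imp_differentiable_at)
    next
      case True
      define T where "T = {w \<in> S. G w \<noteq> 0}"
      have "open T" unfolding T_def
        using continuous_open_preimage[OF holomorphic_on_imp_continuous_on[OF FG(2)] S, of "-{0}"]
        by (auto simp: vimage_def Int_def open_Compl)
      have "(\<lambda>w. F w / G w) holomorphic_on T"
        unfolding T_def by (intro holomorphic_intros holomorphic_on_subset[OF FG(1)] holomorphic_on_subset[OF FG(2)]) auto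
      then have "h holomorphic_on T"
        by (rule holomorphic_transform)
           (use True zeros[OF z] in \<open>auto simp: h_def T_def F_def G_def\<close>)
      moreover have "z \<in> T" using True zeros[OF z] z by (auto simp: T_def G_def)
      ultimately show ?thesis
        using \<open>open T\<close> by (auto intro: holomorphic_on_imp_differentiable_at)
    qed
  qed
qed

text \<open>
  At a zero of \<open>g\<close> the derivative of \<open>g \<phi> = 0\<close> is \<open>g' \<phi> = 0\<close>.
\<close>

lemma holomorphic_cancel_simple_zeros:
  assumes S: "open S" and g: "g holomorphic_on S" and \<phi>: "\<phi> holomorphic_on S"
    and zeros: "\<And>z. z \<in> S \<Longrightarrow> g z = 0 \<Longrightarrow> deriv g z \<noteq> 0"
    and eq: "\<And>z. z \<in> S \<Longrightarrow> g z * \<phi> z = 0" and z: "z \<in> S"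
  shows "\<phi> z = (0::complex)"
proof (cases "g z = 0")
  case True
  have "((\<lambda>z. g z * \<phi> z) has_field_derivative (g z * deriv \<phi> z + deriv g z * \<phi> z)) (at z)"
    by (rule DERIV_mult' holomorphic_derivI[OF g S z] holomorphic_derivI[OF \<phi> S z])+
  moreover have "((\<lambda>z. g z * \<phi> z) has_field_derivative 0) (at z)"
    by (rule has_field_derivative_transform_within_open[of "\<lambda>_. 0", OF _ S z]) (use eq in auto)
  ultimately show ?thesis using DERIV_unique True zeros[OF z] by fastforce
qed (use eq[OF z] in auto)

context
  fixes p :: complex assumes p: "norm p < 1" "p \<noteq> 0"
begin

lemma power_int_inj: assumes "p powi i = p powi j" shows "i = j"
proof -
  have "norm p powi i = norm p powi j" using assms by (metis norm_power_int)
  then have "norm p powr of_int i = norm p powr of_int j"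
    using p powr_real_of_int'[of "norm p"] by simp
  then show ?thesis using p by (subst (asm) powr_inj) auto
qed

lemma theta_shift_holomorphic: "x \<noteq> 0 \<Longrightarrow> (\<lambda>z. theta (z / x) p) holomorphic_on (- {0})"
  by (intro theta_holomorphic p holomorphic_intros) auto

text \<open>
  At \<open>u = 1\<close> the zero comes from the factor \<open>1 - u\<close> alone, and differentiating
  \<open>\<theta>(pu) = - \<theta>(u) / u\<close> carries the derivative from one zero \<open>p\<^sup>k\<close> to the next.
\<close>

lemma theta_simple_zeros:
  assumes u: "u \<noteq> 0" and 0: "theta u p = 0"
  shows "deriv (\<lambda>u. theta u p) u \<noteq> 0"
proof -
  have holo: "(\<lambda>u. theta u p) holomorphic_on (- {0})"
    using theta_shift_holomorphic[of 1] by simp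
  have D: "((\<lambda>u. theta u p) has_field_derivative deriv (\<lambda>u. theta u p) v) (at v)" if "v \<noteq> 0" for v
    by (rule holomorphic_derivI[OF holo]) (use that in auto)
  have base: "deriv (\<lambda>u. theta u p) 1 \<noteq> 0"
  proof -
    define k where "k = (\<lambda>u. qpoch (p * u) p * qpoch (p / u) p)"
    have "k holomorphic_on (- {0})"
      unfolding k_def by (intro holomorphic_intros qpoch_holomorphic p) auto
    then have "(k has_field_derivative deriv k 1) (at 1)"
      by (rule holomorphic_derivI) auto
    then have "((\<lambda>u. (1 - u) * k u) has_field_derivative - k 1) (at 1)"
      by (auto intro!: derivative_eq_intros)
    moreover have "(\<lambda>u. theta u p) = (\<lambda>u. (1 - u) * k u)"
    proof
      fix u show "theta u p = (1 - u) * k u"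
        using qpoch_step[OF p(1), of u] by (simp add: theta_def k_def)
    qed
    ultimately have "deriv (\<lambda>u. theta u p) 1 = - k 1" by (auto intro: DERIV_imp_deriv)
    then show ?thesis using qpoch_nonzero[OF p(1)] p by (simp add: k_def)
  qed
  have step: "deriv (\<lambda>u. theta u p) (p * v) * p = - deriv (\<lambda>u. theta u p) v / v"
    if v: "v \<noteq> 0" "theta v p = 0" for v
  proof -
    have "((\<lambda>u. theta (p * u) p) has_field_derivative deriv (\<lambda>u. theta u p) (p * v) * p) (at v)"
      by (rule DERIV_chain'[where g = "\<lambda>u. theta u p" and f = "\<lambda>u. p * u"])
         (use D[of "p * v"] v p in \<open>auto intro!: derivative_eq_intros\<close>)
    moreover have "((\<lambda>u. theta (p * u) p) has_field_derivative - deriv (\<lambda>u. theta u p) v / v) (at v)"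
    proof (rule has_field_derivative_transform_within_open[of "\<lambda>u. - theta u p / u" _ _ "- {0}"])
      show "((\<lambda>u. - theta u p / u) has_field_derivative - deriv (\<lambda>u. theta u p) v / v) (at v)"
        by (rule derivative_eq_intros D v refl)+ (use v in \<open>auto simp: field_simps\<close>)
    qed (use v theta_times_p[OF p] in auto)
    ultimately show ?thesis by (rule DERIV_unique)
  qed
  have zero: "theta (p powi k) p = 0" for k :: int
    using theta_eq_0_iff[OF p, of "p powi k"] p by auto
  have "deriv (\<lambda>u. theta u p) (p powi k) \<noteq> 0" for k :: int
  proof (induction k rule: int_induct[where k = 0])
    case base show ?case using \<open>deriv (\<lambda>u. theta u p) 1 \<noteq> 0\<close> by simp
  next
    case (step1 i)
    have "p powi (i + 1) = p * p powi i" using p by (simp add: power_int_add)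
    then show ?case using step[of "p powi i"] zero[of i] step1 p by auto
  next
    case (step2 i)
    have "p powi i = p * p powi (i - 1)" using p by (simp add: power_int_diff)
    then show ?case using step[of "p powi (i - 1)"] zero[of "i - 1"] step2 p by auto
  qed
  then show ?thesis using theta_eq_0_iff[OF p u] 0 by auto
qed

lemma shifted_theta_simple_zeros:
  assumes "x \<noteq> 0" "z \<noteq> 0" "theta (z / x) p = 0"
  shows "deriv (\<lambda>z. theta (z / x) p) z \<noteq> 0"
proof -
  have "(\<lambda>u. theta u p) holomorphic_on (- {0})"
    using theta_shift_holomorphic[of 1] by simp
  then have "((\<lambda>u. theta u p) has_field_derivative deriv (\<lambda>u. theta u p) (z / x)) (at (z / x))"
    by (rule holomorphic_derivI) (use assms in auto)
  then have "((\<lambda>z. theta (z / x) p) has_field_derivative deriv (\<lambda>u. theta u p) (z / x) * (1 / x)) (at z)"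
    by (rule DERIV_chain'[where f = "\<lambda>z. z / x", rotated])
       (use assms in \<open>auto intro!: derivative_eq_intros\<close>)
  then have "deriv (\<lambda>z. theta (z / x) p) z = deriv (\<lambda>u. theta u p) (z / x) * (1 / x)"
    by (rule DERIV_imp_deriv)
  then show ?thesis using theta_simple_zeros[of "z / x"] assms by auto
qed

text \<open>
  For real \<open>l\<close> with \<open>|c| |p|\<^sup>l = 1\<close> the function \<open>|f(z)| |z|\<^sup>l\<close> is invariant under \<open>z \<mapsto> pz\<close>, hence
  bounded by its maximum on the compact annulus \<open>|p| \<le> |z| \<le> 1\<close>. So \<open>w \<mapsto> f(e\<^sup>w) e\<^sup>l\<^sup>w\<close> is bounded and
  entire, and Liouville's theorem makes it constant.
\<close>

lemma multiplicative_function_with_zero: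
  assumes f: "f holomorphic_on (- {0})" and per: "\<And>z. z \<noteq> 0 \<Longrightarrow> f (p * z) = c * f z"
    and c: "c \<noteq> 0" and x: "x \<noteq> 0" "f x = 0" and z: "z \<noteq> 0"
  shows "f z = 0"
proof -
  define l where "l = - ln (norm c) / ln (norm p)"
  define M where "M = (\<lambda>z. norm (f z) * norm z powr l)"
  have lnp: "ln (norm p) < 0" using p by simp
  have "norm p powr l = exp (- ln (norm c))"
    unfolding powr_def l_def using lnp p by simp
  then have cp: "norm c * norm p powr l = 1" using c by (simp add: exp_minus)
  have M1: "M (p * z) = M z" if "z \<noteq> 0" for z
  proof -
    have "M (p * z) = (norm c * norm p powr l) * M z"
      using that per[OF that] by (simp add: M_def norm_mult powr_mult mult_ac)
    then show ?thesis by (simp add: cp)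
  qed
  have Mk: "M (p powi k * z) = M z" if "z \<noteq> 0" for k :: int and z
  proof (induction k rule: int_induct[where k = 0])
    case (step1 i)
    have "p powi (i + 1) * z = p * (p powi i * z)" using p by (simp add: power_int_add)
    then show ?case using M1[of "p powi i * z"] that step1 p by (simp add: mult.assoc)
  next
    case (step2 i)
    have "p powi i * z = p * (p powi (i - 1) * z)" using p by (simp add: power_int_diff)
    then show ?case using M1[of "p powi (i - 1) * z"] that step2 p by (simp add: mult.assoc)
  qed simp
  define K where "K = {z::complex. norm p \<le> norm z \<and> norm z \<le> 1}"
  have "K = cball 0 1 - ball 0 (norm p)" by (auto simp: K_def)
  then have "compact K" by (simp add: compact_diff)
  moreover have "continuous_on K M"
    unfolding M_def using p
    by (intro continuous_intros holomorphic_on_imp_continuous_on[OF holomorphic_on_subset[OF f]])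
       (auto simp: K_def)
  ultimately have "bounded (M ` K)" by (intro compact_imp_bounded compact_continuous_image)
  then obtain B where B: "\<And>z. z \<in> K \<Longrightarrow> norm (M z) \<le> B" unfolding bounded_iff by blast
  have bnd: "norm (M z) \<le> B" if "z \<noteq> 0" for z
  proof -
    define L where "L = ln (norm z) / ln (norm p)"
    define k where "k = - \<lfloor>L\<rfloor>"
    have eq: "norm (p powi k * z) = exp ((of_int k + L) * ln (norm p))"
    proof -
      have "norm (p powi k * z) = norm p powr (of_int k) * norm z"
        using p by (simp add: norm_mult norm_power_int powr_real_of_int')
      also have "\<dots> = exp (of_int k * ln (norm p) + ln (norm z))"
        using p that by (simp add: powr_def exp_add)
      finally show ?thesis using lnp by (simp add: L_def field_simps)
    qed
    have k: "0 \<le> of_int k + L" "of_int k + L \<le> 1" unfolding k_def by linarith+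
    have "(of_int k + L) * ln (norm p) \<le> 0" "1 * ln (norm p) \<le> (of_int k + L) * ln (norm p)"
      using k lnp mult_nonneg_nonpos[of "of_int k + L" "ln (norm p)"]
        mult_right_mono_neg[of "of_int k + L" 1 "ln (norm p)"] by auto
    then have "exp (ln (norm p)) \<le> norm (p powi k * z)" "norm (p powi k * z) \<le> 1"
      unfolding eq by auto
    then have "p powi k * z \<in> K" using p by (auto simp: K_def)
    then show ?thesis using B Mk[OF that] by metis
  qed
  define g where "g = (\<lambda>w. f (exp w) * exp (of_real l * w))"
  have "(f \<circ> exp) holomorphic_on UNIV"
    by (rule holomorphic_on_compose[OF holomorphic_on_exp holomorphic_on_subset[OF f]]) auto
  then have g: "g holomorphic_on UNIV"
    unfolding g_def o_def by (intro holomorphic_intros)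
  have "norm (g w) \<le> B" for w
  proof -
    have "norm (g w) = M (exp w)" by (simp add: g_def M_def norm_mult powr_def)
    then show ?thesis using bnd[of "exp w"] by auto
  qed
  then have "bounded (range g)" unfolding bounded_iff by blast
  then obtain C where C: "\<And>w. g w = C" using Liouville_theorem[OF g] unfolding constant_on_def by blast
  have "g (Ln x) = 0" using x by (simp add: g_def)
  then have "g (Ln z) = 0" using C by simp
  then show ?thesis using z by (simp add: g_def)
qed

text \<open>
  Dividing by \<open>\<theta>(z/x)\<close>, where \<open>x\<close> is one of the zeros, lowers \<open>d\<close> by one and keeps the other
  zeros. After \<open>d\<close> divisions the function is multiplicative and one zero is left over.
\<close>

lemma quasi_periodic_eq_0:
  assumes "f holomorphic_on (- {0})" "\<And>z. z \<noteq> 0 \<Longrightarrow> f (p * z) = c * f z / z ^ d"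
    and "finite X" "0 \<notin> X" "card X = Suc d" "\<And>x. x \<in> X \<Longrightarrow> f x = 0"
    and "\<And>x y. x \<in> X \<Longrightarrow> y \<in> X \<Longrightarrow> x \<noteq> y \<Longrightarrow> theta (x / y) p \<noteq> 0" and z: "z \<noteq> 0"
  shows "f z = 0"
proof (cases "c = 0")
  case True
  then show ?thesis using assms(2)[of "z / p"] p z by simp
next
  case False
  then show ?thesis using assms(1-7)
  proof (induction d arbitrary: f c X)
    case 0
    then obtain x where "X = {x}" by (metis card_1_singletonE One_nat_def)
    then show ?case
      using multiplicative_function_with_zero[of f c x] 0 z by auto
  next
    case (Suc d)
    note f = Suc.prems(2) and per = Suc.prems(3)
    obtain x where x: "x \<in> X" "x \<noteq> 0" using Suc.prems by (metis card.empty equals0I nat.distinct(1))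
    define g where "g = (\<lambda>z. theta (z / x) p)"
    have g: "g holomorphic_on (- {0})" unfolding g_def by (rule theta_shift_holomorphic[OF x(2)])
    have gsimple: "deriv g z \<noteq> 0" if "z \<in> - {0}" "g z = 0" for z
      using shifted_theta_simple_zeros[of x z] that x by (simp add: g_def)
    have gp: "g (p * z) = - x * g z / z" if "z \<noteq> 0" for z
      using theta_times_p[OF p, of "z / x"] that x by (simp add: g_def)
    have fx: "f (p powi k * x) = 0" for k :: int
    proof (induction k rule: int_induct[where k = 0])
      case base then show ?case using Suc.prems x by simp
    next
      case (step1 i)
      have "p powi (i + 1) * x = p * (p powi i * x)" using p by (simp add: power_int_add)
      then show ?case using per[of "p powi i * x"] step1 p x by (simp add: mult.assoc)
    next
      case (step2 i)
      have "p powi i * x = p * (p powi (i - 1) * x)" using p by (simp add: power_int_diff)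
      then show ?case using per[of "p powi (i - 1) * x"] step2 p x Suc.prems(1) by (simp add: mult.assoc)
    qed
    have fz: "f z = 0" if "z \<in> - {0}" "g z = 0" for z
    proof -
      have "theta (z / x) p = 0" "z / x \<noteq> 0" using that x by (auto simp: g_def)
      then obtain k :: int where "z / x = p powi k"
        using that x theta_eq_0_iff[OF p, of "z / x"] unfolding g_def by auto
      then have "z = p powi k * x" using x by (simp add: field_simps)
      then show ?thesis using fx by simp
    qed
    obtain h where h: "h holomorphic_on (- {0})" and fgh: "\<And>z. z \<in> - {0} \<Longrightarrow> f z = g z * h z"
      by (rule holomorphic_quotient[OF _ f g]) (use fz gsimple in auto)
    have hp: "h (p * z) = (- c / x) * h z / z ^ d" if z: "z \<noteq> 0" for z
    proof -
      define \<phi> where "\<phi> = (\<lambda>z. h (p * z) - (- c / x) * h z / z ^ d)"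
      have "(h \<circ> (\<lambda>z. p * z)) holomorphic_on (- {0})"
        by (rule holomorphic_on_compose[OF _ holomorphic_on_subset[OF h]]) (use p in \<open>auto intro!: holomorphic_intros\<close>)
      then have "\<phi> holomorphic_on (- {0})"
        unfolding \<phi>_def o_def by (intro holomorphic_intros h) auto
      moreover have "g z * \<phi> z = 0" if z: "z \<in> - {0}" for z
      proof -
        have "g (p * z) * h (p * z) = c * (g z * h z) / z ^ Suc d"
          using per[of z] fgh[of z] fgh[of "p * z"] z p by auto
        then have "- x * g z / z * h (p * z) = c * (g z * h z) / z ^ Suc d"
          using gp z by auto
        then show ?thesis using z x
          by (simp add: \<phi>_def field_simps) (metis add.commute neg_eq_iff_add_eq_0)
      qed
      ultimately have "\<phi> z = 0"
        using holomorphic_cancel_simple_zeros[of "- {0}" g \<phi> z] g gsimple z by auto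
      then show ?thesis by (simp add: \<phi>_def eq_neg_iff_add_eq_0)
    qed
    have "h y = 0" if "y \<in> X - {x}" for y
    proof -
      have "g y \<noteq> 0" "f y = 0" "y \<noteq> 0" using Suc.prems that x by (auto simp: g_def)
      then show ?thesis using fgh[of y] by auto
    qed
    then have "h z = 0"
      using Suc.prems x h hp by (intro Suc.IH[of "- c / x" h "X - {x}"]) auto
    then show ?case using fgh z by auto
  qed
qed

text \<open>
  Such a function has degree \<open>2N\<close>. Modulo \<open>p\<^sup>\<int>\<close> the inversion \<open>y \<mapsto> 1 / y\<close> has the four fixed points
  \<open>y\<^sup>2 \<in> {1, p}\<close>, where an odd function vanishes. Together with \<open>N - 1\<close> given zeros and their inverses
  these are \<open>2N + 2\<close> zeros, which is too many.
\<close>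

lemma odd_quasi_periodic_eq_0:
  assumes h: "h holomorphic_on (- {0})"
    and odd: "\<And>y. y \<noteq> 0 \<Longrightarrow> h (1 / y) = - h y"
    and per: "\<And>y. y \<noteq> 0 \<Longrightarrow> h (p * y) = h y / (p * y\<^sup>2) ^ N"
    and X: "finite X" "0 \<notin> X" "card X + 1 \<ge> N" "\<And>x. x \<in> X \<Longrightarrow> h x = 0"
    and X1: "\<And>x. x \<in> X \<Longrightarrow> theta (x\<^sup>2) p \<noteq> 0"
    and X2: "\<And>x y. x \<in> X \<Longrightarrow> y \<in> X \<Longrightarrow> x \<noteq> y \<Longrightarrow> theta (x * y) p \<noteq> 0 \<and> theta (x / y) p \<noteq> 0"
    and z: "z \<noteq> 0"
  shows "h z = 0"
proof -
  \<comment> \<open>The fixed points of the inversion modulo \<open>p\<^sup>\<int>\<close> are represented by \<open>\<plusminus>1\<close> and \<open>\<plusminus>r\<close>.\<close>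
  define r where "r = csqrt p"
  have r2: "r\<^sup>2 = p" and r0: "r \<noteq> 0" using p by (auto simp: r_def)
  have th: "theta u p = 0 \<longleftrightarrow> (\<exists>k::int. u = p powi k)" if "u \<noteq> 0" for u
    using theta_eq_0_iff[OF p that] .
  have odd_powi: "p \<noteq> p powi (2 * k)" for k :: int
  proof
    assume "p = p powi (2 * k)"
    then have "p powi 1 = p powi (2 * k)" by (simp only: power_int_1_right)
    then have "1 = 2 * k" by (rule power_int_inj)
    then show False by presburger
  qed
  have one_powi: "- 1 \<noteq> p powi k" for k :: int
  proof
    assume *: "- 1 = p powi k"
    have "p powi (2 * k) = p powi k * p powi k" unfolding mult_2 using p by (intro power_int_add) auto
    also have "\<dots> = p powi 0" unfolding *[symmetric] by simp
    finally have "k = 0" using power_int_inj[of "2 * k" 0] by simp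
    then show False using * by simp
  qed
  define E where "E = {1, - 1, r, - r}"
  have sq: "(p powi k)\<^sup>2 = p powi (2 * k)" for k :: int
    unfolding power2_eq_square mult_2 using p by (intro power_int_add[symmetric]) auto
  have rE: "theta r p \<noteq> 0" "theta (- r) p \<noteq> 0" "theta (1 / r) p \<noteq> 0" "theta (- 1 / r) p \<noteq> 0" "theta (- 1) p \<noteq> 0"
  proof -
    have *: "theta e p \<noteq> 0" if "e\<^sup>2 = p" for e
    proof
      assume "theta e p = 0"
      moreover have "e \<noteq> 0" using that p by auto
      ultimately obtain k :: int where "e = p powi k" using th[of e] by auto
      then show False using odd_powi[of k] sq[of k] that by simp
    qed
    show "theta r p \<noteq> 0" "theta (- r) p \<noteq> 0" by (auto intro!: * simp: r2)
    then show "theta (1 / r) p \<noteq> 0" "theta (- 1 / r) p \<noteq> 0"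
      using theta_inverse[OF p, of r] theta_inverse[OF p, of "- r"] r0 by (auto simp: field_simps)
    show "theta (- 1) p \<noteq> 0" using th[of "- 1"] one_powi by auto
  qed
  have EE: "theta (x / y) p \<noteq> 0" if "x \<in> E" "y \<in> E" "x \<noteq> y" for x y
    using that rE r0 by (auto simp: E_def)
  have XE: "theta (x / e) p \<noteq> 0 \<and> theta (x * e) p \<noteq> 0 " if "x \<in> X" "e \<in> E" for x e
  proof -
    have e2: "e\<^sup>2 = 1 \<or> e\<^sup>2 = p" "e \<noteq> 0" using that r2 r0 by (auto simp: E_def)
    have x0: "x \<noteq> 0" using that X by auto
    have no: "x\<^sup>2 \<noteq> p powi k" for k :: int using X1[OF that(1)] th[of "x\<^sup>2"] x0 by auto
    have "x / e \<noteq> p powi k" for k :: int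
    proof
      assume *: "x / e = p powi k"
      have "x\<^sup>2 = (x / e)\<^sup>2 * e\<^sup>2" using e2 by (simp add: power_divide)
      then have "x\<^sup>2 = p powi (2 * k) * e\<^sup>2" unfolding * sq .
      then have "x\<^sup>2 = p powi (2 * k) \<or> x\<^sup>2 = p powi (2 * k + 1)" using e2 p by (auto simp: power_int_add)
      then show False using no by blast
    qed
    moreover have "x * e \<noteq> p powi k" for k :: int
    proof
      assume *: "x * e = p powi k"
      have "x\<^sup>2 = (x * e)\<^sup>2 / e\<^sup>2" using e2 by (simp add: power_mult_distrib)
      then have "x\<^sup>2 = p powi (2 * k) / e\<^sup>2" unfolding * sq .
      then have "x\<^sup>2 = p powi (2 * k) \<or> x\<^sup>2 = p powi (2 * k - 1)" using e2 p by (auto simp: power_int_diff)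
      then show False using no by blast
    qed
    ultimately show ?thesis using th[of "x / e"] th[of "x * e"] x0 e2 by auto
  qed
  have inv: "theta (1 / u) p \<noteq> 0" if "theta u p \<noteq> 0" "u \<noteq> 0" for u
    using theta_inverse[OF p that(2)] that by simp
  define X' where "X' = (\<lambda>x. 1 / x) ` X"
  define Z where "Z = X \<union> X' \<union> E"
  have E0: "0 \<notin> E" using r0 by (auto simp: E_def)
  have th1: "theta 1 p = 0" using theta_at_1 p by blast
  have disj: "X \<inter> X' = {}"
  proof -
    have False if "x \<in> X" "y \<in> X" "x = 1 / y" for x y
    proof -
      have "x * y = 1" "y \<noteq> 0" using that X by auto
      then show False using X1[OF that(1)] X2[OF that(1,2)] th1
        by (metis power2_eq_square)
    qed
    then show ?thesis by (auto simp: X'_def)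
  qed
  have disj2: "(X \<union> X') \<inter> E = {}"
  proof -
    have nz: "x \<noteq> 0" if "x \<in> X" for x using X that by auto
    have "x \<notin> E" if "x \<in> X" for x
    proof
      assume "x \<in> E"
      from XE[OF that this] show False using th1 nz[OF that] by simp
    qed
    moreover have "1 / x \<notin> E" if "x \<in> X" for x
    proof
      assume "1 / x \<in> E"
      from XE[OF that this] show False using th1 nz[OF that] by simp
    qed
    ultimately show ?thesis by (auto simp: X'_def)
  qed
  have cE: "card E = 4"
  proof -
    have "r \<noteq> 1" "r \<noteq> - 1" using r2 p by auto
    moreover from this have "- r \<noteq> 1" by (metis minus_minus)
    ultimately show ?thesis using r0 by (auto simp: E_def)
  qed
  have cX': "card X' = card X"
    unfolding X'_def by (rule card_image) (auto simp: inj_on_def)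
  have fin: "finite X'" "finite E" using X by (auto simp: X'_def E_def)
  have "card Z = card X + card X' + card E"
    unfolding Z_def using disj disj2 X fin by (simp add: card_Un_disjoint)
  then have "Suc (2 * N) \<le> card Z" using cE cX' X by linarith
  then obtain Y where Y: "Y \<subseteq> Z" "card Y = Suc (2 * N)" "finite Y"
    using obtain_subset_with_card_n by blast
  have hE: "h e = 0" if eE: "e \<in> E" for e
  proof -
    have e0: "e \<noteq> 0" using eE E0 by auto
    have e: "h (1 / e) = - h e" "e \<noteq> 0" by (rule odd[OF e0], rule e0)
    consider "1 / e = e" | "e\<^sup>2 = p" using eE r2 by (auto simp: E_def)
    then show ?thesis
    proof cases
      case 2
      have "p * (1 / e) = e" using 2 e by (auto simp: power2_eq_square)
      then have "h e = h (1 / e) / (p * (1 / e)\<^sup>2) ^ N" using per[of "1 / e"] e by auto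
      also have "p * (1 / e)\<^sup>2 = 1" using 2 p e by (simp add: power_divide)
      finally show ?thesis using e by simp
    qed (use e in auto)
  qed
  have hZ: "h x = 0" if xZ: "x \<in> Z" for x
  proof -
    consider "x \<in> X" | y where "y \<in> X" "x = 1 / y" | "x \<in> E" using xZ by (auto simp: Z_def X'_def)
    then show ?thesis
    proof cases
      case 2
      then have "y \<noteq> 0" using X by auto
      then show ?thesis using odd[of y] X(4) 2 by simp
    qed (use X hE in auto)
  qed
  have ZZ: "theta (x / y) p \<noteq> 0" if xyZ: "x \<in> Z" "y \<in> Z" "x \<noteq> y" for x y
  proof -
    have nz: "x \<noteq> 0" if "x \<in> X" for x using X that by auto
    have sq': "theta (x * x) p \<noteq> 0" if "x \<in> X" for x using X1[OF that] by (simp add: power2_eq_square)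
    have mult: "theta (x * y) p \<noteq> 0" if "x \<in> X" "y \<in> X" for x y
      using X2[OF that] sq'[of x] that by (cases "x = y") auto
    have inv1: "theta (1 / (x * y)) p \<noteq> 0" if "x \<in> X" "y \<in> X" for x y
      using inv[OF mult[OF that]] nz that by auto
    have inv2: "theta (e / x) p \<noteq> 0" "theta (1 / (x * e)) p \<noteq> 0" if "x \<in> X" "e \<in> E" for x e
      using inv[of "x / e"] inv[of "x * e"] XE[OF that] nz[OF that(1)] that E0 by auto
    consider "x \<in> X" "y \<in> X" | "x \<in> X" "y \<in> E" | "x \<in> E" "y \<in> X" | "x \<in> E" "y \<in> E"
      | y' where "x \<in> X" "y = 1 / y'" "y' \<in> X" | x' where "x = 1 / x'" "x' \<in> X" "y \<in> X"
      | x' where "x = 1 / x'" "x' \<in> X" "y \<in> E" | y' where "x \<in> E" "y = 1 / y'" "y' \<in> X"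
      | x' y' where "x = 1 / x'" "x' \<in> X" "y = 1 / y'" "y' \<in> X"
      using xyZ unfolding Z_def X'_def by blast
    then show ?thesis
    proof cases
      case 9
      then show ?thesis using X2[of y' x'] xyZ by auto
    qed (use xyZ X2 XE EE mult inv1 inv2 in \<open>auto simp: mult.commute\<close>)
  qed
  show ?thesis
  proof (rule quasi_periodic_eq_0[OF h _ Y(3) _ Y(2) _ _ z])
    show "h (p * z) = (1 / p ^ N) * h z / z ^ (2 * N)" if "z \<noteq> 0" for z
      using per[OF that] by (simp add: power_mult_distrib power_mult)
    have "0 \<notin> Z" using X E0 by (auto simp: Z_def X'_def)
    then show "0 \<notin> Y" using Y by auto
    show "theta (x / y) p \<noteq> 0" if "x \<in> Y" "y \<in> Y" "x \<noteq> y" for x y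
      using that Y ZZ by blast
  qed (use Y hZ in auto)
qed

end

section \<open>Theta functions of type BC\<close>

text \<open>
  In the variable \<open>z\<close> this is the theta function of degree one that is invariant under inversion
  and vanishes at \<open>x\<^sup>\<plusminus>\<^sup>1\<close>.
\<close>

definition theta_pair :: "complex \<Rightarrow> complex \<Rightarrow> complex \<Rightarrow> complex" where
  "theta_pair p x z = theta (x * z) p * theta (x / z) p"

text \<open>
  The sign \<open>e\<close> is the parity under inversion. With the multiplier in the form \<open>(py\<^sup>2)\<^sup>-\<^sup>N\<close> the degrees
  \<open>N\<close> of factors add up, for both parities.
\<close>

definition bc_theta :: "complex \<Rightarrow> complex \<Rightarrow> nat \<Rightarrow> (complex \<Rightarrow> complex) \<Rightarrow> bool" where
  "bc_theta p e N h \<longleftrightarrow> h holomorphic_on (- {0}) \<and> (\<forall>y. y \<noteq> 0 \<longrightarrow> h (1 / y) = e * h y) \<and>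
     (\<forall>y. y \<noteq> 0 \<longrightarrow> h (p * y) = h y / (p * y\<^sup>2) ^ N)"

lemma bc_theta_mult:
  assumes "bc_theta p e M g" "bc_theta p e' N h"
  shows "bc_theta p (e * e') (M + N) (\<lambda>y. g y * h y)"
  using assms unfolding bc_theta_def by (auto intro!: holomorphic_intros simp: power_add)

lemma bc_theta_prod:
  assumes "finite J" "\<And>j. j \<in> J \<Longrightarrow> bc_theta p 1 1 (g j)"
  shows "bc_theta p 1 (card J) (\<lambda>y. \<Prod>j\<in>J. g j y)"
  using assms
proof (induction J rule: finite_induct)
  case empty
  then show ?case by (simp add: bc_theta_def)
next
  case (insert j J)
  then show ?case using bc_theta_mult[of p 1 1 "g j" 1 "card J" "\<lambda>y. \<Prod>j\<in>J. g j y"] by simp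
qed

lemma bc_theta_cmult: "bc_theta p e N h \<Longrightarrow> bc_theta p e N (\<lambda>y. c * h y)"
  unfolding bc_theta_def by (auto intro!: holomorphic_intros)

lemma bc_theta_add:
  "bc_theta p e N g \<Longrightarrow> bc_theta p e N h \<Longrightarrow> bc_theta p e N (\<lambda>y. g y + h y)"
  unfolding bc_theta_def by (auto intro!: holomorphic_intros simp: algebra_simps add_divide_distrib)

lemma bc_theta_diff:
  "bc_theta p e N g \<Longrightarrow> bc_theta p e N h \<Longrightarrow> bc_theta p e N (\<lambda>y. g y - h y)"
  unfolding bc_theta_def by (auto intro!: holomorphic_intros simp: algebra_simps diff_divide_distrib)

lemma bc_theta_sum:
  "(\<And>i. i \<in> A \<Longrightarrow> bc_theta p e N (h i)) \<Longrightarrow> bc_theta p e N (\<lambda>y. \<Sum>i\<in>A. h i y)"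
  unfolding bc_theta_def
  by (auto intro!: holomorphic_intros simp: sum_distrib_left sum_divide_distrib)

lemma theta_pair_self: "norm p < 1 \<Longrightarrow> x \<noteq> 0 \<Longrightarrow> theta_pair p x x = 0"
  by (simp add: theta_pair_def theta_at_1)

context
  fixes p :: complex assumes p: "norm p < 1" "p \<noteq> 0"
begin

lemma theta_pair_inverse_right:
  "x \<noteq> 0 \<Longrightarrow> z \<noteq> 0 \<Longrightarrow> theta_pair p x (1 / z) = theta_pair p x z"
  by (simp add: theta_pair_def)

lemma theta_pair_swap:
  assumes "x \<noteq> 0" "z \<noteq> 0"
  shows "theta_pair p z x = - (z / x) * theta_pair p x z"
  using theta_inverse[OF p, of "x / z"] assms by (simp add: theta_pair_def mult.commute)

lemma theta_pair_inverse_left: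
  assumes "x \<noteq> 0" "z \<noteq> 0"
  shows "theta_pair p (1 / x) z = theta_pair p x z / x\<^sup>2"
  using theta_inverse[OF p, of "x / z"] theta_inverse[OF p, of "x * z"] assms
  by (simp add: theta_pair_def power2_eq_square)

lemma bc_theta_pair:
  assumes x: "x \<noteq> 0" shows "bc_theta p 1 1 (theta_pair p x)"
  unfolding bc_theta_def
proof (intro conjI allI impI)
  have "(\<lambda>z. theta (x * z) p * theta (x / z) p) holomorphic_on (- {0})"
    by (intro holomorphic_intros theta_holomorphic p) (use x in auto)
  then show "theta_pair p x holomorphic_on (- {0})" by (simp add: theta_pair_def[abs_def])
  fix y :: complex assume y: "y \<noteq> 0"
  show "theta_pair p x (1 / y) = 1 * theta_pair p x y"
    using theta_pair_inverse_right[of x y] x y by simp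
  have "theta (x * (p * y)) p = - theta (x * y) p / (x * y)"
    using theta_times_p[OF p, of "x * y"] x y by (simp add: mult_ac)
  moreover have "theta (x / (p * y)) p = - (x / (p * y)) * theta (x / y) p"
    using theta_times_p[OF p, of "x / (p * y)"] x y p by (simp add: field_simps)
  ultimately show "theta_pair p x (p * y) = theta_pair p x y / (p * y\<^sup>2) ^ 1"
    using x y p by (simp add: theta_pair_def power2_eq_square)
qed

lemma theta_p_square_times:
  assumes "u \<noteq> 0" shows "theta (p\<^sup>2 * u) p = theta u p / (p * u\<^sup>2)"
  using theta_times_p[OF p, of "p * u"] theta_times_p[OF p, of u] assms p
  by (simp add: power2_eq_square mult.assoc)

text \<open>
  The factor of the common denominator which vanishes at the fixed points of \<open>y \<mapsto> 1 / y\<close> modulo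
  \<open>p\<^sup>\<int>\<close>.
\<close>

lemma bc_theta_square: "bc_theta p (- 1) 2 (\<lambda>y. theta (y\<^sup>2) p / y)"
  unfolding bc_theta_def
proof (intro conjI allI impI)
  show "(\<lambda>y. theta (y\<^sup>2) p / y) holomorphic_on (- {0})"
    by (intro holomorphic_intros theta_holomorphic p) auto
  fix y :: complex assume y: "y \<noteq> 0"
  show "theta ((1 / y)\<^sup>2) p / (1 / y) = - 1 * (theta (y\<^sup>2) p / y)"
    using theta_inverse[OF p, of "y\<^sup>2"] y by (simp add: power_divide power2_eq_square)
  show "theta ((p * y)\<^sup>2) p / (p * y) = theta (y\<^sup>2) p / y / (p * y\<^sup>2)\<^sup>2"
    using theta_p_square_times[of "y\<^sup>2"] y by (simp add: power_mult_distrib power2_eq_square mult_ac)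
qed

end

text \<open>
  The condition under which no denominator of the coboundary below vanishes.
\<close>

definition generic_point :: "complex \<Rightarrow> nat set \<Rightarrow> (nat \<Rightarrow> complex) \<Rightarrow> bool" where
  "generic_point p J z \<longleftrightarrow> (\<forall>j\<in>J. z j \<noteq> 0 \<and> theta ((z j)\<^sup>2) p \<noteq> 0) \<and>
     (\<forall>j\<in>J. \<forall>k\<in>J. j \<noteq> k \<longrightarrow> theta_pair p (z j) (z k) \<noteq> 0)"

section \<open>The coboundary of a test function\<close>

text \<open>
  The parameters are those of the weight after \<open>a\<^sub>6\<close> has been replaced by \<open>a\<^sub>6 / q\<close>, which is why
  the balancing condition has \<open>p\<close> in place of \<open>pq\<close>.
\<close>

locale bc_system =
  fixes p t :: complex and b :: "nat \<Rightarrow> complex" and K :: "nat set"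
  assumes p: "norm p < 1" "p \<noteq> 0" and t: "t \<noteq> 0" and b: "\<And>m. m \<in> {1..6} \<Longrightarrow> b m \<noteq> 0"
    and K: "finite K" "K \<noteq> {}"
    and balancing: "(\<Prod>m=1..6. b m) * t ^ (2 * card K - 2) = p"
begin

abbreviation \<theta> where "\<theta> u \<equiv> theta u p"
abbreviation v where "v \<equiv> theta_pair p"

definition coeff :: "complex \<Rightarrow> complex" where
  "coeff w = (\<Prod>m=1..6. \<theta> (b m * w)) / (w * \<theta> (w\<^sup>2))"

text \<open>
  In the summand with index \<open>i\<close> of the coboundary, \<open>w\<close> is \<open>z\<^sub>i\<^sup>\<plusminus>\<^sup>1\<close> and \<open>J\<close> the set of the other indices.
\<close>

definition shift_coeff :: "nat set \<Rightarrow> complex \<Rightarrow> (nat \<Rightarrow> complex) \<Rightarrow> complex" where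
  "shift_coeff J w z = coeff w * (\<Prod>j\<in>J. v (t * w) (z j) / v w (z j))"

definition test_fun :: "(nat \<Rightarrow> complex) \<Rightarrow> (nat \<Rightarrow> complex) \<Rightarrow> nat \<Rightarrow> nat set \<Rightarrow> (nat \<Rightarrow> complex) \<Rightarrow> complex" where
  "test_fun \<gamma> x N J z = (\<Sum>l<N. \<gamma> l * (\<Prod>j\<in>J. v (x l) (z j)))"

definition coboundary :: "(nat set \<Rightarrow> (nat \<Rightarrow> complex) \<Rightarrow> complex) \<Rightarrow> (nat \<Rightarrow> complex) \<Rightarrow> complex" where
  "coboundary g z = (\<Sum>i\<in>K. (shift_coeff (K - {i}) (z i) z + shift_coeff (K - {i}) (1 / z i) z) * g (K - {i}) z)"

text \<open>Numerator of \<^const>\<open>shift_coeff\<close> over the common denominator.\<close>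

definition numer :: "nat set \<Rightarrow> (nat \<Rightarrow> complex) \<Rightarrow> complex \<Rightarrow> complex" where
  "numer J z w = (\<Prod>m=1..6. \<theta> (b m * w)) / w\<^sup>2 * (\<Prod>j\<in>J. - (z j / w) * v (t * w) (z j))"

definition denom :: "nat set \<Rightarrow> (nat \<Rightarrow> complex) \<Rightarrow> complex \<Rightarrow> complex" where
  "denom J z y = \<theta> (y\<^sup>2) / y * (\<Prod>j\<in>J. v (z j) y)"

lemma denom_inverse:
  assumes "y \<noteq> 0" "\<And>j. j \<in> J \<Longrightarrow> z j \<noteq> 0"
  shows "denom J z (1 / y) = - denom J z y"
proof -
  have "\<theta> ((1 / y)\<^sup>2) / (1 / y) = - (\<theta> (y\<^sup>2) / y)"
    using bc_theta_square[OF p] assms(1) unfolding bc_theta_def by auto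
  then show ?thesis
    using assms theta_pair_inverse_right[OF p] by (simp add: denom_def)
qed

text \<open>
  The factors of the denominator \<open>v\<^sub>y(z\<^sub>j)\<close> and of \<^const>\<open>denom\<close> differ only by the factor \<open>- y / z\<^sub>j\<close>.
\<close>

lemma denom_times_shift_coeff:
  assumes y: "y \<noteq> 0" and z: "\<And>j. j \<in> J \<Longrightarrow> z j \<noteq> 0" and nz: "denom J z y \<noteq> 0" and J: "finite J"
  shows "denom J z y * shift_coeff J y z = numer J z y"
proof -
  have nz1: "\<theta> (y\<^sup>2) \<noteq> 0" "\<And>j. j \<in> J \<Longrightarrow> v (z j) y \<noteq> 0"
    using nz J by (auto simp: denom_def)
  have "v (z j) y * (v (t * y) (z j) / v y (z j)) = - (z j / y) * v (t * y) (z j)" if "j \<in> J" for j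
  proof -
    have "v y (z j) \<noteq> 0" using theta_pair_swap[OF p, of "z j" y] nz1(2)[OF that] y z[OF that] by auto
    then show ?thesis
      using theta_pair_swap[OF p, of y "z j"] y z[OF that] by simp
  qed
  then have "(\<Prod>j\<in>J. v (z j) y) * (\<Prod>j\<in>J. v (t * y) (z j) / v y (z j)) =
      (\<Prod>j\<in>J. - (z j / y) * v (t * y) (z j))"
    unfolding prod.distrib[symmetric] by (intro prod.cong) auto
  moreover have "\<theta> (y\<^sup>2) / y * coeff y = (\<Prod>m=1..6. \<theta> (b m * y)) / y\<^sup>2"
    using nz1 y by (simp add: coeff_def power2_eq_square)
  moreover have "denom J z y * shift_coeff J y z = (\<theta> (y\<^sup>2) / y * coeff y) *
      ((\<Prod>j\<in>J. v (z j) y) * (\<Prod>j\<in>J. v (t * y) (z j) / v y (z j)))"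
    by (simp only: denom_def shift_coeff_def mult_ac)
  ultimately show ?thesis by (simp only: numer_def)
qed

lemma denom_times_shift_coeff_inverse:
  assumes "y \<noteq> 0" "\<And>j. j \<in> J \<Longrightarrow> z j \<noteq> 0" "denom J z y \<noteq> 0" "finite J"
  shows "denom J z y * shift_coeff J (1 / y) z = - numer J z (1 / y)"
proof -
  have "denom J z (1 / y) * shift_coeff J (1 / y) z = numer J z (1 / y)"
    by (rule denom_times_shift_coeff) (use assms denom_inverse in auto)
  then show ?thesis using denom_inverse[of y J z] assms by (metis minus_mult_left minus_equation_iff)
qed

text \<open>
  The balancing condition enters here: it turns the multiplier of the numerator, which involves
  \<open>b\<^sub>1 \<cdots> b\<^sub>6\<close> and \<open>t\<close>, into a power of \<open>p y\<^sup>2\<close>.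
\<close>

lemma bc_theta_numer:
  assumes z: "\<And>j. j \<in> J \<Longrightarrow> z j \<noteq> 0" and J: "finite J" "card J = card K - 1"
  shows "bc_theta p (- 1) (card K + 2) (\<lambda>y. numer J z y - numer J z (1 / y))"
proof -
  define n where "n = card K"
  have n: "n \<ge> 1" using K by (simp add: n_def Suc_le_eq card_gt_0_iff)
  have per: "numer J z (p * y) = numer J z y / (p * y\<^sup>2) ^ (n + 2)" if y: "y \<noteq> 0" for y
  proof -
    have 1: "(\<Prod>m=1..6. \<theta> (b m * (p * y))) = (\<Prod>m=1..6. \<theta> (b m * y)) / ((\<Prod>m=1..6. b m) * y ^ 6)"
    proof -
      have "(\<Prod>m=1..6. \<theta> (b m * (p * y))) = (\<Prod>m=1..6. - (\<theta> (b m * y) / (b m * y)))"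
        using theta_times_p[OF p] b y by (intro prod.cong) (simp_all add: mult.left_commute[of _ p])
      also have "\<dots> = (\<Prod>m=1..6. \<theta> (b m * y)) / ((\<Prod>m=1..6. b m) * y ^ 6)"
        by (simp add: prod_uminus prod_dividef prod.distrib)
      finally show ?thesis .
    qed
    have 2: "- (z j / (p * y)) * v (t * (p * y)) (z j) =
        (- (z j / y) * v (t * y) (z j)) * (1 / (p * t\<^sup>2 * y\<^sup>2))" if "j \<in> J" for j
    proof -
      have "\<theta> (t * (p * y) * z j) = - \<theta> (t * y * z j) / (t * y * z j)"
        using theta_times_p[OF p, of "t * y * z j"] t y z[OF that] by (simp add: mult_ac)
      moreover have "\<theta> (t * (p * y) / z j) = - \<theta> (t * y / z j) / (t * y / z j)"
        using theta_times_p[OF p, of "t * y / z j"] t y z[OF that] by (simp add: mult_ac)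
      ultimately show ?thesis
        using z[OF that] y t p by (simp add: theta_pair_def power2_eq_square)
    qed
    have "(\<Prod>j\<in>J. - (z j / (p * y)) * v (t * (p * y)) (z j)) =
        (\<Prod>j\<in>J. - (z j / y) * v (t * y) (z j)) * (1 / (p * t\<^sup>2 * y\<^sup>2)) ^ (n - 1)"
    proof -
      have "(\<Prod>j\<in>J. - (z j / (p * y)) * v (t * (p * y)) (z j)) =
          (\<Prod>j\<in>J. (- (z j / y) * v (t * y) (z j)) * (1 / (p * t\<^sup>2 * y\<^sup>2)))"
        by (intro prod.cong refl 2)
      also have "\<dots> = (\<Prod>j\<in>J. - (z j / y) * v (t * y) (z j)) * (1 / (p * t\<^sup>2 * y\<^sup>2)) ^ card J"
        by (simp only: prod.distrib prod_constant)
      finally show ?thesis using J by (simp only: n_def)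
    qed
    then have eq: "numer J z (p * y) = (\<Prod>m=1..6. \<theta> (b m * y)) / ((\<Prod>m=1..6. b m) * y ^ 6) / (p * y)\<^sup>2 *
        ((\<Prod>j\<in>J. - (z j / y) * v (t * y) (z j)) * (1 / (p * t\<^sup>2 * y\<^sup>2)) ^ (n - 1))"
      unfolding numer_def 1 by simp
    obtain m where m: "n = Suc m" using n by (cases n) auto
    have B: "(\<Prod>m=1..6. b m) * t ^ (2 * m) = p" using balancing by (simp add: n_def[symmetric] m)
    have A: "(p * t\<^sup>2 * y\<^sup>2) ^ m = t ^ (2 * m) * (p * y\<^sup>2) ^ m"
      unfolding power_mult[of t 2 m] power_mult_distrib by (simp only: mult_ac)
    have "((\<Prod>m=1..6. b m) * y ^ 6) * (p * y)\<^sup>2 * (p * t\<^sup>2 * y\<^sup>2) ^ m =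
       ((\<Prod>m=1..6. b m) * t ^ (2 * m)) * (y ^ 6 * (p * y)\<^sup>2 * (p * y\<^sup>2) ^ m)"
      unfolding A by (simp only: mult_ac)
    also have "\<dots> = y\<^sup>2 * (p * y\<^sup>2) ^ (n + 2)"
    proof -
      have "(p * y\<^sup>2) ^ (n + 2) = (p * y\<^sup>2) ^ m * (p * y\<^sup>2) ^ 3" by (simp add: m power_add eval_nat_numeral)
      moreover have "p * (y ^ 6 * (p * y)\<^sup>2 * Q) = y\<^sup>2 * (Q * (p * y\<^sup>2) ^ 3)" for Q by algebra
      ultimately show ?thesis unfolding B by (simp only:)
    qed
    finally have C: "((\<Prod>m=1..6. b m) * y ^ 6) * (p * y)\<^sup>2 * (p * t\<^sup>2 * y\<^sup>2) ^ m = y\<^sup>2 * (p * y\<^sup>2) ^ (n + 2)" .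
    have "numer J z (p * y) = (\<Prod>m=1..6. \<theta> (b m * y)) * (\<Prod>j\<in>J. - (z j / y) * v (t * y) (z j)) /
       (((\<Prod>m=1..6. b m) * y ^ 6) * (p * y)\<^sup>2 * (p * t\<^sup>2 * y\<^sup>2) ^ m)"
      unfolding eq m by (simp add: power_one_over divide_simps)
    also have "\<dots> = numer J z y / (p * y\<^sup>2) ^ (n + 2)"
      unfolding C numer_def by (simp add: divide_simps)
    finally show ?thesis .
  qed
  have per': "numer J z (1 / (p * y)) = numer J z (1 / y) / (p * y\<^sup>2) ^ (n + 2)" if y: "y \<noteq> 0" for y
  proof -
    have "numer J z (p * (1 / (p * y))) = numer J z (1 / (p * y)) / (p * (1 / (p * y))\<^sup>2) ^ (n + 2)"
      by (rule per) (use y p in auto)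
    moreover have "p * (1 / (p * y))\<^sup>2 = 1 / (p * y\<^sup>2)" "p * (1 / (p * y)) = 1 / y"
      using y p by (simp_all add: power2_eq_square)
    ultimately have "numer J z (1 / y) = numer J z (1 / (p * y)) / (1 / (p * y\<^sup>2)) ^ (n + 2)"
      by (simp only:)
    then have "numer J z (1 / y) = numer J z (1 / (p * y)) * (p * y\<^sup>2) ^ (n + 2)"
      by (simp only: power_one_over divide_divide_eq_right div_by_1)
    moreover have "(p * y\<^sup>2) ^ (n + 2) \<noteq> 0" using y p by simp
    ultimately show ?thesis by (metis nonzero_mult_div_cancel_right)
  qed
  have holo: "numer J z holomorphic_on (- {0})"
  proof -
    have "(\<lambda>w. (\<Prod>m=1..6. \<theta> (b m * w)) / w\<^sup>2 *
        (\<Prod>j\<in>J. - (z j / w) * (\<theta> (t * w * z j) * \<theta> (t * w / z j)))) holomorphic_on (- {0})"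
      by (intro holomorphic_intros theta_holomorphic p) (use b t z in auto)
    then show ?thesis by (simp add: numer_def[abs_def] theta_pair_def)
  qed
  have "(numer J z \<circ> (\<lambda>y. 1 / y)) holomorphic_on (- {0})"
    by (rule holomorphic_on_compose[OF _ holomorphic_on_subset[OF holo]])
       (auto intro!: holomorphic_intros)
  then show ?thesis
    unfolding bc_theta_def using holo per per'
    by (auto intro!: holomorphic_intros simp: o_def diff_divide_distrib n_def)
qed

end

context bc_system
begin

lemma remove_index:
  assumes "l \<in> K" "J = K - {l}"
  shows "finite J" "l \<notin> J" "K = insert l J" "card K = Suc (card J)"
proof -
  show 1: "finite J" "l \<notin> J" and 2: "K = insert l J" using assms K by auto
  show "card K = Suc (card J)" unfolding 2 using 1 by (rule card_insert_disjoint)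
qed

lemma test_fun_insert:
  assumes "finite J" "l \<notin> J"
  shows "test_fun \<gamma> x N (insert l J) (z(l := y)) = (\<Sum>i<N. \<gamma> i * (\<Prod>j\<in>J. v (x i) (z j)) * v (x i) y)"
proof -
  have "(\<Prod>j\<in>J. v (x i) ((z(l := y)) j)) = (\<Prod>j\<in>J. v (x i) (z j))" for i
    by (rule prod.cong) (use assms in auto)
  then show ?thesis using assms by (simp add: test_fun_def mult_ac)
qed

lemma shift_coeff_insert:
  assumes "finite J" "l \<notin> J"
  shows "shift_coeff (insert l J) w (z(l := y)) = shift_coeff J w z * (v (t * w) y / v w y)"
proof -
  have "(\<Prod>j\<in>J. v (t * w) ((z(l := y)) j) / v w ((z(l := y)) j)) = (\<Prod>j\<in>J. v (t * w) (z j) / v w (z j))"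
    by (rule prod.cong) (use assms in auto)
  then show ?thesis using assms by (simp add: shift_coeff_def mult_ac)
qed

lemma shift_coeff_cong:
  "(\<And>j. j \<in> J \<Longrightarrow> z j = z' j) \<Longrightarrow> shift_coeff J w z = shift_coeff J w z'"
  unfolding shift_coeff_def by (intro arg_cong2[where f = "(*)"] refl prod.cong) auto

lemma test_fun_cong:
  "(\<And>j. j \<in> J \<Longrightarrow> z j = z' j) \<Longrightarrow> test_fun \<gamma> x N J z = test_fun \<gamma> x N J z'"
  unfolding test_fun_def by (intro sum.cong arg_cong2[where f = "(*)"] refl prod.cong) auto

text \<open>
  Multiplied by \<^const>\<open>denom\<close>, the coboundary is holomorphic in each variable; the poles at
  \<open>z\<^sub>l = z\<^sub>j\<^sup>\<plusminus>\<^sup>1\<close> cancel between the terms with index \<open>l\<close> and \<open>j\<close>.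
\<close>

lemma coboundary_cleared:
  fixes \<gamma> x :: "nat \<Rightarrow> complex" and N :: nat and g
  defines "g \<equiv> test_fun \<gamma> x N"
  assumes x: "\<And>i. i < N \<Longrightarrow> x i \<noteq> 0" and l: "l \<in> K" and J: "J = K - {l}"
    and gen: "generic_point p J z"
  obtains h where "bc_theta p (- 1) (card K + 2) h"
    "\<And>y. y \<noteq> 0 \<Longrightarrow> denom J z y \<noteq> 0 \<Longrightarrow> h y = denom J z y * coboundary g (z(l := y))"
    "\<And>j. j \<in> J \<Longrightarrow> h (z j) = 0"
proof -
  have J': "finite J" "l \<notin> J" "K = insert l J" "card K = Suc (card J)"
    using remove_index[OF l J] by blast+
  have z: "z j \<noteq> 0" if "j \<in> J" for j using gen that by (auto simp: generic_point_def)
  define A where "A j = shift_coeff (J - {j}) (z j) z" for j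
  define B where "B j = shift_coeff (J - {j}) (1 / z j) z * (z j)\<^sup>2" for j
  define G where "G j y = (\<Sum>i<N. \<gamma> i * (\<Prod>k\<in>J - {j}. v (x i) (z k)) * v (x i) y)" for j y
  define E where "E j y = denom (J - {j}) z y * (A j * v (t * z j) y + B j * v (t / z j) y) * G j y" for j y
  define h where "h y = g J z * (numer J z y - numer J z (1 / y)) + (\<Sum>j\<in>J. E j y)" for y
  have Kj: "K - {j} = insert l (J - {j})" if "j \<in> J" for j using J' that by auto
  have Gg: "g (K - {j}) (z(l := y)) = G j y" if "j \<in> J" for j y
    unfolding g_def G_def Kj[OF that] by (rule test_fun_insert) (use J' in auto)
  have bcdenom: "bc_theta p (- 1) (2 + card I) (denom I z)" if "I \<subseteq> J" for I
  proof -
    have "bc_theta p (- 1 * 1) (2 + card I) (\<lambda>y. \<theta> (y\<^sup>2) / y * (\<Prod>j\<in>I. v (z j) y))"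
      by (intro bc_theta_mult bc_theta_square[OF p] bc_theta_prod bc_theta_pair[OF p])
         (use that J' z finite_subset in auto)
    then show ?thesis by (simp add: denom_def[abs_def])
  qed
  show ?thesis
  proof
    have bcE: "bc_theta p (- 1) (card K + 2) (E j)" if j: "j \<in> J" for j
    proof -
      have "bc_theta p (- 1 * 1 * 1) (2 + card (J - {j}) + 1 + 1) (E j)"
        unfolding E_def G_def
        by (intro bc_theta_mult bcdenom bc_theta_add bc_theta_sum bc_theta_cmult bc_theta_pair[OF p])
           (use j t z x in auto)
      moreover have "2 + card (J - {j}) + 1 + 1 = card K + 2"
        using J'(4) card.remove[OF J'(1) j] by linarith
      ultimately show ?thesis by simp
    qed
    show "bc_theta p (- 1) (card K + 2) h"
      unfolding h_def
      by (intro bc_theta_add bc_theta_cmult bc_theta_sum bcE bc_theta_numer z) (use J' in auto)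
    show "h y = denom J z y * coboundary g (z(l := y))" if y: "y \<noteq> 0" and nz: "denom J z y \<noteq> 0" for y
    proof -
      define c where "c j = (shift_coeff (K - {j}) (z j) (z(l := y)) + shift_coeff (K - {j}) (1 / z j) (z(l := y))) * g (K - {j}) (z(l := y))" for j
      have "coboundary g (z(l := y)) =
          (shift_coeff J y (z(l := y)) + shift_coeff J (1 / y) (z(l := y))) * g J (z(l := y)) + (\<Sum>j\<in>J. c j)"
      proof -
        define e where "e i = (shift_coeff (K - {i}) ((z(l := y)) i) (z(l := y)) +
            shift_coeff (K - {i}) (1 / (z(l := y)) i) (z(l := y))) * g (K - {i}) (z(l := y))" for i
        have "(\<Sum>j\<in>J. e j) = (\<Sum>j\<in>J. c j)"
          by (rule sum.cong) (use J' in \<open>auto simp: c_def e_def\<close>)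
        moreover have "coboundary g (z(l := y)) = (\<Sum>i\<in>K. e i)" by (simp add: coboundary_def e_def)
        moreover have "(\<Sum>i\<in>K. e i) = e l + (\<Sum>i\<in>J. e i)" using J' by simp
        ultimately show ?thesis using J by (simp add: e_def)
      qed
      also have "shift_coeff J y (z(l := y)) = shift_coeff J y z"
        by (rule shift_coeff_cong) (use J' in auto)
      also have "shift_coeff J (1 / y) (z(l := y)) = shift_coeff J (1 / y) z"
        by (rule shift_coeff_cong) (use J' in auto)
      also have "g J (z(l := y)) = g J z"
        unfolding g_def by (rule test_fun_cong) (use J' in auto)
      finally have cob: "coboundary g (z(l := y)) =
          (shift_coeff J y z + shift_coeff J (1 / y) z) * g J z + (\<Sum>j\<in>J. c j)" .
      have eq: "denom J z y * coboundary g (z(l := y)) =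
          (denom J z y * shift_coeff J y z + denom J z y * shift_coeff J (1 / y) z) * g J z +
          (\<Sum>j\<in>J. denom J z y * c j)"
        unfolding cob sum_distrib_left[symmetric] by (simp add: algebra_simps)
      have summand: "denom J z y * c j = E j y" if j: "j \<in> J" for j
      proof -
        have vn: "v (z j) y \<noteq> 0" using nz j J' by (auto simp: denom_def)
        have D: "denom J z y = denom (J - {j}) z y * v (z j) y"
          unfolding denom_def using prod.remove[OF J'(1) j, of "\<lambda>j. v (z j) y"] by (simp add: mult_ac)
        have 1: "shift_coeff (K - {j}) (z j) (z(l := y)) = A j * v (t * z j) y / v (z j) y"
          unfolding Kj[OF j] A_def by (subst shift_coeff_insert) (use J' in auto)
        have "shift_coeff (K - {j}) (1 / z j) (z(l := y)) =
            shift_coeff (J - {j}) (1 / z j) z * (v (t * (1 / z j)) y / v (1 / z j) y)"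
          unfolding Kj[OF j] by (subst shift_coeff_insert) (use J' in auto)
        then have 2: "shift_coeff (K - {j}) (1 / z j) (z(l := y)) = B j * v (t / z j) y / v (z j) y"
          using theta_pair_inverse_left[OF p z[OF j] y] by (simp add: B_def)
        show ?thesis
          unfolding c_def D 1 2 Gg[OF j] E_def using vn by (simp add: field_simps)
      qed
      have "(\<Sum>j\<in>J. denom J z y * c j) = (\<Sum>j\<in>J. E j y)"
        by (intro sum.cong refl summand)
      moreover have "denom J z y * shift_coeff J y z = numer J z y"
        by (rule denom_times_shift_coeff) (use y z nz J' in auto)
      moreover have "denom J z y * shift_coeff J (1 / y) z = - numer J z (1 / y)"
        by (rule denom_times_shift_coeff_inverse) (use y z nz J' in auto)
      ultimately show ?thesis
        unfolding eq h_def by (simp only: mult.commute diff_conv_add_uminus)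
    qed
    show "h (z j) = 0" if j: "j \<in> J" for j
    proof -
      have Ek: "E k (z j) = 0" if "k \<in> J - {j}" for k
      proof -
        have "v (z j) (z j) = 0" using theta_pair_self[OF p(1) z[OF j]] .
        then have "denom (J - {k}) z (z j) = 0"
          unfolding denom_def using that j J' by (auto intro!: prod_zero bexI[of _ j])
        then show ?thesis by (simp add: E_def)
      qed
      define D where "D = denom (J - {j}) z (z j)"
      have "D \<noteq> 0"
        using gen j z[OF j] J' by (auto simp: D_def denom_def generic_point_def)
      then have s: "D * shift_coeff (J - {j}) (z j) z = numer (J - {j}) z (z j)"
          "D * shift_coeff (J - {j}) (1 / z j) z = - numer (J - {j}) z (1 / z j)"
        unfolding D_def using z[OF j] z J'
        by (auto intro!: denom_times_shift_coeff denom_times_shift_coeff_inverse)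
      have num: "numer J z w = numer (J - {j}) z w * (- (z j / w) * v (t * w) (z j))" for w
        unfolding numer_def using prod.remove[OF J'(1) j, of "\<lambda>j. - (z j / w) * v (t * w) (z j)"]
        by (simp only: mult_ac)
      have 1: "numer J z (z j) = - (D * A j * v (t * z j) (z j))"
        unfolding num A_def s using z[OF j] by simp
      have "D * B j = - numer (J - {j}) z (1 / z j) * (z j)\<^sup>2"
        unfolding B_def using s(2) by (simp add: mult.assoc[symmetric])
      then have 2: "numer J z (1 / z j) = D * B j * v (t / z j) (z j)"
        unfolding num using z[OF j] by (simp add: power2_eq_square)
      have 3: "G j (z j) = g J z"
        unfolding G_def g_def test_fun_def
      proof (intro sum.cong refl)
        fix i
        show "\<gamma> i * (\<Prod>k\<in>J - {j}. v (x i) (z k)) * v (x i) (z j) = \<gamma> i * (\<Prod>k\<in>J. v (x i) (z k))"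
          unfolding prod.remove[OF J'(1) j, of "\<lambda>k. v (x i) (z k)"] by (simp only: mult_ac)
      qed
      have "(\<Sum>k\<in>J. E k (z j)) = E j (z j)"
        using Ek by (simp add: sum.remove[OF J'(1) j])
      then have "h (z j) = g J z * (numer J z (z j) - numer J z (1 / z j)) +
          D * (A j * v (t * z j) (z j) + B j * v (t / z j) (z j)) * g J z"
        unfolding h_def E_def D_def 3 by simp
      also have "\<dots> = 0" unfolding 1 2 by (simp add: algebra_simps)
      finally show ?thesis .
    qed
  qed
qed

definition defect :: "(nat set \<Rightarrow> (nat \<Rightarrow> complex) \<Rightarrow> complex) \<Rightarrow> complex \<Rightarrow> complex \<Rightarrow> complex \<Rightarrow> complex \<Rightarrow> (nat \<Rightarrow> complex) \<Rightarrow> complex" where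
  "defect g c a d a' z = coboundary g z - c * (\<Prod>k\<in>K. v a (z k)) - d * (\<Prod>k\<in>K. v a' (z k))"

text \<open>
  Multiplied by \<^const>\<open>denom\<close>, the defect is odd of degree \<open>n + 2\<close> in the variable \<open>y\<close>, where \<open>n\<close> is
  the number of variables. It vanishes at the other \<open>n - 1\<close> variables and at the two given points,
  and \<open>n + 1\<close> zeros are enough.
\<close>

lemma defect_interpolation:
  fixes \<gamma> x :: "nat \<Rightarrow> complex" and N :: nat and g
  defines "g \<equiv> test_fun \<gamma> x N"
  assumes x: "\<And>i. i < N \<Longrightarrow> x i \<noteq> 0" and l: "l \<in> K" and a: "a \<noteq> 0" "a' \<noteq> 0"
    and gen: "generic_point p K (z(l := y))" "generic_point p K (z(l := y1))" "generic_point p K (z(l := y2))"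
    and y12: "v y1 y2 \<noteq> 0"
    and zero: "defect g c a d a' (z(l := y1)) = 0" "defect g c a d a' (z(l := y2)) = 0"
  shows "defect g c a d a' (z(l := y)) = 0"
proof -
  define J where "J = K - {l}"
  have J': "finite J" "l \<notin> J" "K = insert l J" "card K = Suc (card J)"
    using remove_index[OF l J_def] by blast+
  have gJ: "generic_point p J z"
  proof -
    have "generic_point p J (z(l := y))"
      using gen(1) J'(3) unfolding generic_point_def by blast
    moreover have "(z(l := y)) j = z j" if "j \<in> J" for j using J'(2) that by auto
    ultimately show ?thesis unfolding generic_point_def by simp
  qed
  have z: "z j \<noteq> 0" if "j \<in> J" for j using gJ that by (auto simp: generic_point_def)
  have ys: "w \<noteq> 0 \<and> \<theta> (w\<^sup>2) \<noteq> 0 \<and> (\<forall>j\<in>J. v (z j) w \<noteq> 0) \<and> denom J z w \<noteq> 0"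
    if "generic_point p K (z(l := w))" for w
  proof -
    have "w \<noteq> 0" "\<theta> (w\<^sup>2) \<noteq> 0" using that l by (auto simp: generic_point_def)
    moreover have "v (z j) w \<noteq> 0" if "j \<in> J" for j
    proof -
      have "j \<in> K" "l \<in> K" "j \<noteq> l" using that J' by auto
      then have "v ((z(l := w)) j) ((z(l := w)) l) \<noteq> 0"
        using \<open>generic_point p K (z(l := w))\<close> unfolding generic_point_def by blast
      then show ?thesis using \<open>j \<noteq> l\<close> by simp
    qed
    ultimately show ?thesis using J' by (auto simp: denom_def)
  qed
  obtain h0 where h0: "bc_theta p (- 1) (card K + 2) h0"
    "\<And>y. y \<noteq> 0 \<Longrightarrow> denom J z y \<noteq> 0 \<Longrightarrow> h0 y = denom J z y * coboundary g (z(l := y))"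
    "\<And>j. j \<in> J \<Longrightarrow> h0 (z j) = 0"
    using coboundary_cleared[of N x l J z \<gamma>] x l J_def gJ unfolding g_def by metis
  define h where "h y = h0 y - c * (\<Prod>k\<in>J. v a (z k)) * (denom J z y * v a y)
      - d * (\<Prod>k\<in>J. v a' (z k)) * (denom J z y * v a' y)" for y
  have bcdenom: "bc_theta p (- 1) (2 + card J) (denom J z)"
  proof -
    have "bc_theta p (- 1 * 1) (2 + card J) (\<lambda>y. \<theta> (y\<^sup>2) / y * (\<Prod>j\<in>J. v (z j) y))"
      by (intro bc_theta_mult bc_theta_square[OF p] bc_theta_prod bc_theta_pair[OF p])
         (use J' z in auto)
    then show ?thesis by (simp add: denom_def[abs_def])
  qed
  have bcv: "bc_theta p (- 1) (card K + 2) (\<lambda>y. denom J z y * v w y)" if "w \<noteq> 0" for w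
    using bc_theta_mult[OF bcdenom bc_theta_pair[OF p that]] J' by simp
  have hbc: "bc_theta p (- 1) (card K + 2) h"
    unfolding h_def by (intro bc_theta_diff h0(1) bc_theta_cmult bcv a)
  have prodK: "(\<Prod>k\<in>K. v w ((z(l := y)) k)) = (\<Prod>k\<in>J. v w (z k)) * v w y" for w y
  proof -
    have "(\<Prod>k\<in>J. v w ((z(l := y)) k)) = (\<Prod>k\<in>J. v w (z k))"
      by (rule prod.cong) (use J' in auto)
    then show ?thesis using J' by (simp add: mult.commute)
  qed
  have hH: "h y = denom J z y * defect g c a d a' (z(l := y))" if "generic_point p K (z(l := y))" for y
    using h0(2)[of y] ys[OF that] unfolding h_def defect_def prodK by (simp add: algebra_simps)
  define X where "X = z ` J \<union> {y1, y2}"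
  have th1: "\<theta> 1 = 0" using theta_at_1 p by blast
  have inj: "inj_on z J"
  proof (rule inj_onI, rule ccontr)
    fix j k assume "j \<in> J" "k \<in> J" "z j = z k" "j \<noteq> k"
    then have "v (z j) (z j) \<noteq> 0" using gJ by (metis generic_point_def)
    then show False using theta_pair_self[OF p(1)] z \<open>j \<in> J\<close> by blast
  qed
  have y1: "y1 \<notin> z ` J" "y2 \<notin> z ` J" "y1 \<noteq> y2"
    using ys[OF gen(2)] ys[OF gen(3)] theta_pair_self[OF p(1)] y12 z by auto
  have "card X = card J + 2"
    unfolding X_def using y1 J' by (simp add: card_Un_disjoint card_image[OF inj])
  have sym: "v u w \<noteq> 0 \<Longrightarrow> u \<noteq> 0 \<Longrightarrow> w \<noteq> 0 \<Longrightarrow> v w u \<noteq> 0" for u w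
    using theta_pair_swap[OF p, of u w] by simp
  have "h y = 0"
  proof (rule odd_quasi_periodic_eq_0[OF p, of h "card K + 2" X])
    show "h holomorphic_on - {0}" "\<And>y. y \<noteq> 0 \<Longrightarrow> h (1 / y) = - h y"
      "\<And>y. y \<noteq> 0 \<Longrightarrow> h (p * y) = h y / (p * y\<^sup>2) ^ (card K + 2)"
      using hbc by (auto simp: bc_theta_def)
    show "finite X" using J' by (simp add: X_def)
    show "0 \<notin> X" using z ys[OF gen(2)] ys[OF gen(3)] by (auto simp: X_def)
    show "card K + 2 \<le> card X + 1" using \<open>card X = card J + 2\<close> J' by simp
    show "h w = 0" if "w \<in> X" for w
    proof -
      consider j where "j \<in> J" "w = z j" | "w = y1" | "w = y2" using \<open>w \<in> X\<close> by (auto simp: X_def)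
      then show ?thesis
      proof cases
        case 1
        then have "v (z j) (z j) = 0" using theta_pair_self[OF p(1)] z by blast
        then have "denom J z (z j) = 0"
          unfolding denom_def using 1 J' by (auto intro!: prod_zero bexI[of _ j])
        then show ?thesis using h0(3) 1 by (simp add: h_def)
      qed (use hH gen zero in auto)
    qed
    show "\<theta> (w\<^sup>2) \<noteq> 0" if "w \<in> X" for w
      using that ys[OF gen(2)] ys[OF gen(3)] gJ by (auto simp: X_def generic_point_def)
    show "\<theta> (u * w) \<noteq> 0 \<and> \<theta> (u / w) \<noteq> 0" if "u \<in> X" "w \<in> X" "u \<noteq> w" for u w
    proof -
      have nz: "u \<noteq> 0" if "u \<in> X" for u using that z ys[OF gen(2)] ys[OF gen(3)] by (auto simp: X_def)
      have zz: "v (z j) (z k) \<noteq> 0" if "j \<in> J" "k \<in> J" "z j \<noteq> z k" for j k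
        using gJ that unfolding generic_point_def by metis
      have zy: "v (z j) y1 \<noteq> 0" "v y1 (z j) \<noteq> 0" "v (z j) y2 \<noteq> 0" "v y2 (z j) \<noteq> 0" if "j \<in> J" for j
        using ys[OF gen(2)] ys[OF gen(3)] that sym z[OF that] by auto
      have yy: "v y1 y2 \<noteq> 0" "v y2 y1 \<noteq> 0" using y12 sym ys[OF gen(2)] ys[OF gen(3)] by auto
      have "v u w \<noteq> 0"
        using that zz zy yy unfolding X_def by (elim UnE imageE insertE emptyE) auto
      then show ?thesis by (simp add: theta_pair_def)
    qed
    show "y \<noteq> 0" using ys[OF gen(1)] by simp
  qed
  then show ?thesis using hH[OF gen(1)] ys[OF gen(1)] by auto
qed

end

section \<open>Evaluation at the nodes\<close>

lemma triangular_system: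
  fixes M :: "nat \<Rightarrow> nat \<Rightarrow> 'a::field"
  assumes "\<And>l r. l < r \<Longrightarrow> r < n \<Longrightarrow> M l r = 0" "\<And>l. l < n \<Longrightarrow> M l l \<noteq> 0"
  obtains \<gamma> where "\<And>r. r < n \<Longrightarrow> (\<Sum>l<n. \<gamma> l * M l r) = \<tau> r"
proof -
  have "\<exists>\<gamma>. \<forall>r<n. (\<Sum>l<n. \<gamma> l * M l r) = \<tau> r"
    using assms
  proof (induction n arbitrary: \<tau>)
    case (Suc n)
    obtain \<gamma> where \<gamma>: "\<forall>r<n. (\<Sum>l<n. \<gamma> l * M l r) = \<tau> r - \<tau> n / M n n * M n r"
      using Suc.IH[of "\<lambda>r. \<tau> r - \<tau> n / M n n * M n r"] Suc.prems by auto
    define \<gamma>' where "\<gamma>' = \<gamma>(n := \<tau> n / M n n)"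
    have eq: "(\<Sum>l<Suc n. \<gamma>' l * M l r) = (\<Sum>l<n. \<gamma> l * M l r) + \<tau> n / M n n * M n r" for r
      by (simp add: \<gamma>'_def)
    have "(\<Sum>l<Suc n. \<gamma>' l * M l r) = \<tau> r" if "r < Suc n" for r
    proof (cases "r = n")
      case True
      have "(\<Sum>l<n. \<gamma> l * M l n) = 0" using Suc.prems(1)[of _ n] by (intro sum.neutral) auto
      then show ?thesis unfolding eq True using Suc.prems(2)[of n] by simp
    next
      case False
      then have "r < n" using that by simp
      then have "(\<Sum>l<n. \<gamma> l * M l r) = \<tau> r - \<tau> n / M n n * M n r" using \<gamma> by blast
      then show ?thesis unfolding eq by simp
    qed
    then show ?case by blast
  qed simp
  then show ?thesis using that by blast
qed

lemma theta_nonzero_annulus: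
  assumes p: "norm p < 1" "p \<noteq> 0" and u: "norm p < norm u" "norm u < 1"
  shows "theta u p \<noteq> 0"
proof
  have u0: "u \<noteq> 0" using u by auto
  assume "theta u p = 0"
  then obtain e :: int where e: "u = p powi e" using theta_eq_0_iff[OF p u0] by auto
  show False
  proof (cases "e \<le> 0")
    case True
    then obtain k where "e = - int k" by (metis nonpos_int_cases)
    then have "norm u * norm p ^ k = 1" using e p by (simp add: power_int_minus norm_inverse norm_power)
    moreover have "norm u * norm p ^ k \<le> norm u * 1"
      using p by (intro mult_left_mono power_le_one) auto
    ultimately show False using u by simp
  next
    case False
    then obtain k where "e = int (Suc k)" by (metis gr0_implies_Suc not_le pos_int_cases)
    then have "norm u = norm p ^ Suc k" using e by (simp add: norm_mult norm_power del: of_nat_Suc)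
    moreover have "norm p ^ Suc k \<le> norm p ^ 1"
      using p by (intro power_decreasing) auto
    ultimately show False using u by simp
  qed
qed

context bc_system
begin

text \<open>
  The variables with index in \<open>A\<close> take the values \<open>a, at, \<dots>, at\<^sup>r\<^sup>-\<^sup>1\<close> in some order; the order
  is irrelevant since everything evaluated at the nodes is symmetric.
\<close>

definition nodes :: "complex \<Rightarrow> nat \<Rightarrow> nat set \<Rightarrow> (nat \<Rightarrow> complex) \<Rightarrow> bool" where
  "nodes a r A z \<longleftrightarrow> (\<exists>f. bij_betw f {..<r} A \<and> (\<forall>j<r. z (f j) = a * t ^ j))"

lemma nodes_insert:
  assumes "nodes a r A z" "l \<notin> A"
  shows "nodes a (Suc r) (insert l A) (z(l := a * t ^ r))"
proof -
  obtain f where f: "bij_betw f {..<r} A" "\<forall>j<r. z (f j) = a * t ^ j"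
    using assms by (auto simp: nodes_def)
  have "bij_betw (f(r := l)) {..<r} A"
    using f(1) by (subst bij_betw_cong[of _ _ f]) auto
  then have "bij_betw (f(r := l)) ({..<r} \<union> {r}) (A \<union> {l})"
    using notIn_Un_bij_betw3[of r "{..<r}" "f(r := l)" A] assms(2) by auto
  moreover have "{..<r} \<union> {r} = {..<Suc r}" by auto
  ultimately have "bij_betw (f(r := l)) {..<Suc r} (insert l A)" by simp
  moreover have "f j \<noteq> l" if "j < r" for j using f(1) that assms(2) by (auto simp: bij_betw_def)
  ultimately show ?thesis
    using f(2) unfolding nodes_def by (intro exI[of _ "f(r := l)"]) (auto simp: less_Suc_eq)
qed

lemma nodes_upd: "nodes a r A z \<Longrightarrow> l \<notin> A \<Longrightarrow> nodes a r A (z(l := y))"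
  unfolding nodes_def by (auto simp: bij_betw_def)

lemma nodes_remove:
  assumes "nodes a (Suc r) A z"
  obtains i where "i \<in> A" "z i = a * t ^ r" "nodes a r (A - {i}) z"
proof -
  obtain f where f: "bij_betw f {..<Suc r} A" "\<forall>j<Suc r. z (f j) = a * t ^ j"
    using assms unfolding nodes_def by blast
  have "bij_betw f {..<r} (A - {f r})"
    using f(1) by (auto simp: bij_betw_def lessThan_Suc inj_on_def)
  then have "nodes a r (A - {f r}) z" unfolding nodes_def using f(2) by auto
  moreover have "f r \<in> A" using f(1) unfolding bij_betw_def by blast
  ultimately show ?thesis using that f(2) by blast
qed

lemma nodes_memberD: "nodes a r A z \<Longrightarrow> i \<in> A \<Longrightarrow> \<exists>j<r. z i = a * t ^ j"
  unfolding nodes_def bij_betw_def by auto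

lemma nodes_get: "nodes a r A z \<Longrightarrow> j < r \<Longrightarrow> \<exists>i\<in>A. z i = a * t ^ j"
  unfolding nodes_def bij_betw_def by auto

lemma nodes_prod:
  assumes "nodes a r A z" shows "(\<Prod>i\<in>A. G (z i)) = (\<Prod>j<r. G (a * t ^ j))"
proof -
  obtain f where f: "bij_betw f {..<r} A" "\<forall>j<r. z (f j) = a * t ^ j"
    using assms unfolding nodes_def by blast
  have "(\<Prod>i\<in>A. G (z i)) = (\<Prod>j<r. G (z (f j)))"
    by (rule prod.reindex_bij_betw[OF f(1), symmetric])
  also have "\<dots> = (\<Prod>j<r. G (a * t ^ j))" using f(2) by (intro prod.cong) auto
  finally show ?thesis .
qed

lemma nodes_card: "nodes a r A z \<Longrightarrow> card A = r"
  unfolding nodes_def using bij_betw_same_card by fastforce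

text \<open>
  The value of \<^const>\<open>shift_coeff\<close> at \<open>w = at\<^sup>r\<close> when the other variables are
  \<open>a, \<dots>, at\<^sup>r\<^sup>-\<^sup>1, a', \<dots>, a't\<^sup>s\<^sup>-\<^sup>1\<close>.
\<close>

definition step_coeff :: "complex \<Rightarrow> complex \<Rightarrow> nat \<Rightarrow> nat \<Rightarrow> complex" where
  "step_coeff a a' r s = coeff (a * t ^ r) *
     ((\<Prod>j<r. v (t * (a * t ^ r)) (a * t ^ j) / v (a * t ^ r) (a * t ^ j)) *
      (\<Prod>j<s. v (t * (a * t ^ r)) (a' * t ^ j) / v (a * t ^ r) (a' * t ^ j)))"

definition node_value ::
  "(nat \<Rightarrow> complex) \<Rightarrow> (nat \<Rightarrow> complex) \<Rightarrow> nat \<Rightarrow> complex \<Rightarrow> complex \<Rightarrow> nat \<Rightarrow> nat \<Rightarrow> complex" where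
  "node_value \<gamma> x N a a' r s =
     (\<Sum>l<N. \<gamma> l * ((\<Prod>j<r. v (x l) (a * t ^ j)) * (\<Prod>j<s. v (x l) (a' * t ^ j))))"

lemma node_value_swap: "node_value \<gamma> x N a' a s r = node_value \<gamma> x N a a' r s"
  unfolding node_value_def by (simp add: mult.commute)

text \<open>
  A factor \<open>\<theta>(1) = 0\<close> kills almost all summands. For \<open>w = 1 / z\<^sub>i\<close> and \<open>z\<^sub>i = at\<^sup>j\<close> it comes from the
  node \<open>at\<^sup>j\<^sup>-\<^sup>1\<close>, or from the parameter \<open>b\<^sub>k = a\<close> if \<open>j = 0\<close>; for \<open>w = z\<^sub>i\<close> from the node \<open>at\<^sup>j\<^sup>+\<^sup>1\<close>. Only
  \<open>w = at\<^sup>r\<^sup>-\<^sup>1\<close> remains.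
\<close>

lemma coboundary_part_at_nodes:
  assumes A: "nodes a r A z" and B: "nodes a' s B z" and AB: "A \<inter> B = {}" "A \<union> B = K"
    and a: "a = b k" "k \<in> {1..6}" and t1: "t \<noteq> 1"
  shows "(\<Sum>i\<in>A. (shift_coeff (K - {i}) (z i) z + shift_coeff (K - {i}) (1 / z i) z) *
      test_fun \<gamma> x N (K - {i}) z) =
    (if r = 0 then 0 else step_coeff a a' (r - 1) s * node_value \<gamma> x N a a' (r - 1) s)"
    (is "(\<Sum>i\<in>A. ?h i) = _")
proof (cases r)
  case 0
  then have "A = {}" using A by (auto simp: nodes_def bij_betw_def)
  then show ?thesis using 0 by simp
next
  case (Suc r')
  have a0: "a \<noteq> 0" using a b by auto
  have th1: "\<theta> 1 = 0" using theta_at_1 p by blast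
  have fin: "finite A" "finite (K - {i})" for i using AB K by auto
  have neg: "shift_coeff (K - {i}) (1 / z i) z = 0" if i: "i \<in> A" for i
  proof -
    obtain j where j: "j < r" "z i = a * t ^ j" using nodes_memberD[OF A i] by blast
    show ?thesis
    proof (cases j)
      case 0
      have "(\<Prod>m=1..6. \<theta> (b m * (1 / z i))) = 0"
        using a0 th1 a j 0 by (intro prod_zero) (auto intro!: bexI[of _ k])
      then show ?thesis by (simp add: shift_coeff_def coeff_def)
    next
      case (Suc j')
      then obtain i' where i': "i' \<in> A" "z i' = a * t ^ j'" using nodes_get[OF A, of j'] j by auto
      have "z i' \<noteq> z i" using i' j Suc a0 t t1 by simp
      then have "i' \<in> K - {i}" using i' AB by auto
      moreover have "v (t * (1 / z i)) (z i') = 0"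
        using a0 t th1 by (simp add: theta_pair_def j i' Suc)
      ultimately have "(\<Prod>j\<in>K - {i}. v (t * (1 / z i)) (z j) / v (1 / z i) (z j)) = 0"
        using fin by (intro prod_zero) auto
      then show ?thesis by (simp add: shift_coeff_def)
    qed
  qed
  have pos: "shift_coeff (K - {i}) (z i) z = 0" if i: "i \<in> A" "z i = a * t ^ j" "Suc j < r" for i j
  proof -
    obtain i' where i': "i' \<in> A" "z i' = a * t ^ Suc j" using nodes_get[OF A i(3)] by auto
    have "z i' \<noteq> z i" using i' i a0 t t1 by simp
    then have "i' \<in> K - {i}" using i' AB by auto
    moreover have "v (t * z i) (z i') = 0"
      using a0 t th1 by (simp add: theta_pair_def i i')
    ultimately have "(\<Prod>j\<in>K - {i}. v (t * z i) (z j) / v (z i) (z j)) = 0"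
      using fin by (intro prod_zero) auto
    then show ?thesis by (simp add: shift_coeff_def)
  qed
  obtain i where i: "i \<in> A" "z i = a * t ^ r'" "nodes a r' (A - {i}) z"
    using nodes_remove A Suc by blast
  have "?h i' = 0" if i'A: "i' \<in> A - {i}" for i'
  proof -
    obtain j where "j < r'" "z i' = a * t ^ j" using nodes_memberD[OF i(3) i'A] by blast
    then show ?thesis using neg[of i'] pos[of i' j] i'A Suc by auto
  qed
  then have "(\<Sum>i\<in>A. ?h i) = ?h i"
    using sum.remove[OF fin(1) i(1), of ?h] by (simp add: sum.neutral)
  also have "\<dots> = shift_coeff (K - {i}) (z i) z * test_fun \<gamma> x N (K - {i}) z"
    using neg[OF i(1)] by simp
  finally have sum: "(\<Sum>i\<in>A. ?h i) = shift_coeff (K - {i}) (z i) z * test_fun \<gamma> x N (K - {i}) z" .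
  have KI: "K - {i} = (A - {i}) \<union> B" using AB i by auto
  have prod: "(\<Prod>k\<in>K - {i}. G (z k)) = (\<Prod>j<r'. G (a * t ^ j)) * (\<Prod>j<s. G (a' * t ^ j))" for G :: "complex \<Rightarrow> complex"
  proof -
    have "(\<Prod>k\<in>K - {i}. G (z k)) = (\<Prod>k\<in>A - {i}. G (z k)) * (\<Prod>k\<in>B. G (z k))"
      unfolding KI by (rule prod.union_disjoint) (use AB K fin in \<open>auto intro: finite_subset\<close>)
    then show ?thesis unfolding nodes_prod[OF i(3)] nodes_prod[OF B] .
  qed
  have "shift_coeff (K - {i}) (z i) z = step_coeff a a' r' s"
    unfolding shift_coeff_def step_coeff_def i(2)
    using prod[of "\<lambda>y. v (t * (a * t ^ r')) y / v (a * t ^ r') y"] by simp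
  moreover have "test_fun \<gamma> x N (K - {i}) z = node_value \<gamma> x N a a' r' s"
    unfolding test_fun_def node_value_def prod[of "v (x _)"] ..
  ultimately show ?thesis using sum Suc by simp
qed


lemma coboundary_at_nodes:
  assumes A: "nodes a r A z" and B: "nodes a' s B z" and AB: "A \<inter> B = {}" "A \<union> B = K"
    and a: "a = b k" "k \<in> {1..6}" "a' = b k'" "k' \<in> {1..6}" and t1: "t \<noteq> 1"
  shows "coboundary (test_fun \<gamma> x N) z =
    (if r = 0 then 0 else step_coeff a a' (r - 1) s * node_value \<gamma> x N a a' (r - 1) s) +
    (if s = 0 then 0 else step_coeff a' a (s - 1) r * node_value \<gamma> x N a a' r (s - 1))"
proof -
  define h where "h i = (shift_coeff (K - {i}) (z i) z + shift_coeff (K - {i}) (1 / z i) z) *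
      test_fun \<gamma> x N (K - {i}) z" for i
  have "finite A" "finite B" using AB K by (auto intro: finite_subset)
  then have "coboundary (test_fun \<gamma> x N) z = sum h A + sum h B"
    using sum.union_disjoint[of A B h] AB by (simp add: coboundary_def h_def)
  moreover have "B \<inter> A = {}" "B \<union> A = K" using AB by auto
  ultimately show ?thesis
    using coboundary_part_at_nodes[OF A B AB a(1,2) t1, of \<gamma> x N]
      coboundary_part_at_nodes[OF B A _ _ a(3,4) t1, of \<gamma> x N]
    by (simp add: node_value_swap[of _ _ _ a' a] h_def)
qed

end

text \<open>
  All theta functions that are divided by at the nodes are assumed to be nonzero. The annulus
  separates the nodes from the unit circle modulo \<open>p\<^sup>\<int>\<close>.
\<close>

locale bc_generic = bc_system +
  fixes k0 k1 :: nat
  assumes k01: "k0 \<in> {1..6}" "k1 \<in> {1..6}" "k0 \<noteq> k1"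
    and t_less: "norm t < 1"
    and annulus: "\<And>j. j < card K \<Longrightarrow> norm p < norm (b k0 * t ^ j) \<and> norm (b k0 * t ^ j) < 1"
      "\<And>j. j < card K \<Longrightarrow> norm p < norm (b k1 * t ^ j) \<and> norm (b k1 * t ^ j) < 1"
    and gen_product: "\<And>j. j \<le> 2 * card K - 2 \<Longrightarrow> theta (b k0 * b k1 * t ^ j) p \<noteq> 0"
    and gen_square: "\<And>j. theta ((b k0)\<^sup>2 * t ^ j) p \<noteq> 0" "\<And>j. theta ((b k1)\<^sup>2 * t ^ j) p \<noteq> 0"
    and gen_quotient: "\<And>e. theta (b k0 / b k1 * t powi e) p \<noteq> 0"
    and gen_t: "\<And>j. 1 \<le> j \<Longrightarrow> j \<le> 2 * card K - 2 \<Longrightarrow> theta (t ^ j) p \<noteq> 0"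
    and gen_other: "\<And>m j. m \<in> {1..6} - {k0, k1} \<Longrightarrow> j < card K \<Longrightarrow>
      theta (b m * b k0 * t ^ j) p \<noteq> 0 \<and> theta (b m * b k1 * t ^ j) p \<noteq> 0"
begin

lemma theta_inverse_nonzero: "u \<noteq> 0 \<Longrightarrow> \<theta> (1 / u) \<noteq> 0 \<longleftrightarrow> \<theta> u \<noteq> 0"
  using theta_inverse[OF p, of u] by simp

lemma b01: "b k0 \<noteq> 0" "b k1 \<noteq> 0" using b k01 by auto

lemma t_neq_1: "t \<noteq> 1" using t_less by auto

lemma gen_quotient': "\<theta> (b k1 / b k0 * t powi e) \<noteq> 0"
proof -
  have "b k1 / b k0 * t powi e = 1 / (b k0 / b k1 * t powi (- e))"
    using b01 t by (simp add: power_int_minus field_simps)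
  then show ?thesis using theta_inverse_nonzero[of "b k0 / b k1 * t powi (- e)"] gen_quotient b01 t by simp
qed

lemma swap: "bc_generic p t b K k1 k0"
  by unfold_locales
    (use k01 t_less annulus gen_product gen_square gen_quotient' gen_t gen_other in \<open>auto simp: mult.commute\<close>)

lemma node_pair_same:
  assumes "i < card K" "j < card K" "i \<noteq> j" shows "v (b k0 * t ^ i) (b k0 * t ^ j) \<noteq> 0"
proof -
  have "\<theta> (b k0 * t ^ i * (b k0 * t ^ j)) \<noteq> 0"
    using gen_square(1)[of "i + j"] by (simp add: power_add power2_eq_square mult_ac)
  moreover have "\<theta> (b k0 * t ^ i / (b k0 * t ^ j)) \<noteq> 0"
  proof (cases "i > j")
    case True
    then have "b k0 * t ^ i / (b k0 * t ^ j) = t ^ (i - j)" using b01 t by (simp add: power_diff)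
    then show ?thesis using gen_t[of "i - j"] True assms by simp
  next
    case False
    then have "b k0 * t ^ i / (b k0 * t ^ j) = 1 / t ^ (j - i)" using b01 t by (simp add: power_diff)
    then show ?thesis using gen_t[of "j - i"] theta_inverse_nonzero[of "t ^ (j - i)"] False assms t by simp
  qed
  ultimately show ?thesis by (simp add: theta_pair_def)
qed

lemma node_pair_different:
  assumes "i < card K" "j < card K" shows "v (b k0 * t ^ i) (b k1 * t ^ j) \<noteq> 0"
proof -
  have "\<theta> (b k0 * t ^ i * (b k1 * t ^ j)) \<noteq> 0"
    using gen_product[of "i + j"] assms by (simp add: power_add mult_ac)
  moreover have "b k0 * t ^ i / (b k1 * t ^ j) = b k0 / b k1 * t powi (int i - int j)"
    using t by (simp add: power_int_diff)
  ultimately show ?thesis using gen_quotient[of "int i - int j"] by (simp add: theta_pair_def)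
qed

lemma node_pair_torus:
  assumes "i < card K" "norm z = 1" shows "v (b k0 * t ^ i) z \<noteq> 0"
proof -
  have "\<theta> u \<noteq> 0" if "norm u = norm (b k0 * t ^ i)" for u
    using theta_nonzero_annulus[OF p, of u] annulus(1)[OF assms(1)] that by simp
  then show ?thesis using assms(2) by (simp add: theta_pair_def norm_mult norm_divide)
qed

lemma generic_point_update:
  assumes "generic_point p K z" "l \<in> K" "y \<noteq> 0" "\<theta> (y\<^sup>2) \<noteq> 0" "\<And>j. j \<in> K - {l} \<Longrightarrow> v y (z j) \<noteq> 0"
  shows "generic_point p K (z(l := y))"
proof -
  have z: "z j \<noteq> 0" if "j \<in> K" for j using assms(1) that by (auto simp: generic_point_def)
  have "v (z j) y \<noteq> 0" if "j \<in> K - {l}" for j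
    using theta_pair_swap[OF p, of y "z j"] assms(3) assms(5)[OF that] z that by auto
  then show ?thesis using assms by (auto simp: generic_point_def)
qed

lemma generic_point_insert_node:
  assumes gen: "generic_point p K z" and A: "nodes (b k0) r A z" and B: "nodes (b k1) s B z"
    and r: "r < card K" and s: "s \<le> card K" and l: "l \<in> K - A - B"
    and torus: "\<And>i. i \<in> K - A - B \<Longrightarrow> norm (z i) = 1"
  shows "generic_point p K (z(l := b k0 * t ^ r))"
proof (rule generic_point_update[OF gen])
  show "l \<in> K" using l by auto
  show "b k0 * t ^ r \<noteq> 0" using b01 t by simp
  show "\<theta> ((b k0 * t ^ r)\<^sup>2) \<noteq> 0"
    using gen_square(1)[of "r + r"] by (simp add: power_add power2_eq_square mult_ac)
  fix j assume "j \<in> K - {l}"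
  then consider "j \<in> A" | "j \<in> B" | "j \<in> K - A - B" by blast
  then show "v (b k0 * t ^ r) (z j) \<noteq> 0"
  proof cases
    case 1
    then obtain i where "i < r" "z j = b k0 * t ^ i" using nodes_memberD[OF A] by blast
    then show ?thesis using node_pair_same[of r i] r by simp
  next
    case 2
    then obtain i where "i < s" "z j = b k1 * t ^ i" using nodes_memberD[OF B] by blast
    then show ?thesis using node_pair_different[of r i] r s by simp
  next
    case 3
    then show ?thesis using node_pair_torus[OF r torus] by blast
  qed
qed

end

context bc_generic
begin

interpretation sw: bc_generic p t b K k1 k0 by (rule swap)

text \<open>
  By induction on the number of variables that are not yet at a node. Such a variable can be moved
  to the next node \<open>at\<^sup>r\<close> or to the next node \<open>a't\<^sup>s\<close>, and the two values determine the defect.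
\<close>

lemma defect_eq_0:
  fixes \<gamma> x :: "nat \<Rightarrow> complex" and N :: nat and g
  defines "g \<equiv> test_fun \<gamma> x N"
  assumes x: "\<And>i. i < N \<Longrightarrow> x i \<noteq> 0"
    and base: "\<And>A B r s z. nodes (b k0) r A z \<Longrightarrow> nodes (b k1) s B z \<Longrightarrow> A \<inter> B = {} \<Longrightarrow> A \<union> B = K \<Longrightarrow>
      defect g c (b k0) d (b k1) z = 0"
    and "generic_point p K z" "nodes (b k0) r A z" "nodes (b k1) s B z" "A \<inter> B = {}" "A \<union> B \<subseteq> K"
    and "\<And>i. i \<in> K - A - B \<Longrightarrow> norm (z i) = 1"
  shows "defect g c (b k0) d (b k1) z = 0"
  using assms(4-)
proof (induction "card (K - A - B)" arbitrary: A B r s z)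
  case 0
  then have "A \<union> B = K" using K by auto
  then show ?case using base 0 by blast
next
  case (Suc m)
  obtain l where l: "l \<in> K - A - B" using Suc.hyps(2) by (metis card.empty equals0I nat.distinct(1))
  have fin: "finite A" "finite B" using Suc.prems K by (auto intro: finite_subset)
  have "card A + card B < card K"
  proof -
    have "A \<union> B \<subset> K" using l Suc.prems by blast
    then have "card (A \<union> B) < card K" using K by (intro psubset_card_mono) auto
    then show ?thesis using card_Un_disjoint[OF fin] Suc.prems by simp
  qed
  then have rs: "r < card K" "s < card K"
    using nodes_card[OF Suc.prems(2)] nodes_card[OF Suc.prems(3)] by auto
  have KA: "K - A - B - {l} = K - insert l A - B" "K - A - B - {l} = K - A - insert l B" using l by auto
  have card: "m = card (K - A - B - {l})"
    using Suc.hyps(2) l K by simp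
  have 1: "generic_point p K (z(l := b k0 * t ^ r))"
    by (rule generic_point_insert_node[where A = A and B = B and s = s]) (use Suc.prems rs l in auto)
  have 2: "generic_point p K (z(l := b k1 * t ^ s))"
    by (rule sw.generic_point_insert_node[where A = B and B = A and s = r]) (use Suc.prems rs l in auto)
  have d1: "defect g c (b k0) d (b k1) (z(l := b k0 * t ^ r)) = 0"
    by (rule Suc.hyps(1)[of "insert l A" B, OF _ 1 nodes_insert[OF Suc.prems(2)] nodes_upd[OF Suc.prems(3)]])
       (use Suc.prems l card KA in auto)
  have d2: "defect g c (b k0) d (b k1) (z(l := b k1 * t ^ s)) = 0"
    by (rule Suc.hyps(1)[of A "insert l B", OF _ 2 nodes_upd[OF Suc.prems(2)] nodes_insert[OF Suc.prems(3)]])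
       (use Suc.prems l card KA in auto)
  have "defect g c (b k0) d (b k1) (z(l := z l)) = 0"
    unfolding g_def
    by (rule defect_interpolation[OF x _ b01 _ 1 2])
       (use Suc.prems l rs node_pair_different d1 d2 in \<open>auto simp: g_def\<close>)
  then show ?case by simp
qed

end

section \<open>The linear relation for generic parameters\<close>

text \<open>
  In terms of \<open>f(e) = \<theta>(ct\<^sup>e)\<close> the product splits into two telescoping products and
  \<open>\<Prod>\<^sub>r f(2r + 2 - n) / f(n - 2 - 2r)\<close>, in which the substitution \<open>r \<mapsto> n - 2 - r\<close> exchanges numerators and
  denominators except for \<open>r = n - 1\<close>.
\<close>

lemma theta_quotient_identity:
  assumes p: "norm p < 1" "p \<noteq> 0" and t: "t \<noteq> 0" and c: "c \<noteq> 0"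
    and gen: "\<And>e. theta (c * t powi e) p \<noteq> 0"
  shows "(\<Prod>r<n. - c * (theta (t powi (int r + 1) / c) p * theta (c * t powi (2 * int r + 2 - int n)) p *
        theta (t powi (- int r) / c) p) /
      (theta (c * t powi (int r + 1)) p * theta (t powi (2 * int r + 2 - int n) / c) p *
        theta (c * t powi (- int r)) p)) = 1" (is "(\<Prod>r<n. ?T r) = 1")
proof -
  define f where "f e = theta (c * t powi e) p" for e
  have f0: "f e \<noteq> 0" for e using gen by (simp add: f_def)
  have h: "theta (t powi e / c) p = - f (- e) / (c * t powi (- e))" for e
    using theta_inverse[OF p, of "c * t powi (- e)"] c t
    by (simp add: f_def power_int_minus field_simps)
  define U where "U r = (t ^ (n - Suc r) / t ^ r) * (f (- int (Suc r)) / f (- int r)) * (f (int r) / f (int (Suc r))) *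
       (f (2 * int r + 2 - int n) / f (int n - 2 * int r - 2))" for r
  have "(\<Prod>r<n. ?T r) =
    (\<Prod>r<n. U r)"
  proof (rule prod.cong[OF refl])
    fix r assume "r \<in> {..<n}"
    then have r: "r < n" by simp
    have e1: "t ^ (n - Suc r) / t ^ r = t powi (int n - 1 - 2 * int r)"
    proof -
      have "t ^ (n - Suc r) / t ^ r = t powi (int (n - Suc r)) / t powi int r" by simp
      also have "\<dots> = t powi (int (n - Suc r) - int r)" by (rule power_int_diff[symmetric]) (use t in auto)
      also have "int (n - Suc r) - int r = int n - 1 - 2 * int r" using r by simp
      finally show ?thesis .
    qed
    have e2: "t powi (int n - 1 - 2 * int r) * t powi (- (int r + 1)) * t powi (int r) =
        t powi (- (2 * int r + 2 - int n))"
      unfolding power_int_add[OF disjI1[OF t], symmetric] by (rule arg_cong[of _ _ "(powi) t"]) simp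
    have cancel: "- c * (- X / (c * T1) * F * (- Y / (c * T2))) / (F1 * (- F2 / (c * T3)) * F3) =
        E * (X / F3) * (Y / F1) * (F / F2)"
      if "E * T1 * T2 = T3" "T1 \<noteq> 0" "T2 \<noteq> 0" "T3 \<noteq> 0" "F1 \<noteq> 0" "F2 \<noteq> 0" "F3 \<noteq> 0"
      for T1 T2 T3 E F F1 F2 F3 X Y :: complex
    proof -
      have "E = T3 / (T1 * T2)" using that by (simp add: field_simps)
      then show ?thesis using that(2-) c by (simp add: divide_simps)
    qed
    have i: "- int (Suc r) = - (int r + 1)" "int (Suc r) = int r + 1"
      "int n - 2 * int r - 2 = - (2 * int r + 2 - int n)" by simp_all
    show "?T r =
      U r"
      unfolding U_def h e1 i f_def[symmetric] minus_minus
      by (rule cancel[OF e2]) (use t f0 in auto)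
  qed
  also have "\<dots> = (\<Prod>r<n. t ^ (n - Suc r) / t ^ r) * (\<Prod>r<n. f (- int (Suc r)) / f (- int r)) *
      (\<Prod>r<n. f (int r) / f (int (Suc r))) * (\<Prod>r<n. f (2 * int r + 2 - int n) / f (int n - 2 * int r - 2))"
    by (simp only: U_def prod.distrib)
  also have "(\<Prod>r<n. t ^ (n - Suc r) / t ^ r) = 1"
    unfolding prod_dividef prod.nat_diff_reindex using t by simp
  also have "(\<Prod>r<n. f (- int (Suc r)) / f (- int r)) = f (- int n) / f 0"
    using prod_lessThan_telescope[of n "\<lambda>r. f (- int r)"] f0 by simp
  also have "(\<Prod>r<n. f (int r) / f (int (Suc r))) = f 0 / f (int n)"
    using prod_lessThan_telescope'[of n "\<lambda>r. f (int r)"] f0 by simp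
  also have "(\<Prod>r<n. f (2 * int r + 2 - int n) / f (int n - 2 * int r - 2)) = f (int n) / f (- int n)"
  proof (cases n)
    case 0
    then show ?thesis using f0 by simp
  next
    case (Suc m)
    have "(\<Prod>r<m. f (int n - 2 * int r - 2)) = (\<Prod>r<m. f (2 * int (m - Suc r) + 2 - int n))"
      by (rule prod.cong) (use Suc in \<open>auto simp: of_nat_diff algebra_simps\<close>)
    also have "\<dots> = (\<Prod>r<m. f (2 * int r + 2 - int n))"
      by (rule prod.nat_diff_reindex)
    finally have eq: "(\<Prod>r<m. f (int n - 2 * int r - 2)) = (\<Prod>r<m. f (2 * int r + 2 - int n))" .
    have split: "(\<Prod>r<n. g r) = (\<Prod>r<m. g r) * g m" for g :: "nat \<Rightarrow> complex"
      unfolding Suc by (rule prod.lessThan_Suc)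
    have last: "f (2 * int m + 2 - int n) = f (int n)" "f (int n - 2 * int m - 2) = f (- int n)"
      by (rule arg_cong[of _ _ f], simp add: Suc)+
    have "(\<Prod>r<m. f (2 * int r + 2 - int n)) \<noteq> 0" using f0 by simp
    then show ?thesis unfolding split prod_dividef eq last by simp
  qed
  finally show ?thesis using f0 by simp
qed

context bc_generic
begin

definition others :: "complex \<Rightarrow> complex" where
  "others w = (\<Prod>m\<in>{1..6} - {k0, k1}. \<theta> (b m * w))"

text \<open>
  This factor of \<^const>\<open>step_coeff\<close> involves only \<open>t\<close> and cancels in ratios.
\<close>

definition t_quotient :: "nat \<Rightarrow> complex" where
  "t_quotient r = (\<Prod>j<r. \<theta> (t ^ (r + 1 - j)) / \<theta> (t ^ (r - j)))"

lemma t_quotient_nonzero: "r < card K \<Longrightarrow> t_quotient r \<noteq> 0"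
  unfolding t_quotient_def using gen_t by auto

text \<open>
  The products over the nodes telescope, and what remains of them cancels against the factors of
  \<^const>\<open>coeff\<close> for the parameters \<open>b k0\<close> and \<open>b k1\<close>.
\<close>

lemma step_coeff_closed:
  assumes rs: "r + s < card K"
  shows "step_coeff (b k0) (b k1) r s =
    others (b k0 * t ^ r) / (b k0 * t ^ r) * t_quotient r * \<theta> (b k0 * b k1 * t ^ (r + s)) *
      \<theta> (b k0 / b k1 * t powi (int r + 1)) / \<theta> (b k0 / b k1 * t powi (int r + 1 - int s))"
proof -
  define a where "a = b k0"
  define a' where "a' = b k1"
  have a: "a \<noteq> 0" "a' \<noteq> 0" using b01 by (auto simp: a_def a'_def)
  have sq: "\<theta> (a\<^sup>2 * t ^ j) \<noteq> 0" for j using gen_square(1) by (simp add: a_def)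
  have pr: "\<theta> (a * a' * t ^ j) \<noteq> 0" if "j \<le> r + s" for j
    using gen_product that rs by (simp add: a_def a'_def)
  have qu: "\<theta> (a / a' * t powi e) \<noteq> 0" for e using gen_quotient by (simp add: a_def a'_def)
  have "{1..6} = insert k0 (insert k1 ({1..6} - {k0, k1}))" using k01 by auto
  then have "(\<Prod>m=1..6. \<theta> (b m * w)) = (\<Prod>m\<in>insert k0 (insert k1 ({1..6} - {k0, k1})). \<theta> (b m * w))" for w
    by simp
  then have "(\<Prod>m=1..6. \<theta> (b m * (a * t ^ r))) = \<theta> (a * (a * t ^ r)) * (\<theta> (a' * (a * t ^ r)) * others (a * t ^ r))"
    using k01 by (simp add: others_def a_def a'_def)
  moreover have "a * (a * t ^ r) = a\<^sup>2 * t ^ r" "a' * (a * t ^ r) = a * a' * t ^ r" "(a * t ^ r)\<^sup>2 = a\<^sup>2 * t ^ (r + r)"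
    by (simp_all add: power2_eq_square power_add)
  ultimately have co: "coeff (a * t ^ r) = \<theta> (a\<^sup>2 * t ^ r) * (\<theta> (a * a' * t ^ r) * others (a * t ^ r)) /
      (a * t ^ r * \<theta> (a\<^sup>2 * t ^ (r + r)))"
    unfolding coeff_def by simp
  have A: "(\<Prod>j<r. v (t * (a * t ^ r)) (a * t ^ j) / v (a * t ^ r) (a * t ^ j)) =
      \<theta> (a\<^sup>2 * t ^ (r + r)) / \<theta> (a\<^sup>2 * t ^ r) * t_quotient r"
  proof -
    have "v (t * (a * t ^ r)) (a * t ^ j) / v (a * t ^ r) (a * t ^ j) =
        \<theta> (a\<^sup>2 * t ^ (r + Suc j)) / \<theta> (a\<^sup>2 * t ^ (r + j)) * (\<theta> (t ^ (r + 1 - j)) / \<theta> (t ^ (r - j)))" if "j < r" for j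
    proof -
      have "t * (a * t ^ r) * (a * t ^ j) = a\<^sup>2 * t ^ (r + Suc j)" "a * t ^ r * (a * t ^ j) = a\<^sup>2 * t ^ (r + j)"
        by (simp_all add: power_add power2_eq_square)
      moreover have "t * (a * t ^ r) / (a * t ^ j) = t ^ (r + 1 - j)" "a * t ^ r / (a * t ^ j) = t ^ (r - j)"
        using that a t by (simp_all add: power_diff)
      ultimately show ?thesis unfolding theta_pair_def by (simp only: times_divide_times_eq)
    qed
    then have "(\<Prod>j<r. v (t * (a * t ^ r)) (a * t ^ j) / v (a * t ^ r) (a * t ^ j)) =
        (\<Prod>j<r. \<theta> (a\<^sup>2 * t ^ (r + Suc j)) / \<theta> (a\<^sup>2 * t ^ (r + j))) * t_quotient r"
      unfolding t_quotient_def by (simp add: prod.distrib[symmetric])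
    also have "(\<Prod>j<r. \<theta> (a\<^sup>2 * t ^ (r + Suc j)) / \<theta> (a\<^sup>2 * t ^ (r + j))) = \<theta> (a\<^sup>2 * t ^ (r + r)) / \<theta> (a\<^sup>2 * t ^ (r + 0))"
      by (rule prod_lessThan_telescope[of r "\<lambda>j. \<theta> (a\<^sup>2 * t ^ (r + j))"]) (rule sq)
    finally show ?thesis by simp
  qed
  have B: "(\<Prod>j<s. v (t * (a * t ^ r)) (a' * t ^ j) / v (a * t ^ r) (a' * t ^ j)) =
      \<theta> (a * a' * t ^ (r + s)) / \<theta> (a * a' * t ^ r) *
      (\<theta> (a / a' * t powi (int r + 1)) / \<theta> (a / a' * t powi (int r + 1 - int s)))"
  proof -
    have "v (t * (a * t ^ r)) (a' * t ^ j) / v (a * t ^ r) (a' * t ^ j) =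
        \<theta> (a * a' * t ^ (r + Suc j)) / \<theta> (a * a' * t ^ (r + j)) *
        (\<theta> (a / a' * t powi (int r + 1 - int j)) / \<theta> (a / a' * t powi (int r + 1 - int (Suc j))))" for j
    proof -
      have "t * (a * t ^ r) * (a' * t ^ j) = a * a' * t ^ (r + Suc j)" "a * t ^ r * (a' * t ^ j) = a * a' * t ^ (r + j)"
        by (simp_all add: power_add)
      moreover have "t * (a * t ^ r) / (a' * t ^ j) = a / a' * t powi (int r + 1 - int j)"
        "a * t ^ r / (a' * t ^ j) = a / a' * t powi (int r + 1 - int (Suc j))"
        using a t by (simp_all add: power_int_diff power_int_add)
      ultimately show ?thesis unfolding theta_pair_def by (simp only: times_divide_times_eq)
    qed
    then have "(\<Prod>j<s. v (t * (a * t ^ r)) (a' * t ^ j) / v (a * t ^ r) (a' * t ^ j)) =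
        (\<Prod>j<s. \<theta> (a * a' * t ^ (r + Suc j)) / \<theta> (a * a' * t ^ (r + j))) *
        (\<Prod>j<s. \<theta> (a / a' * t powi (int r + 1 - int j)) / \<theta> (a / a' * t powi (int r + 1 - int (Suc j))))"
      by (simp only: prod.distrib)
    also have "(\<Prod>j<s. \<theta> (a * a' * t ^ (r + Suc j)) / \<theta> (a * a' * t ^ (r + j))) = \<theta> (a * a' * t ^ (r + s)) / \<theta> (a * a' * t ^ (r + 0))"
      by (rule prod_lessThan_telescope[of s "\<lambda>j. \<theta> (a * a' * t ^ (r + j))"]) (use pr in auto)
    also have "(\<Prod>j<s. \<theta> (a / a' * t powi (int r + 1 - int j)) / \<theta> (a / a' * t powi (int r + 1 - int (Suc j)))) =
        \<theta> (a / a' * t powi (int r + 1 - int 0)) / \<theta> (a / a' * t powi (int r + 1 - int s))"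
      by (rule prod_lessThan_telescope'[of s "\<lambda>j. \<theta> (a / a' * t powi (int r + 1 - int j))"]) (rule qu)
    finally show ?thesis by simp
  qed
  have "step_coeff a a' r s = others (a * t ^ r) / (a * t ^ r) * t_quotient r * \<theta> (a * a' * t ^ (r + s)) *
      \<theta> (a / a' * t powi (int r + 1)) / \<theta> (a / a' * t powi (int r + 1 - int s))"
    unfolding step_coeff_def co A B using sq[of r] sq[of "r + r"] pr[of r] by (simp add: field_simps)
  then show ?thesis by (simp add: a_def a'_def)
qed

lemma others_nonzero: "r < card K \<Longrightarrow> others (b k0 * t ^ r) \<noteq> 0"
  unfolding others_def using gen_other by (auto simp: mult.assoc)

lemma step_coeff_nonzero: "r + s < card K \<Longrightarrow> step_coeff (b k0) (b k1) r s \<noteq> 0"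
  using step_coeff_closed[of r s] others_nonzero[of r] t_quotient_nonzero[of r] b01 t
    gen_product[of "r + s"] gen_quotient by auto

end

context bc_generic
begin

interpretation sw: bc_generic p t b K k1 k0 by (rule swap)

lemma swapped_others: "sw.others w = others w"
  unfolding others_def sw.others_def by (simp add: insert_commute)

lemma step_ratio:
  assumes r: "r < card K"
  shows "- (step_coeff (b k1) (b k0) r (card K - 1 - r) / step_coeff (b k0) (b k1) r (card K - 1 - r)) *
      (v (b k1) (b k0 * t ^ r) / v (b k0) (b k1 * t ^ r)) =
    others (b k1 * t ^ r) / others (b k0 * t ^ r) *
    (let c = b k0 / b k1; n = card K in
     - c * (\<theta> (t powi (int r + 1) / c) * \<theta> (c * t powi (2 * int r + 2 - int n)) * \<theta> (t powi (- int r) / c)) /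
      (\<theta> (c * t powi (int r + 1)) * \<theta> (t powi (2 * int r + 2 - int n) / c) * \<theta> (c * t powi (- int r))))"
proof -
  define c where "c = b k0 / b k1"
  define s where "s = card K - 1 - r"
  define M where "M = \<theta> (b k0 * b k1 * t ^ (r + s))"
  define L where "L = \<theta> (b k0 * b k1 * t ^ r)"
  have rs: "r + s < card K" using r by (simp add: s_def)
  have e: "int r + 1 - int s = 2 * int r + 2 - int (card K)" using r by (simp add: s_def of_nat_diff)
  have c': "b k1 / b k0 * x = x / c" for x using b01 by (simp add: c_def)
  have 1: "step_coeff (b k0) (b k1) r s = others (b k0 * t ^ r) / (b k0 * t ^ r) * t_quotient r * M *
      \<theta> (c * t powi (int r + 1)) / \<theta> (c * t powi (2 * int r + 2 - int (card K)))"
    unfolding step_coeff_closed[OF rs] e c_def M_def ..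
  have 2: "step_coeff (b k1) (b k0) r s = others (b k1 * t ^ r) / (b k1 * t ^ r) * t_quotient r * M *
      \<theta> (t powi (int r + 1) / c) / \<theta> (t powi (2 * int r + 2 - int (card K)) / c)"
    unfolding sw.step_coeff_closed[OF rs] e c' M_def swapped_others
    by (simp only: mult.commute[of "b k1" "b k0"])
  have 3: "v (b k1) (b k0 * t ^ r) = L * \<theta> (t powi (- int r) / c)"
  proof -
    have "b k1 / (b k0 * t ^ r) = t powi (- int r) / c"
      using b01 t by (simp add: c_def power_int_minus field_simps)
    then show ?thesis by (simp add: theta_pair_def L_def mult_ac)
  qed
  have 4: "v (b k0) (b k1 * t ^ r) = L * \<theta> (c * t powi (- int r))"
  proof -
    have "b k0 / (b k1 * t ^ r) = c * t powi (- int r)"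
      using b01 t by (simp add: c_def power_int_minus field_simps)
    then show ?thesis by (simp add: theta_pair_def L_def mult_ac)
  qed
  have nz: "M \<noteq> 0" "L \<noteq> 0" "t_quotient r \<noteq> 0" "others (b k0 * t ^ r) \<noteq> 0"
    using gen_product rs r t_quotient_nonzero others_nonzero by (auto simp: M_def L_def)
  have nz2: "\<theta> (c * t powi x) \<noteq> 0" "\<theta> (t powi x / c) \<noteq> 0" for x
    using gen_quotient[of x] gen_quotient'[of x] unfolding c' c_def[symmetric] by blast+
  have rat: "- (O1 / (B1 * T) * Q * M * X1 / X2 / (O0 / (B0 * T) * Q * M * Y1 / Y2)) * (L * X3 / (L * Y3)) =
     O1 / O0 * (- c' * (X1 * Y2 * X3) / (Y1 * X2 * Y3))"
    if "c' = B0 / B1" "Q \<noteq> 0" "M \<noteq> 0" "L \<noteq> 0" "O0 \<noteq> 0" "B0 \<noteq> 0" "B1 \<noteq> 0" "T \<noteq> 0" "Y1 \<noteq> 0" "Y2 \<noteq> 0" "X2 \<noteq> 0" "Y3 \<noteq> 0"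
    for Q M L O0 O1 B0 B1 T X1 X2 X3 Y1 Y2 Y3 c' :: complex
    using that by (simp add: field_simps)
  show ?thesis
    unfolding s_def[symmetric] 1 2 3 4 Let_def c_def[symmetric]
    by (rule rat[OF c_def]) (use nz nz2 b01 t in auto)
qed

text \<open>
  The values \<open>\<tau> r\<close> of the test function at \<open>r\<close> nodes of the first and \<open>n - 1 - r\<close> nodes of the second kind
  are chosen such that the two surviving terms of the coboundary cancel for \<open>0 < r < n\<close>. They can be
  prescribed because \<open>\<Prod>\<^sub>j v\<^sub>x(z\<^sub>j)\<close> with \<open>x = at\<^sup>l\<close> vanishes as soon as \<open>at\<^sup>l\<close> is one of the nodes, that
  is, for \<open>r > l\<close>.
\<close>

lemma coboundary_relation:
  obtains \<gamma> x :: "nat \<Rightarrow> complex" and N :: nat and c d where "\<forall>l<N. x l \<noteq> 0" "d \<noteq> 0"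
    "\<forall>z. (\<forall>i\<in>K. norm (z i) = 1) \<longrightarrow> generic_point p K z \<longrightarrow>
       coboundary (test_fun \<gamma> x N) z = c * (\<Prod>i\<in>K. v (b k0) (z i)) + d * (\<Prod>i\<in>K. v (b k1) (z i))"
    "- (c / d) = (\<Prod>i<card K. \<Prod>m\<in>{1..6} - {k0, k1}. \<theta> (b m * b k1 * t ^ i) / \<theta> (b m * b k0 * t ^ i))"
proof -
  define n where "n = card K"
  have n: "n > 0" using K by (simp add: n_def card_gt_0_iff)
  define C where "C r = step_coeff (b k0) (b k1) r (n - 1 - r)" for r
  define D where "D r = step_coeff (b k1) (b k0) r (n - 1 - r)" for r
  have C0: "C r \<noteq> 0" and D0: "D r \<noteq> 0" if "r < n" for r
    using step_coeff_nonzero[of r "n - 1 - r"] sw.step_coeff_nonzero[of r "n - 1 - r"] that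
    by (auto simp: C_def D_def n_def)
  define \<tau> where "\<tau> r = (\<Prod>i<r. - (C i / D (n - 1 - Suc i)))" for r
  define x where "x l = b k0 * t ^ l" for l
  have x0: "x l \<noteq> 0" for l using b01 t by (simp add: x_def)
  define M where "M l r = (\<Prod>j<r. v (x l) (b k0 * t ^ j)) * (\<Prod>j<n - 1 - r. v (x l) (b k1 * t ^ j))" for l r
  have M1: "M l r = 0" if "l < r" for l r
  proof -
    have "v (x l) (b k0 * t ^ l) = 0" unfolding x_def using theta_pair_self[OF p(1)] b01 t by simp
    then have "(\<Prod>j<r. v (x l) (b k0 * t ^ j)) = 0" using that by (intro prod_zero) auto
    then show ?thesis by (simp add: M_def)
  qed
  have M2: "M l l \<noteq> 0" if "l < n" for l
    unfolding M_def x_def using that node_pair_same node_pair_different by (auto simp: n_def)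
  obtain \<gamma> where \<gamma>: "\<And>r. r < n \<Longrightarrow> (\<Sum>l<n. \<gamma> l * M l r) = \<tau> r"
    using triangular_system[of n M \<tau>] M1 M2 by blast
  have nv: "node_value \<gamma> x n (b k0) (b k1) r (n - 1 - r) = \<tau> r" if "r < n" for r
    using \<gamma>[OF that] unfolding node_value_def M_def by simp
  define P0 where "P0 = (\<Prod>j<n. v (b k0) (b k1 * t ^ j))"
  define P1 where "P1 = (\<Prod>j<n. v (b k1) (b k0 * t ^ j))"
  have P0: "P0 \<noteq> 0" and P1: "P1 \<noteq> 0"
    using node_pair_different[of 0] sw.node_pair_different[of 0] n by (auto simp: P0_def P1_def n_def)
  \<comment> \<open>These constants make the defect vanish at the two extreme configurations \<open>r = 0\<close> and \<open>r = n\<close>.\<close>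
  define c where "c = D (n - 1) * \<tau> 0 / P0"
  define d where "d = C (n - 1) * \<tau> (n - 1) / P1"
  have \<tau>0: "\<tau> r \<noteq> 0" if "r < n" for r
    unfolding \<tau>_def using C0 D0 that by (auto simp: n_def)
  have base: "defect (test_fun \<gamma> x n) c (b k0) d (b k1) z = 0"
    if A: "nodes (b k0) r A z" and B: "nodes (b k1) s B z" and AB: "A \<inter> B = {}" "A \<union> B = K" for A B r s z
  proof -
    have fin: "finite A" "finite B" using AB K by (auto intro: finite_subset)
    have rs: "r + s = n"
      using nodes_card[OF A] nodes_card[OF B] card_Un_disjoint[OF fin AB(1)] AB(2) by (simp add: n_def)
    have cob: "coboundary (test_fun \<gamma> x n) z =
      (if r = 0 then 0 else step_coeff (b k0) (b k1) (r - 1) s * node_value \<gamma> x n (b k0) (b k1) (r - 1) s) +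
      (if s = 0 then 0 else step_coeff (b k1) (b k0) (s - 1) r * node_value \<gamma> x n (b k0) (b k1) r (s - 1))"
      by (rule coboundary_at_nodes[OF A B AB refl k01(1) refl k01(2) t_neq_1])
    have prod: "(\<Prod>k\<in>K. G (z k)) = (\<Prod>j<r. G (b k0 * t ^ j)) * (\<Prod>j<s. G (b k1 * t ^ j))" for G :: "complex \<Rightarrow> complex"
    proof -
      have "(\<Prod>k\<in>K. G (z k)) = (\<Prod>k\<in>A. G (z k)) * (\<Prod>k\<in>B. G (z k))"
        unfolding AB(2)[symmetric] by (rule prod.union_disjoint[OF fin AB(1)])
      then show ?thesis unfolding nodes_prod[OF A] nodes_prod[OF B] .
    qed
    have z0: "(\<Prod>j<m. v y (y * t ^ j)) = 0" if "m > 0" "y \<noteq> 0" for m y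
    proof -
      have "v y (y * t ^ 0) = 0" using theta_pair_self[OF p(1) that(2)] by simp
      then show ?thesis using that(1) by (intro prod_zero) blast+
    qed
    consider "r = 0" "s = n" | "r = n" "s = 0" | "r > 0" "s > 0" using rs by linarith
    then show ?thesis
    proof cases
      case 1
      have "coboundary (test_fun \<gamma> x n) z = D (n - 1) * \<tau> 0"
        unfolding cob using 1 n nv[of 0] by (simp add: D_def)
      moreover have "(\<Prod>k\<in>K. v (b k0) (z k)) = P0" "(\<Prod>k\<in>K. v (b k1) (z k)) = 0"
        unfolding prod using 1 n z0 b01 by (simp_all add: P0_def)
      ultimately show ?thesis using P0 by (simp add: defect_def c_def)
    next
      case 2
      have "coboundary (test_fun \<gamma> x n) z = C (n - 1) * \<tau> (n - 1)"
        unfolding cob using 2 n nv[of "n - 1"] by (simp add: C_def)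
      moreover have "(\<Prod>k\<in>K. v (b k1) (z k)) = P1" "(\<Prod>k\<in>K. v (b k0) (z k)) = 0"
        unfolding prod using 2 n z0 b01 by (simp_all add: P1_def)
      ultimately show ?thesis using P1 by (simp add: defect_def d_def)
    next
      case 3
      obtain r' where r': "r = Suc r'" using 3 by (cases r) auto
      have s: "s = n - 1 - r'" "s - 1 = n - 1 - Suc r'" "r = n - 1 - (s - 1)" using rs r' 3 by auto
      have "coboundary (test_fun \<gamma> x n) z = C r' * \<tau> r' + D (s - 1) * \<tau> (Suc r')"
      proof -
        have "step_coeff (b k0) (b k1) (r - 1) s = C r'" using s(1) by (simp add: C_def r')
        moreover have "step_coeff (b k1) (b k0) (s - 1) r = D (s - 1)" using s(3) by (simp add: D_def)
        moreover have "node_value \<gamma> x n (b k0) (b k1) (r - 1) s = \<tau> r'" using nv[of r'] s(1) rs 3 r' by simp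
        moreover have "node_value \<gamma> x n (b k0) (b k1) r (s - 1) = \<tau> (Suc r')" using nv[of r] s(2) rs 3 r' by simp
        ultimately show ?thesis unfolding cob using 3 by simp
      qed
      also have "\<tau> (Suc r') = - (C r' / D (s - 1)) * \<tau> r'" unfolding s(2) by (simp add: \<tau>_def)
      also have "C r' * \<tau> r' + D (s - 1) * (- (C r' / D (s - 1)) * \<tau> r') = 0"
        using D0[of "s - 1"] rs 3 by simp
      finally show ?thesis
        unfolding defect_def prod z0[OF 3(1) b01(1)] z0[OF 3(2) b01(2)] by simp
    qed
  qed
  show ?thesis
  proof
    show "\<forall>l<n. x l \<noteq> 0" using x0 by blast
    show "d \<noteq> 0" using C0 \<tau>0 P1 n by (simp add: d_def)
    show "\<forall>z. (\<forall>i\<in>K. norm (z i) = 1) \<longrightarrow> generic_point p K z \<longrightarrow>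
       coboundary (test_fun \<gamma> x n) z = c * (\<Prod>i\<in>K. v (b k0) (z i)) + d * (\<Prod>i\<in>K. v (b k1) (z i))"
    proof (intro allI impI)
      fix z assume z: "\<forall>i\<in>K. norm (z i) = 1" "generic_point p K z"
      have "nodes y 0 {} z" for y by (simp add: nodes_def bij_betw_def)
      then have "defect (test_fun \<gamma> x n) c (b k0) d (b k1) z = 0"
        using defect_eq_0[of n x \<gamma> c d z 0 "{}" 0 "{}", OF x0 base] z by auto
      then show "coboundary (test_fun \<gamma> x n) z = c * (\<Prod>i\<in>K. v (b k0) (z i)) + d * (\<Prod>i\<in>K. v (b k1) (z i))"
        by (simp add: defect_def algebra_simps)
    qed
    obtain m where m: "n = Suc m" using n by (cases n) auto
    have "- (c / d) = - (D m / C m) * (1 / \<tau> m) * (P1 / P0)"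
      using m by (simp add: c_def d_def \<tau>_def)
    also have "1 / \<tau> m = (\<Prod>i<m. - (D (m - Suc i) / C i))"
    proof -
      have "1 / \<tau> m = (\<Prod>i<m. 1 / - (C i / D (m - Suc i)))"
        unfolding \<tau>_def m by (simp only: prod_dividef prod.neutral_const diff_Suc_1)
      also have "\<dots> = (\<Prod>i<m. - (D (m - Suc i) / C i))"
        by (rule prod.cong) simp_all
      finally show ?thesis .
    qed
    also have "\<dots> = (\<Prod>i<m. - 1) * (\<Prod>i<m. D i) / (\<Prod>i<m. C i)"
      using prod.nat_diff_reindex[of D m] by (simp add: prod_uminus prod_dividef)
    also have "- (D m / C m) * ((\<Prod>i<m. - 1) * (\<Prod>i<m. D i) / (\<Prod>i<m. C i)) * (P1 / P0) =
        (\<Prod>r<n. - (D r / C r)) * (P1 / P0)"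
      by (simp add: m prod_uminus prod_dividef mult_ac)
    also have "\<dots> = (\<Prod>r<n. - (D r / C r) * (v (b k1) (b k0 * t ^ r) / v (b k0) (b k1 * t ^ r)))"
      unfolding P0_def P1_def by (simp only: prod.distrib prod_dividef)
    also have "\<dots> = (\<Prod>r<n. others (b k1 * t ^ r) / others (b k0 * t ^ r))"
    proof -
      define c' where "c' = b k0 / b k1"
      define T where "T r = - c' * (\<theta> (t powi (int r + 1) / c') * \<theta> (c' * t powi (2 * int r + 2 - int n)) * \<theta> (t powi (- int r) / c')) /
        (\<theta> (c' * t powi (int r + 1)) * \<theta> (t powi (2 * int r + 2 - int n) / c') * \<theta> (c' * t powi (- int r)))" for r
      have "(\<Prod>r<n. T r) = 1"
        unfolding T_def by (rule theta_quotient_identity[OF p t]) (use b01 gen_quotient in \<open>auto simp: c'_def\<close>)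
      moreover have "- (D r / C r) * (v (b k1) (b k0 * t ^ r) / v (b k0) (b k1 * t ^ r)) =
        others (b k1 * t ^ r) / others (b k0 * t ^ r) * T r" if "r < n" for r
        using step_ratio[of r] that unfolding C_def D_def n_def c'_def Let_def T_def by blast
      then have "(\<Prod>r<n. - (D r / C r) * (v (b k1) (b k0 * t ^ r) / v (b k0) (b k1 * t ^ r))) =
        (\<Prod>r<n. others (b k1 * t ^ r) / others (b k0 * t ^ r) * T r)"
        by (intro prod.cong refl) simp
      ultimately show ?thesis by (simp only: prod.distrib mult_1_right)
    qed
    also have "\<dots> = (\<Prod>i<card K. \<Prod>m\<in>{1..6} - {k0, k1}. \<theta> (b m * b k1 * t ^ i) / \<theta> (b m * b k0 * t ^ i))"
      unfolding n_def others_def prod_dividef[symmetric] by (simp only: mult.assoc)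
    finally show "- (c / d) = (\<Prod>i<card K. \<Prod>m\<in>{1..6} - {k0, k1}. \<theta> (b m * b k1 * t ^ i) / \<theta> (b m * b k0 * t ^ i))" .
  qed
qed

end

section \<open>Integration over the torus\<close>

lemma circle_integral_rescale:
  "(LINT y:{0..2 * pi}|lborel. g y) = (2 * pi) *\<^sub>R (LINT x:{0..1}|lborel. g (2 * pi * x))"
  for g :: "real \<Rightarrow> complex"
proof -
  have "indicator {0..2 * pi} (0 + 2 * pi * x) = (indicator {0..1} x :: real)" for x
    by (auto simp: indicator_def zero_le_mult_iff) (use pi_gt_zero in linarith)
  then show ?thesis
    unfolding set_lebesgue_integral_def
    using lborel_integral_real_affine[of "2 * pi" "\<lambda>y. indicator {0..2 * pi} y *\<^sub>R g y" 0] by simp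
qed

lemma circle_integral_reflect:
  "(LINT y:{0..2 * pi}|lborel. g (1 / cis y)) = (LINT y:{0..2 * pi}|lborel. g (cis y))"
  for g :: "complex \<Rightarrow> complex"
proof -
  have "indicator {0..2 * pi} (2 * pi + - 1 * x) = (indicator {0..2 * pi} x :: real)" for x
    by (auto simp: indicator_def)
  moreover have "cis (2 * pi + - 1 * x) = 1 / cis x" for x
    by (simp add: cis_divide[symmetric] flip: cis_divide)
  ultimately show ?thesis
    unfolding set_lebesgue_integral_def
    using lborel_integral_real_affine[of "- 1" "\<lambda>y. indicator {0..2 * pi} y *\<^sub>R g (cis y)" "2 * pi"] by simp
qed

text \<open>
  The loops \<open>q\<^sup>s e\<^sup>i\<^sup>x\<close>, \<open>0 \<le> s \<le> 1\<close>, form a homotopy inside the annulus between the unit circle and its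
  image under multiplication by \<open>q\<close>.
\<close>

lemma circle_integral_shift:
  assumes S: "open S" and G: "G holomorphic_on S" and q: "q \<noteq> 0" "norm q < 1"
    and ann: "\<And>z. norm q \<le> norm z \<Longrightarrow> norm z \<le> 1 \<Longrightarrow> z \<in> S" and S0: "0 \<notin> S"
  shows "(LINT y:{0..2 * pi}|lborel. G (q * cis y)) = (LINT y:{0..2 * pi}|lborel. G (cis y))"
proof -
  define \<gamma> where "\<gamma> c x = c * exp (2 * of_real pi * \<i> * of_real x)" for c :: complex and x :: real
  have \<gamma>n: "norm (\<gamma> c x) = norm c" for c x by (simp add: \<gamma>_def norm_mult)
  have \<gamma>d: "(\<gamma> c has_vector_derivative (2 * of_real pi * \<i>) * \<gamma> c x) (at x within A)" for c x A
    unfolding \<gamma>_def by (rule has_vector_derivative_real_field) (auto intro!: derivative_eq_intros)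
  have \<gamma>c: "continuous_on A (\<gamma> c)" for c A unfolding \<gamma>_def by (intro continuous_intros)
  have valid: "valid_path (\<gamma> c)" for c
    unfolding valid_path_def
    by (rule C1_differentiable_imp_piecewise)
       (auto simp: C1_differentiable_on_def intro!: exI[of _ "\<lambda>x. (2 * of_real pi * \<i>) * \<gamma> c x"] \<gamma>d continuous_intros \<gamma>c)
  have \<gamma>S: "\<gamma> c x \<in> S" if "norm q \<le> norm c" "norm c \<le> 1" for c x
    using that by (intro ann) (simp_all add: \<gamma>n)
  define L where "L = Ln q"
  have L: "exp L = q" "norm (exp (of_real s * L)) = norm q powr s" for s :: real
    using q by (simp_all add: L_def powr_def)
  define h where "h = (\<lambda>(s::real, x::real). exp (of_real s * L) * exp (2 * of_real pi * \<i> * of_real x))"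
  have hom: "homotopic_loops S (\<gamma> 1) (\<gamma> q)"
    unfolding homotopic_loops
  proof (intro exI[of _ h] conjI ballI)
    show "continuous_on ({0..1} \<times> {0..1}) h"
      unfolding h_def case_prod_beta by (intro continuous_intros)
    show "h \<in> {0..1} \<times> {0..1} \<rightarrow> S"
    proof (rule Pi_I)
      fix y :: "real \<times> real" assume "y \<in> {0..1} \<times> {0..1}"
      then obtain s x where y: "y = (s, x)" and s: "s \<in> {0..1}" by auto
      have "norm q powr 1 \<le> norm q powr s" "norm q powr s \<le> norm q powr 0"
        by (rule powr_mono'; use s q in auto)+
      then have "\<gamma> (exp (of_real s * L)) x \<in> S"
        using q by (intro \<gamma>S) (simp_all only: L, simp_all)
      then show "h y \<in> S" by (simp add: y h_def \<gamma>_def)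
    qed
  next
    fix x :: real
    show "h (0, x) = \<gamma> 1 x" "h (1, x) = \<gamma> q x" by (simp_all add: h_def \<gamma>_def L)
    show "pathfinish (h \<circ> Pair x) = pathstart (h \<circ> Pair x)"
      by (simp add: h_def pathfinish_def pathstart_def)
  qed
  have ci: "contour_integral (\<gamma> c) (\<lambda>z. G z / z) = (2 * of_real pi * \<i>) * (LINT x:{0..1}|lborel. G (\<gamma> c x))"
    if c: "norm q \<le> norm c" "norm c \<le> 1" for c
  proof -
    have c0: "\<gamma> c x \<noteq> 0" for x using c q \<gamma>n[of c x] by auto
    have "contour_integral (\<gamma> c) (\<lambda>z. G z / z) =
        integral {0..1} (\<lambda>x. G (\<gamma> c x) / \<gamma> c x * vector_derivative (\<gamma> c) (at x))"
      by (rule contour_integral_integral)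
    also have "\<dots> = integral {0..1} (\<lambda>x. (2 * of_real pi * \<i>) * G (\<gamma> c x))"
      using c0 by (simp add: vector_derivative_at[OF \<gamma>d] mult_ac)
    also have "\<dots> = (2 * of_real pi * \<i>) * integral {0..1} (\<lambda>x. G (\<gamma> c x))"
      by simp
    also have "integral {0..1} (\<lambda>x. G (\<gamma> c x)) = (LINT x:{0..1}|lborel. G (\<gamma> c x))"
    proof (rule set_borel_integral_eq_integral(2)[symmetric], rule borel_integrable_atLeastAtMost')
      show "continuous_on {0..1} (\<lambda>x. G (\<gamma> c x))"
        by (rule continuous_on_compose2[OF holomorphic_on_imp_continuous_on[OF G] \<gamma>c]) (use \<gamma>S c in auto)
    qed
    finally show ?thesis .
  qed
  have "contour_integral (\<gamma> 1) (\<lambda>z. G z / z) = contour_integral (\<gamma> q) (\<lambda>z. G z / z)"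
    by (rule Cauchy_theorem_homotopic_loops[OF hom S _ valid valid])
       (use S0 in \<open>auto intro!: holomorphic_intros G\<close>)
  then have "(LINT x:{0..1}|lborel. G (\<gamma> 1 x)) = (LINT x:{0..1}|lborel. G (\<gamma> q x))"
    using q by (simp add: ci)
  moreover have "\<gamma> c x = c * cis (2 * pi * x)" for c x
    by (simp add: \<gamma>_def cis_conv_exp mult_ac)
  ultimately show ?thesis
    unfolding circle_integral_rescale by simp
qed

abbreviation torus_measure :: "nat set \<Rightarrow> (nat \<Rightarrow> real) measure" where
  "torus_measure K \<equiv> \<Pi>\<^sub>M i\<in>K. lborel"

abbreviation torus_box :: "nat set \<Rightarrow> (nat \<Rightarrow> real) set" where
  "torus_box K \<equiv> K \<rightarrow>\<^sub>E {0..2 * pi}"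

lemma torus_box_finite_measurable:
  fixes K :: "nat set" assumes K: "finite K"
  shows "emeasure (torus_measure K) (torus_box K) < \<infinity>"
    and "(torus_box K) \<in> sets (torus_measure K)"
proof -
  interpret product_sigma_finite "\<lambda>_::nat. lborel :: real measure" ..
  have "emeasure (torus_measure K) (torus_box K) = (\<Prod>i\<in>K. emeasure lborel {0..2 * pi})"
    by (rule emeasure_PiM) (use K in auto)
  also have "\<dots> < \<infinity>" using K by (simp add: ennreal_power)
  finally show "emeasure (torus_measure K) (torus_box K) < \<infinity>" .
  show "(torus_box K) \<in> sets (torus_measure K)"
    by (rule sets_PiM_I_finite) (use K in auto)
qed

text \<open>
  Also the coordinates outside the index set of the torus are restricted, so that membership is
  independent of that set. The points at which integrands are evaluated satisfy this.
\<close>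

definition unimodular :: "(nat \<Rightarrow> complex) set" where
  "unimodular = {z. \<forall>i. norm (z i) = 1}"

definition torus_bounded :: "((nat \<Rightarrow> complex) \<Rightarrow> complex) \<Rightarrow> bool" where
  "torus_bounded f \<longleftrightarrow> (\<exists>C. \<forall>z\<in>unimodular. norm (f z) \<le> C)"

definition torus_measurable :: "nat set \<Rightarrow> ((nat \<Rightarrow> complex) \<Rightarrow> complex) \<Rightarrow> bool" where
  "torus_measurable K f \<longleftrightarrow> (\<lambda>x. f (\<lambda>i. cis (x i))) \<in> borel_measurable (torus_measure K)"

definition torus_average :: "nat set \<Rightarrow> ((nat \<Rightarrow> complex) \<Rightarrow> complex) \<Rightarrow> complex" where
  "torus_average K f = (LINT x : (torus_box K) | (torus_measure K). f (\<lambda>i. cis (x i)))"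

lemma torus_integrable:
  assumes K: "finite K" and f: "torus_measurable K f" "torus_bounded f"
  shows "set_integrable (torus_measure K) (torus_box K) (\<lambda>x. f (\<lambda>i. cis (x i)))"
proof -
  obtain C where C: "\<And>z. z \<in> unimodular \<Longrightarrow> norm (f z) \<le> C"
    using f(2) by (auto simp: torus_bounded_def)
  have le: "norm (f (\<lambda>i. cis (x i))) \<le> C" for x by (rule C) (simp add: unimodular_def)
  note box = torus_box_finite_measurable[OF K]
  show ?thesis
    unfolding set_integrable_def
  proof (rule integrableI_bounded_set[where A = "(torus_box K)" and B = C])
    have [measurable]: "(\<lambda>x. f (\<lambda>i. cis (x i))) \<in> borel_measurable (torus_measure K)"
      using f(1) by (simp add: torus_measurable_def)
    note [measurable] = box(2)
    show "(\<lambda>x. indicator (torus_box K) x *\<^sub>R f (\<lambda>i. cis (x i))) \<in> borel_measurable (torus_measure K)"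
      by measurable
  qed (use box le in \<open>auto simp: indicator_def intro!: AE_I2\<close>)
qed

text \<open>
  Fubini's theorem, with the integration over the variable \<open>z\<^sub>l\<close> inside.
\<close>

lemma torus_average_eq_0:
  assumes K: "finite K" and l: "l \<in> K" and f: "torus_measurable K f" "torus_bounded f"
    and zero: "\<And>z. z \<in> unimodular \<Longrightarrow> (LINT y:{0..2 * pi}|lborel. f (z(l := cis y))) = 0"
  shows "torus_average K f = 0"
proof -
  interpret product_sigma_finite "\<lambda>_::nat. lborel :: real measure" ..
  define J where "J = K - {l}"
  have J: "finite J" "l \<notin> J" "K = insert l J" using K l by (auto simp: J_def)
  define F where "F x = indicator (torus_box K) x *\<^sub>R f (\<lambda>i. cis (x i))" for x
  have int: "integrable (\<Pi>\<^sub>M i\<in>insert l J. lborel) F"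
    using torus_integrable[OF K f] J unfolding set_integrable_def F_def by simp
  have "torus_average K f = integral\<^sup>L (\<Pi>\<^sub>M i\<in>insert l J. lborel) F"
    unfolding torus_average_def set_lebesgue_integral_def F_def J(3) ..
  also have "\<dots> = (LINT x|(torus_measure J). (LINT y|lborel. F (x(l := y))))"
    by (rule product_integral_insert[OF J(1,2) int])
  also have "\<dots> = (LINT x|torus_measure J. 0)"
  proof (rule Bochner_Integration.integral_cong[OF refl])
    fix x :: "nat \<Rightarrow> real" assume "x \<in> space (torus_measure J)"
    then have x: "x \<in> extensional J" by (simp add: space_PiM PiE_def)
    have "F (x(l := y)) = indicator (torus_box J) x *\<^sub>R (indicator {0..2 * pi} y *\<^sub>R f ((\<lambda>i. cis (x i))(l := cis y)))" for y
    proof -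
      have "x(l := y) \<in> (torus_box K) \<longleftrightarrow> x \<in> (torus_box J) \<and> y \<in> {0..2 * pi}"
        using x J by (auto simp: PiE_def Pi_def extensional_def)
      moreover have "(\<lambda>i. cis ((x(l := y)) i)) = (\<lambda>i. cis (x i))(l := cis y)" by auto
      ultimately show ?thesis unfolding F_def by (auto simp: indicator_def)
    qed
    then have "(LINT y|lborel. F (x(l := y))) =
        indicator (torus_box J) x *\<^sub>R (LINT y:{0..2 * pi}|lborel. f ((\<lambda>i. cis (x i))(l := cis y)))"
      unfolding set_lebesgue_integral_def by (simp del: scaleR_scaleR)
    also have "\<dots> = 0" using zero[of "\<lambda>i. cis (x i)"] by (simp add: unimodular_def)
    finally show "(LINT y|lborel. F (x(l := y))) = 0" .
  qed
  finally show ?thesis by simp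
qed

lemma torus_average_add:
  assumes "finite K" "torus_measurable K f" "torus_bounded f" "torus_measurable K g" "torus_bounded g"
  shows "torus_average K (\<lambda>z. f z + g z) = torus_average K f + torus_average K g"
  using torus_integrable[OF assms(1-3)] torus_integrable[OF assms(1,4,5)]
  unfolding torus_average_def by (rule set_integral_add(2))

lemma torus_average_cmult: "torus_average K (\<lambda>z. c * f z) = c * torus_average K f"
  unfolding torus_average_def by simp

lemma torus_average_cong:
  "(\<And>z. z \<in> unimodular \<Longrightarrow> f z = g z) \<Longrightarrow> torus_average K f = torus_average K g"
  unfolding torus_average_def by (simp add: unimodular_def)

lemma torus_bounded_const: "torus_bounded (\<lambda>_. c)"
  unfolding torus_bounded_def by blast

lemma torus_bounded_mult: "torus_bounded f \<Longrightarrow> torus_bounded g \<Longrightarrow> torus_bounded (\<lambda>z. f z * g z)"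
  unfolding torus_bounded_def
proof safe
  fix C D assume "\<forall>z\<in>unimodular. norm (f z) \<le> C" "\<forall>z\<in>unimodular. norm (g z) \<le> D"
  then have "norm (f z * g z) \<le> \<bar>C\<bar> * \<bar>D\<bar>" if "z \<in> unimodular" for z
    unfolding norm_mult using that by (intro mult_mono) (auto intro: order_trans[OF _ abs_ge_self])
  then show "\<exists>C. \<forall>z\<in>unimodular. norm (f z * g z) \<le> C" by blast
qed

lemma torus_bounded_add: "torus_bounded f \<Longrightarrow> torus_bounded g \<Longrightarrow> torus_bounded (\<lambda>z. f z + g z)"
  unfolding torus_bounded_def by (meson add_mono norm_triangle_le)

lemma torus_bounded_prod:
  assumes "\<And>i. i \<in> A \<Longrightarrow> torus_bounded (f i)" shows "torus_bounded (\<lambda>z. \<Prod>i\<in>A. f i z)"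
  using assms by (induction A rule: infinite_finite_induct) (auto intro: torus_bounded_const torus_bounded_mult)

lemma torus_bounded_sum:
  assumes "\<And>i. i \<in> A \<Longrightarrow> torus_bounded (f i)" shows "torus_bounded (\<lambda>z. \<Sum>i\<in>A. f i z)"
  using assms by (induction A rule: infinite_finite_induct) (auto intro: torus_bounded_const torus_bounded_add)

lemma torus_bounded_comp:
  fixes \<phi> :: "complex \<Rightarrow> complex"
  assumes "continuous_on (sphere 0 1) \<phi>" "\<And>z. z \<in> unimodular \<Longrightarrow> norm (m z) = 1"
  shows "torus_bounded (\<lambda>z. \<phi> (m z))"
proof -
  have "bounded (\<phi> ` sphere 0 1)"
    by (intro compact_imp_bounded compact_continuous_image assms) auto
  then obtain C where "\<And>u. u \<in> sphere 0 1 \<Longrightarrow> norm (\<phi> u) \<le> C" unfolding bounded_iff by blast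
  then show ?thesis unfolding torus_bounded_def using assms(2) by (intro exI[of _ C]) auto
qed

lemma torus_bounded_cong:
  "torus_bounded f \<Longrightarrow> (\<And>z. z \<in> unimodular \<Longrightarrow> f z = g z) \<Longrightarrow> torus_bounded g"
  unfolding torus_bounded_def by auto

section \<open>The weight function\<close>

definition weight1 :: "complex \<Rightarrow> complex \<Rightarrow> (nat \<Rightarrow> complex) \<Rightarrow> complex \<Rightarrow> complex" where
  "weight1 p q b y = (\<Prod>m=1..6. egamma (b m * y) p q * egamma (b m / y) p q) /
     (egamma (y\<^sup>2) p q * egamma (1 / y\<^sup>2) p q)"

text \<open>
  In the denominator the factors are grouped into reciprocal pairs, the form in which the
  reflection formula applies.
\<close>

definition weight2 :: "complex \<Rightarrow> complex \<Rightarrow> complex \<Rightarrow> complex \<Rightarrow> complex \<Rightarrow> complex" where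
  "weight2 p q t u w =
     (egamma (t * (u * w)) p q * egamma (t * (u / w)) p q * egamma (t * (w / u)) p q * egamma (t * (1 / (u * w))) p q) /
     ((egamma (u * w) p q * egamma (1 / (u * w)) p q) * (egamma (w / u) p q * egamma (1 / (w / u)) p q))"

lemma Psi_eq_weights:
  "Psi n p q t a z = (\<Prod>i=1..n. weight1 p q a (z i)) * (\<Prod>k=1..n. \<Prod>j=1..<k. weight2 p q t (z j) (z k))"
proof -
  have two: "(\<Prod>s\<in>{1, - 1 :: int}. f s) = f 1 * f (- 1)" for f :: "int \<Rightarrow> complex" by simp
  show ?thesis
    unfolding Psi_def two weight1_def weight2_def
    by (intro arg_cong2[where f = "(*)"] prod.cong refl)
       (simp_all add: power_int_minus divide_inverse mult_ac)
qed

lemma weight1_inverse: "weight1 p q b (1 / y) = weight1 p q b y"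
  unfolding weight1_def by (simp add: power_divide mult.commute)

lemma weight2_swap: "weight2 p q t u w = weight2 p q t w u"
  unfolding weight2_def by (simp add: mult_ac)

lemma weight2_inverse: "weight2 p q t (1 / u) w = weight2 p q t u w"
  unfolding weight2_def by (simp add: mult_ac)

lemma prod_pairs_isolate:
  fixes g :: "nat \<Rightarrow> nat \<Rightarrow> 'a::comm_monoid_mult"
  assumes sym: "\<And>j k. g j k = g k j" and l: "l \<in> {1..n}"
  shows "(\<Prod>k=1..n. \<Prod>j=1..<k. g j k) =
    (\<Prod>j\<in>{1..n} - {l}. g l j) * (\<Prod>k\<in>{1..n} - {l}. \<Prod>j\<in>{1..<k} - {l}. g j k)"
proof -
  have row: "(\<Prod>j=1..<k. g j k) = (if l < k then g l k else 1) * (\<Prod>j\<in>{1..<k} - {l}. g j k)" for k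
  proof (cases "l < k")
    case True
    then have "l \<in> {1..<k}" using l by auto
    then show ?thesis using prod.remove[of "{1..<k}" l "\<lambda>j. g j k"] True by simp
  qed (auto intro: prod.cong)
  have "(\<Prod>j=1..<l. g j l) = (\<Prod>j\<in>{1..n} - {l}. if j < l then g l j else 1)"
  proof -
    have "{j \<in> {1..n} - {l}. j < l} = {1..<l}" using l by auto
    then show ?thesis using sym by (simp add: prod.inter_filter[symmetric])
  qed
  moreover have "(if j < l then g l j else 1) * (if l < j then g l j else 1) = g l j" if "j \<in> {1..n} - {l}" for j
    using that by auto
  then have "(\<Prod>j\<in>{1..n} - {l}. if j < l then g l j else 1) * (\<Prod>j\<in>{1..n} - {l}. if l < j then g l j else 1) =
      (\<Prod>j\<in>{1..n} - {l}. g l j)"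
    unfolding prod.distrib[symmetric] by (intro prod.cong) auto
  moreover have "(\<Prod>k=1..n. \<Prod>j=1..<k. g j k) = (\<Prod>j=1..<l. g j l) *
      ((\<Prod>k\<in>{1..n} - {l}. if l < k then g l k else 1) * (\<Prod>k\<in>{1..n} - {l}. \<Prod>j\<in>{1..<k} - {l}. g j k))"
  proof -
    have "(\<Prod>k=1..n. \<Prod>j=1..<k. g j k) = (\<Prod>j=1..<l. g j l) * (\<Prod>k\<in>{1..n} - {l}. \<Prod>j=1..<k. g j k)"
      by (rule prod.remove[OF finite_atLeastAtMost l])
    also have "(\<Prod>k\<in>{1..n} - {l}. \<Prod>j=1..<k. g j k) =
        (\<Prod>k\<in>{1..n} - {l}. (if l < k then g l k else 1) * (\<Prod>j\<in>{1..<k} - {l}. g j k))"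
      by (rule prod.cong[OF refl row])
    finally show ?thesis by (simp only: prod.distrib)
  qed
  ultimately show ?thesis by (simp add: mult.assoc[symmetric])
qed

locale bc_integral = bc_system p t b "{1..n}" for p t b and n :: nat +
  fixes q :: complex
  assumes q: "norm q < 1" "q \<noteq> 0" and t1: "norm t < 1" and b1: "\<And>m. m \<in> {1..6} \<Longrightarrow> norm (b m) < 1"
begin

abbreviation \<Gamma> where "\<Gamma> u \<equiv> egamma u p q"

definition rest_weight :: "nat \<Rightarrow> (nat \<Rightarrow> complex) \<Rightarrow> complex" where
  "rest_weight l z = (\<Prod>i\<in>{1..n} - {l}. weight1 p q b (z i)) *
     (\<Prod>k\<in>{1..n} - {l}. \<Prod>j\<in>{1..<k} - {l}. weight2 p q t (z j) (z k))"

lemma Psi_isolate: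
  assumes l: "l \<in> {1..n}"
  shows "Psi n p q t b z = rest_weight l z *
    (weight1 p q b (z l) * (\<Prod>j\<in>{1..n} - {l}. weight2 p q t (z l) (z j)))"
  unfolding Psi_eq_weights rest_weight_def
    prod_pairs_isolate[OF weight2_swap[of p q t "z _" "z _"] l] prod.remove[OF finite_atLeastAtMost l, of "\<lambda>i. weight1 p q b (z i)"]
  by (simp only: mult_ac)

definition kernel1 :: "complex \<Rightarrow> complex" where
  "kernel1 y = (\<Prod>m=1..6. \<Gamma> (b m * y) * \<Gamma> (q * (b m / y))) * (y * theta (y\<^sup>2) q)"

definition kernel2 :: "complex \<Rightarrow> complex \<Rightarrow> complex" where
  "kernel2 w y = \<Gamma> (t * (y * w)) * \<Gamma> (t * (y / w)) * \<Gamma> (q * (t * (w / y))) * \<Gamma> (q * (t * (1 / (y * w)))) *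
        (theta (y * w) q * theta (y / w) q)"

definition kernel :: "nat set \<Rightarrow> (nat \<Rightarrow> complex) \<Rightarrow> complex \<Rightarrow> complex" where
  "kernel J z y = kernel1 y * (\<Prod>j\<in>J. kernel2 (z j) y)"

text \<open>
  The only zero on the unit circle is \<open>u = 1\<close>, for both moduli.
\<close>

lemma theta_q_zero:
  assumes "norm u = 1" "theta u p = 0" shows "theta u q = 0" "theta (1 / u) q = 0"
proof -
  have u0: "u \<noteq> 0" using assms by auto
  obtain k :: int where k: "u = p powi k" using theta_eq_0_iff[OF p u0] assms by auto
  have "norm p powr k = 1" using assms k p by (simp add: norm_power_int powr_real_of_int')
  then have "k = 0" using p powr_inj[of "norm p" k 0] by auto
  then have "u = 1" using k by simp
  then show "theta u q = 0" "theta (1 / u) q = 0" using theta_at_1 q by auto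
qed

lemma mult_exchange: "(A * B) * (C * D) = (A * C) * (B * (D :: complex))"
  by (simp only: mult_ac)

lemma weight1_times_coeff:
  assumes y: "norm y = 1"
  shows "weight1 p q b y * coeff (1 / y) = kernel1 y"
proof -
  have y0: "y \<noteq> 0" using y by auto
  have u: "norm (y\<^sup>2) = 1" using y by (simp add: norm_power)
  have "weight1 p q b y = (\<Prod>m=1..6. \<Gamma> (b m * y) * \<Gamma> (b m / y)) * (1 / (\<Gamma> (y\<^sup>2) * \<Gamma> (1 / y\<^sup>2)))"
    by (simp add: weight1_def)
  also have "1 / (\<Gamma> (y\<^sup>2) * \<Gamma> (1 / y\<^sup>2)) = theta (1 / y\<^sup>2) p * theta (y\<^sup>2) q"
    by (rule inverse_egamma_reflection[OF p q u])
  finally have w: "weight1 p q b y = (\<Prod>m=1..6. \<Gamma> (b m * y) * \<Gamma> (b m / y)) * (theta (1 / y\<^sup>2) p * theta (y\<^sup>2) q)" .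
  have c: "coeff (1 / y) = (\<Prod>m=1..6. \<theta> (b m / y)) * (y / \<theta> (1 / y\<^sup>2))"
    by (simp add: coeff_def power_divide)
  have "(\<Prod>m=1..6. \<Gamma> (b m * y) * \<Gamma> (b m / y)) * (\<Prod>m=1..6. \<theta> (b m / y)) =
      (\<Prod>m=1..6. \<Gamma> (b m * y) * \<Gamma> (q * (b m / y)))"
    unfolding prod.distrib[symmetric]
  proof (rule prod.cong[OF refl])
    fix m :: nat assume "m \<in> {1..6}"
    then have "b m / y \<noteq> 0" "norm (b m / y) < 1" using b b1 y y0 by (auto simp: norm_divide)
    then show "\<Gamma> (b m * y) * \<Gamma> (b m / y) * \<theta> (b m / y) = \<Gamma> (b m * y) * \<Gamma> (q * (b m / y))"
      using egamma_times_q[OF p q, of "b m / y"] by simp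
  qed
  moreover have "(theta (1 / y\<^sup>2) p * theta (y\<^sup>2) q) * (y / \<theta> (1 / y\<^sup>2)) = y * theta (y\<^sup>2) q"
    using theta_q_zero[of "1 / y\<^sup>2"] u by (cases "\<theta> (1 / y\<^sup>2) = 0") (auto simp: norm_divide)
  ultimately show ?thesis
    unfolding w c kernel1_def by (subst mult_exchange) (simp only:)
qed

lemma weight2_times_ratio:
  assumes y: "norm y = 1" and w: "norm w = 1"
  shows "weight2 p q t y w * (v (t * (1 / y)) w / v (1 / y) w) = kernel2 w y"
proof -
  have y0: "y \<noteq> 0" "w \<noteq> 0" using y w by auto
  have n1: "norm (y * w) = 1" and n2: "norm (w / y) = 1" using y w by (simp_all add: norm_mult norm_divide)
  define A where "A = \<Gamma> (t * (y * w)) * \<Gamma> (t * (y / w))"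
  have "weight2 p q t y w = A * \<Gamma> (t * (w / y)) * \<Gamma> (t * (1 / (y * w))) *
      ((1 / (\<Gamma> (y * w) * \<Gamma> (1 / (y * w)))) * (1 / (\<Gamma> (w / y) * \<Gamma> (1 / (w / y)))))"
    by (simp add: weight2_def A_def)
  also have "1 / (\<Gamma> (y * w) * \<Gamma> (1 / (y * w))) = \<theta> (1 / (y * w)) * theta (y * w) q"
    by (rule inverse_egamma_reflection[OF p q n1])
  also have "1 / (\<Gamma> (w / y) * \<Gamma> (1 / (w / y))) = 1 / (\<Gamma> (y / w) * \<Gamma> (1 / (y / w)))"
    by (simp add: mult.commute)
  also have "\<dots> = \<theta> (1 / (y / w)) * theta (y / w) q"
    by (rule inverse_egamma_reflection[OF p q]) (use y w in \<open>simp add: norm_divide\<close>)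
  finally have W: "weight2 p q t y w = A * \<Gamma> (t * (w / y)) * \<Gamma> (t * (1 / (y * w))) *
      ((\<theta> (1 / (y * w)) * theta (y * w) q) * (\<theta> (w / y) * theta (y / w) q))" by simp
  have v: "v (t * (1 / y)) w = \<theta> (t * (w / y)) * \<theta> (t * (1 / (y * w)))" "v (1 / y) w = \<theta> (w / y) * \<theta> (1 / (y * w))"
    by (simp_all add: theta_pair_def mult_ac)
  have G: "\<Gamma> (t * u) * \<theta> (t * u) = \<Gamma> (q * (t * u))" if "norm u = 1" for u
  proof -
    have "u \<noteq> 0" using that by auto
    then show ?thesis
      using egamma_times_q[OF p q, of "t * u"] t t1 that by (simp add: norm_mult mult.commute)
  qed
  have c1: "\<theta> (1 / (y * w)) * theta (y * w) q / \<theta> (1 / (y * w)) = theta (y * w) q"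
    using theta_q_zero[of "1 / (y * w)"] n1 by (cases "\<theta> (1 / (y * w)) = 0") (auto simp: norm_divide)
  have c2: "\<theta> (w / y) * theta (y / w) q / \<theta> (w / y) = theta (y / w) q"
    using theta_q_zero[of "w / y"] n2 by (cases "\<theta> (w / y) = 0") auto
  have "weight2 p q t y w * (v (t * (1 / y)) w / v (1 / y) w) =
      A * (\<Gamma> (t * (w / y)) * \<theta> (t * (w / y))) * (\<Gamma> (t * (1 / (y * w))) * \<theta> (t * (1 / (y * w)))) *
      ((\<theta> (1 / (y * w)) * theta (y * w) q / \<theta> (1 / (y * w))) * (\<theta> (w / y) * theta (y / w) q / \<theta> (w / y)))"
    unfolding W v by (simp add: mult_ac)
  also have "\<Gamma> (t * (w / y)) * \<theta> (t * (w / y)) = \<Gamma> (q * (t * (w / y)))" by (rule G[OF n2])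
  also have "\<Gamma> (t * (1 / (y * w))) * \<theta> (t * (1 / (y * w))) = \<Gamma> (q * (t * (1 / (y * w))))"
    by (rule G) (use n1 in \<open>simp add: norm_divide\<close>)
  finally show ?thesis unfolding c1 c2 A_def kernel2_def by (simp only: mult_ac)
qed

text \<open>
  The reflection formula supplies the theta functions that cancel the denominators of the shift
  coefficient, and the numerators are absorbed by \<open>\<theta>(u) \<Gamma>(u) = \<Gamma>(qu)\<close>. What is left has no poles in the
  annulus \<open>|q| \<le> |y| \<le> 1\<close>. Where a denominator vanishes, both sides are \<open>0\<close>.
\<close>

lemma weights_times_shift_coeff:
  assumes y: "norm y = 1" and z: "\<And>j. j \<in> J \<Longrightarrow> norm (z j) = 1"
  shows "(weight1 p q b y * (\<Prod>j\<in>J. weight2 p q t y (z j))) * shift_coeff J (1 / y) z = kernel J z y"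
proof -
  have "(\<Prod>j\<in>J. weight2 p q t y (z j)) * (\<Prod>j\<in>J. v (t * (1 / y)) (z j) / v (1 / y) (z j)) = (\<Prod>j\<in>J. kernel2 (z j) y)"
    unfolding prod.distrib[symmetric] by (intro prod.cong refl weight2_times_ratio y z)
  then show ?thesis
    unfolding shift_coeff_def kernel_def weight1_times_coeff[OF y, symmetric]
    by (subst mult_exchange) (simp only:)
qed

text \<open>
  The reflection formula supplies the theta functions that cancel the denominators of the shift
  coefficient, and the numerators are absorbed by \<open>\<theta>(u) \<Gamma>(u) = \<Gamma>(qu)\<close>. What is left has no poles in the
  annulus \<open>|q| \<le> |y| \<le> 1\<close>. Where a denominator vanishes, both sides are \<open>0\<close>.
\<close>

lemma weights_times_shift_coeff':
  assumes y: "norm y = 1" and z: "\<And>j. j \<in> J \<Longrightarrow> norm (z j) = 1"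
  shows "(weight1 p q b y * (\<Prod>j\<in>J. weight2 p q t y (z j))) * shift_coeff J y z = kernel J z (1 / y)"
  using weights_times_shift_coeff[of "1 / y" J z] y z
  by (simp add: norm_divide weight1_inverse weight2_inverse)

text \<open>
  The gamma functions on both sides agree up to their order; the sign and the powers of \<open>y\<close> come
  from the theta functions with modulus \<open>q\<close>.
\<close>

lemma kernel_antisymmetric:
  assumes y: "y \<noteq> 0" and z: "\<And>j. j \<in> J \<Longrightarrow> z j \<noteq> 0"
  shows "kernel J z (q * y) = - kernel J z (1 / y)"
proof -
  have 1: "(\<Prod>m=1..6. \<Gamma> (b m * (q * y)) * \<Gamma> (q * (b m / (q * y)))) =
      (\<Prod>m=1..6. \<Gamma> (b m * (1 / y)) * \<Gamma> (q * (b m / (1 / y))))"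
    by (rule prod.cong) (use q in \<open>simp_all add: mult_ac\<close>)
  have 2: "q * y * theta ((q * y)\<^sup>2) q = - (1 / y * theta ((1 / y)\<^sup>2) q)"
  proof -
    have "theta ((q * y)\<^sup>2) q = theta (y\<^sup>2) q / (q * (y\<^sup>2)\<^sup>2)"
      using theta_p_square_times[OF q, of "y\<^sup>2"] y by (simp add: power_mult_distrib)
    moreover have "theta ((1 / y)\<^sup>2) q = - theta (y\<^sup>2) q / y\<^sup>2"
      using theta_inverse[OF q, of "y\<^sup>2"] y by (simp add: power_divide)
    ultimately show ?thesis using y q by (simp add: power2_eq_square)
  qed
  have 3: "kernel2 (z j) (q * y) = kernel2 (z j) (1 / y)" if "j \<in> J" for j
  proof -
    have z0: "z j \<noteq> 0" using z that .
    have "theta (q * y * z j) q = - theta (y * z j) q / (y * z j)" "theta (q * y / z j) q = - theta (y / z j) q / (y / z j)"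
      using theta_times_p[OF q, of "y * z j"] theta_times_p[OF q, of "y / z j"] y z0 by (simp_all add: mult_ac)
    moreover have "theta (1 / y * z j) q = - theta (y / z j) q / (y / z j)" "theta (1 / y / z j) q = - theta (y * z j) q / (y * z j)"
      using theta_inverse[OF q, of "y / z j"] theta_inverse[OF q, of "y * z j"] y z0 by simp_all
    moreover have "t * (q * y * z j) = q * (t * (z j / (1 / y)))" "t * (q * y / z j) = q * (t * (1 / (1 / y * z j)))"
      "q * (t * (z j / (q * y))) = t * (1 / y * z j)" "q * (t * (1 / (q * y * z j))) = t * (1 / y / z j)"
      using q by (simp_all add: mult_ac)
    ultimately show ?thesis unfolding kernel2_def by (simp only: mult_ac)
  qed
  have "(\<Prod>j\<in>J. kernel2 (z j) (q * y)) = (\<Prod>j\<in>J. kernel2 (z j) (1 / y))"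
    by (rule prod.cong[OF refl 3])
  moreover have "kernel1 (q * y) = - kernel1 (1 / y)" unfolding kernel1_def 1 2 by simp
  ultimately show ?thesis unfolding kernel_def by simp
qed

text \<open>
  By the shift of the circle the integral of \<open>G(y)\<close> is minus that of \<open>G(1/y)\<close>, and by reflection the
  two integrals are equal.
\<close>

lemma kernel_average:
  assumes z: "\<And>j. j \<in> J \<Longrightarrow> norm (z j) = 1"
  shows "(LINT y:{0..2 * pi}|lborel. kernel J z (cis y)) = 0"
    and "(LINT y:{0..2 * pi}|lborel. kernel J z (1 / cis y)) = 0"
proof -
  \<comment> \<open>All gamma functions in the kernel are holomorphic for \<open>|q| \<rho> < |y| < 1 / \<rho>\<close>.\<close>
  define \<rho> where "\<rho> = Max (insert (norm t) ((\<lambda>m. norm (b m)) ` {1..6}))"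
  have \<rho>t: "norm t \<le> \<rho>" and \<rho>b: "\<And>m. m \<in> {1..6} \<Longrightarrow> norm (b m) \<le> \<rho>"
    unfolding \<rho>_def by (intro Max_ge; auto)+
  have "\<rho> \<in> insert (norm t) ((\<lambda>m. norm (b m)) ` {1..6})"
    unfolding \<rho>_def by (rule Max_in) auto
  then have \<rho>1: "\<rho> < 1" using t1 b1 by auto
  have \<rho>0: "\<rho> > 0" using \<rho>t t by (metis norm_le_zero_iff not_le order_trans)
  define S where "S = {y :: complex. norm q * \<rho> < norm y \<and> norm y < 1 / \<rho>}"
  have "open S" unfolding S_def by (intro open_Collect_conj open_Collect_less continuous_intros)
  have S0: "y \<noteq> 0" if "y \<in> S" for y using that \<rho>0 q by (auto simp: S_def mult_less_0_iff)
  have z0: "z j \<noteq> 0" if "j \<in> J" for j using z[OF that] by auto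
  have out: "norm (c * y) < 1" if "y \<in> S" "norm c \<le> \<rho>" for y c
  proof -
    have "norm (c * y) \<le> \<rho> * norm y" using that by (simp add: norm_mult mult_right_mono)
    also have "\<dots> < 1" using that(1) \<rho>0 by (simp add: S_def field_simps)
    finally show ?thesis .
  qed
  have inn: "norm (q * (c / y)) < 1" if "y \<in> S" "norm c \<le> \<rho>" for y c
  proof -
    have "norm (q * c) \<le> norm q * \<rho>" using that by (simp add: norm_mult mult_left_mono)
    also have "\<dots> < norm y" using that(1) by (simp add: S_def)
    finally show ?thesis using S0[OF that(1)] by (simp add: norm_mult norm_divide)
  qed
  have holo: "kernel J z holomorphic_on S"
    unfolding kernel_def kernel1_def kernel2_def
  proof (intro holomorphic_intros egamma_holomorphic[OF p q] theta_holomorphic[OF q])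
    fix y m assume y: "y \<in> S"
    show "norm (b m * y) < 1" "norm (q * (b m / y)) < 1" if "m \<in> {1..6}" using out inn y \<rho>b that by auto
    show "b m * y \<noteq> 0" "q * (b m / y) \<noteq> 0" if "m \<in> {1..6}" using b that S0[OF y] q by auto
  next
    fix y j assume y: "y \<in> S" and j: "j \<in> J"
    have tz: "norm (t * z j) \<le> \<rho>" "norm (t / z j) \<le> \<rho>" using z[OF j] \<rho>t by (simp_all add: norm_mult norm_divide)
    show "norm (t * (y * z j)) < 1" "norm (t * (y / z j)) < 1"
      using out[OF y tz(1)] out[OF y tz(2)] by (simp_all add: mult_ac)
    show "norm (q * (t * (z j / y))) < 1" "norm (q * (t * (1 / (y * z j)))) < 1"
      using inn[OF y tz(1)] inn[OF y tz(2)] by (simp_all add: mult_ac)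
  qed (use S0 z0 t q in auto)
  have shift: "(LINT y:{0..2 * pi}|lborel. kernel J z (q * cis y)) = (LINT y:{0..2 * pi}|lborel. kernel J z (cis y))"
  proof (rule circle_integral_shift[OF \<open>open S\<close> holo q(2,1)])
    fix y :: complex assume "norm q \<le> norm y" "norm y \<le> 1"
    moreover have "norm q * \<rho> < norm q * 1" using q \<rho>1 by (intro mult_strict_left_mono) auto
    moreover have "1 < 1 / \<rho>" using \<rho>0 \<rho>1 by simp
    ultimately show "y \<in> S" by (simp add: S_def)
  qed (use S0 in auto)
  have "(LINT y:{0..2 * pi}|lborel. kernel J z (q * cis y)) = - (LINT y:{0..2 * pi}|lborel. kernel J z (1 / cis y))"
    using kernel_antisymmetric[of "cis _" J z] z0 by (simp add: set_lebesgue_integral_def)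
  then have "(LINT y:{0..2 * pi}|lborel. kernel J z (cis y)) = - (LINT y:{0..2 * pi}|lborel. kernel J z (cis y))"
    using shift circle_integral_reflect[of "kernel J z"] by simp
  then show "(LINT y:{0..2 * pi}|lborel. kernel J z (cis y)) = 0" by simp
  then show "(LINT y:{0..2 * pi}|lborel. kernel J z (1 / cis y)) = 0"
    using circle_integral_reflect[of "kernel J z"] by simp
qed

end

lemma borel_measurable_egamma:
  assumes "norm p < 1" "norm q < 1" "g \<in> borel_measurable M"
  shows "(\<lambda>x. egamma (g x) p q) \<in> borel_measurable M"
proof -
  have "continuous_on UNIV (\<lambda>u. qpoch2 u p q)"
    by (rule holomorphic_on_imp_continuous_on[OF qpoch2_holomorphic_UNIV[OF assms(1,2)]])
  then have 1: "(\<lambda>u. qpoch2 u p q) \<in> borel_measurable borel"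
    by (rule borel_measurable_continuous_onI)
  have 2: "(\<lambda>x. p * q / g x) \<in> borel_measurable M" using assms(3) by measurable
  show ?thesis
    unfolding egamma_def
    by (intro borel_measurable_divide measurable_compose[OF 2 1] measurable_compose[OF assms(3) 1])
qed

lemma borel_measurable_theta:
  assumes "norm p < 1" "g \<in> borel_measurable M"
  shows "(\<lambda>x. theta (g x) p) \<in> borel_measurable M"
proof -
  have "continuous_on UNIV (\<lambda>u. qpoch u p)"
    by (rule holomorphic_on_imp_continuous_on[OF qpoch_holomorphic_UNIV[OF assms(1)]])
  then have 1: "(\<lambda>u. qpoch u p) \<in> borel_measurable borel"
    by (rule borel_measurable_continuous_onI)
  have 2: "(\<lambda>x. p / g x) \<in> borel_measurable M" using assms(2) by measurable
  show ?thesis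
    unfolding theta_def
    by (intro borel_measurable_times measurable_compose[OF 2 1] measurable_compose[OF assms(2) 1])
qed

lemma torus_coordinate_measurable:
  "i \<in> K \<Longrightarrow> (\<lambda>x. cis (x i)) \<in> borel_measurable (torus_measure K)"
proof -
  assume i: "i \<in> K"
  have "continuous_on UNIV cis" by (intro continuous_intros)
  then have 1: "cis \<in> borel_measurable borel" by (rule borel_measurable_continuous_onI)
  have "(\<lambda>x. x i) \<in> measurable (torus_measure K) (lborel :: real measure)"
    by (rule measurable_component_singleton[OF i])
  then have "(\<lambda>x. x i) \<in> borel_measurable (torus_measure K)" by simp
  then show ?thesis by (rule measurable_compose[OF _ 1])
qed

lemma Psi_torus_measurable:
  assumes p: "norm p < 1" and q: "norm q < 1"
  shows "torus_measurable {1..n} (Psi n p q t a)"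
  unfolding torus_measurable_def Psi_eq_weights weight1_def weight2_def
  by (intro borel_measurable_times borel_measurable_prod borel_measurable_divide borel_measurable_power
      borel_measurable_const borel_measurable_egamma[OF p q] torus_coordinate_measurable) auto

context bc_integral
begin

lemma shift_coeff_torus_measurable:
  assumes "i \<in> {1..n}" "J \<subseteq> {1..n}"
  shows "torus_measurable {1..n} (\<lambda>z. shift_coeff J (z i) z)" "torus_measurable {1..n} (\<lambda>z. shift_coeff J (1 / z i) z)"
  unfolding torus_measurable_def shift_coeff_def coeff_def theta_pair_def
  by (intro borel_measurable_times borel_measurable_prod borel_measurable_divide borel_measurable_power
      borel_measurable_const borel_measurable_theta[OF p(1)] torus_coordinate_measurable; use assms in auto)+

lemma test_fun_torus_measurable:
  assumes "J \<subseteq> {1..n}"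
  shows "torus_measurable {1..n} (test_fun \<gamma> x N J)"
  unfolding torus_measurable_def test_fun_def theta_pair_def
  by (intro borel_measurable_times borel_measurable_sum borel_measurable_prod borel_measurable_divide
      borel_measurable_const borel_measurable_theta[OF p(1)] torus_coordinate_measurable; use assms in auto)

lemma pair_prod_torus_measurable:
  "torus_measurable {1..n} (\<lambda>z. \<Prod>i=1..n. v x (z i))"
  unfolding torus_measurable_def theta_pair_def
  by (intro borel_measurable_times borel_measurable_prod borel_measurable_divide
      borel_measurable_const borel_measurable_theta[OF p(1)] torus_coordinate_measurable; simp)

lemma torus_measurable_mult:
  "torus_measurable K f \<Longrightarrow> torus_measurable K g \<Longrightarrow> torus_measurable K (\<lambda>z. f z * g z)"
  unfolding torus_measurable_def by (rule borel_measurable_times)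

lemma egamma_torus_bounded:
  assumes "c \<noteq> 0" "norm c < 1" "\<And>z. z \<in> unimodular \<Longrightarrow> norm (m z) = 1"
  shows "torus_bounded (\<lambda>z. \<Gamma> (c * m z))"
proof (rule torus_bounded_comp[of "\<lambda>u. \<Gamma> (c * u)" m])
  show "continuous_on (sphere 0 1) (\<lambda>u. \<Gamma> (c * u))"
    by (intro holomorphic_on_imp_continuous_on egamma_holomorphic p q holomorphic_intros)
       (use assms in \<open>auto simp: norm_mult\<close>)
qed (use assms in auto)

lemma theta_torus_bounded:
  assumes "norm r < 1" "r \<noteq> 0" "c \<noteq> 0" "\<And>z. z \<in> unimodular \<Longrightarrow> norm (m z) = 1"
  shows "torus_bounded (\<lambda>z. theta (c * m z) r)"
proof (rule torus_bounded_comp[of "\<lambda>u. theta (c * u) r" m])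
  show "continuous_on (sphere 0 1) (\<lambda>u. theta (c * u) r)"
    by (intro holomorphic_on_imp_continuous_on theta_holomorphic assms holomorphic_intros)
       (use assms in auto)
qed (use assms in auto)

lemma weight1_torus_bounded: "torus_bounded (\<lambda>z. weight1 p q b (z i))"
proof (rule torus_bounded_cong)
  show "torus_bounded (\<lambda>z. (\<Prod>m=1..6. \<Gamma> (b m * z i) * \<Gamma> (b m * (1 / z i))) * (theta (1 * (1 / (z i)\<^sup>2)) p * theta (1 * (z i)\<^sup>2) q))"
    by (intro torus_bounded_mult torus_bounded_prod egamma_torus_bounded theta_torus_bounded)
       (use b b1 p q in \<open>auto simp: unimodular_def norm_divide norm_power\<close>)
  fix z :: "nat \<Rightarrow> complex" assume "z \<in> unimodular"
  then have "norm ((z i)\<^sup>2) = 1" by (simp add: unimodular_def norm_power)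
  from inverse_egamma_reflection[OF p q this]
  show "(\<Prod>m=1..6. \<Gamma> (b m * z i) * \<Gamma> (b m * (1 / z i))) * (theta (1 * (1 / (z i)\<^sup>2)) p * theta (1 * (z i)\<^sup>2) q) = weight1 p q b (z i)"
    by (simp add: weight1_def divide_inverse)
qed

lemma weight2_torus_bounded: "torus_bounded (\<lambda>z. weight2 p q t (z j) (z k))"
proof (rule torus_bounded_cong)
  show "torus_bounded (\<lambda>z. (\<Gamma> (t * (z j * z k)) * \<Gamma> (t * (z j / z k)) * \<Gamma> (t * (z k / z j)) * \<Gamma> (t * (1 / (z j * z k)))) *
     ((theta (1 * (1 / (z j * z k))) p * theta (1 * (z j * z k)) q) *
      (theta (1 * (1 / (z k / z j))) p * theta (1 * (z k / z j)) q)))"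
    by (intro torus_bounded_mult egamma_torus_bounded theta_torus_bounded)
       (use t t1 p q in \<open>auto simp: unimodular_def norm_divide norm_mult\<close>)
  fix z :: "nat \<Rightarrow> complex" assume "z \<in> unimodular"
  then have n: "norm (z j * z k) = 1" "norm (z k / z j) = 1" by (auto simp: unimodular_def norm_mult norm_divide)
  show "(\<Gamma> (t * (z j * z k)) * \<Gamma> (t * (z j / z k)) * \<Gamma> (t * (z k / z j)) * \<Gamma> (t * (1 / (z j * z k)))) *
     ((theta (1 * (1 / (z j * z k))) p * theta (1 * (z j * z k)) q) *
      (theta (1 * (1 / (z k / z j))) p * theta (1 * (z k / z j)) q)) = weight2 p q t (z j) (z k)"
    unfolding mult_1 inverse_egamma_reflection[OF p q n(1), symmetric] inverse_egamma_reflection[OF p q n(2), symmetric]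
      weight2_def by simp
qed

lemma Psi_torus_bounded: "torus_bounded (Psi n p q t b)"
  unfolding Psi_eq_weights[abs_def]
  by (intro torus_bounded_mult torus_bounded_prod weight1_torus_bounded weight2_torus_bounded)

lemma rest_weight_torus_bounded: "torus_bounded (rest_weight l)"
  unfolding rest_weight_def[abs_def]
  by (intro torus_bounded_mult torus_bounded_prod weight1_torus_bounded weight2_torus_bounded)

lemma kernel_torus_bounded:
  "torus_bounded (\<lambda>z. kernel J z (z l))" "torus_bounded (\<lambda>z. kernel J z (1 / z l))"
proof -
  have *: "torus_bounded (\<lambda>z. kernel J z (m z))" if m: "\<And>z. z \<in> unimodular \<Longrightarrow> norm (m z) = 1" for m
  proof (rule torus_bounded_cong)
    show "torus_bounded (\<lambda>z. (\<Prod>i=1..6. \<Gamma> (b i * m z) * \<Gamma> ((q * b i) * (1 / m z))) * ((\<lambda>u. u) (m z) * theta (1 * (m z)\<^sup>2) q) *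
     (\<Prod>j\<in>J. \<Gamma> (t * (m z * z j)) * \<Gamma> (t * (m z / z j)) * \<Gamma> ((q * t) * (z j / m z)) * \<Gamma> ((q * t) * (1 / (m z * z j))) *
        (theta (1 * (m z * z j)) q * theta (1 * (m z / z j)) q)))"
      by (intro torus_bounded_mult torus_bounded_prod egamma_torus_bounded theta_torus_bounded torus_bounded_comp continuous_intros)
         (use b b1 t t1 p q m mult_strict_mono[of "norm q" 1 _ 1] in \<open>auto simp: unimodular_def norm_divide norm_mult norm_power\<close>)
  qed (simp add: kernel_def kernel1_def kernel2_def mult.assoc)
  show "torus_bounded (\<lambda>z. kernel J z (z l))" "torus_bounded (\<lambda>z. kernel J z (1 / z l))"
    by (rule *; simp add: unimodular_def norm_divide)+
qed

lemma pair_prod_torus_bounded: "x \<noteq> 0 \<Longrightarrow> torus_bounded (\<lambda>z. \<Prod>i\<in>A. v x (z i))"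
proof -
  assume x: "x \<noteq> 0"
  have "torus_bounded (\<lambda>z. \<Prod>i\<in>A. \<theta> (x * z i) * \<theta> (x * (1 / z i)))"
    by (intro torus_bounded_prod torus_bounded_mult theta_torus_bounded p x)
       (auto simp: unimodular_def norm_divide)
  then show ?thesis by (simp add: theta_pair_def)
qed

lemma test_fun_torus_bounded:
  "(\<And>l. l < N \<Longrightarrow> x l \<noteq> 0) \<Longrightarrow> torus_bounded (test_fun \<gamma> x N J)"
  unfolding test_fun_def[abs_def]
  by (intro torus_bounded_sum torus_bounded_mult torus_bounded_const pair_prod_torus_bounded) auto

text \<open>
  On the torus the summand is the product of a function independent of \<open>z\<^sub>l\<close> and the kernel at
  \<open>z\<^sub>l\<^sup>\<plusminus>\<^sup>1\<close>, so integrating over \<open>z\<^sub>l\<close> first gives \<open>0\<close>.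
\<close>

lemma coboundary_term_average:
  fixes \<gamma> x :: "nat \<Rightarrow> complex" and N :: nat and w :: "(nat \<Rightarrow> complex) \<Rightarrow> complex" and f
  assumes l: "l \<in> {1..n}" and x: "\<And>i. i < N \<Longrightarrow> x i \<noteq> 0"
    and w: "w = (\<lambda>z. z l) \<or> w = (\<lambda>z. 1 / z l)"
  defines "J \<equiv> {1..n} - {l}"
  defines "f \<equiv> \<lambda>z. Psi n p q t b z * (shift_coeff J (w z) z * test_fun \<gamma> x N J z)"
  shows "torus_measurable {1..n} f" "torus_bounded f" "torus_average {1..n} f = 0"
proof -
  have J: "J \<subseteq> {1..n}" "l \<notin> J" by (auto simp: J_def)
  have "torus_measurable {1..n} (\<lambda>z. shift_coeff J (w z) z)"
    using w shift_coeff_torus_measurable[OF l J(1)] by auto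
  then show m: "torus_measurable {1..n} f"
    unfolding f_def by (intro torus_measurable_mult Psi_torus_measurable test_fun_torus_measurable p q J)
  have eq: "f z = rest_weight l z * test_fun \<gamma> x N J z * kernel J z (1 / w z)" if z: "z \<in> unimodular" for z
  proof -
    have n: "norm (z l) = 1" "\<And>j. j \<in> J \<Longrightarrow> norm (z j) = 1" using z by (auto simp: unimodular_def)
    define W where "W = weight1 p q b (z l) * (\<Prod>j\<in>J. weight2 p q t (z l) (z j))"
    have "W * shift_coeff J (1 / z l) z = kernel J z (z l)" "W * shift_coeff J (z l) z = kernel J z (1 / z l)"
      unfolding W_def using n by (auto intro!: weights_times_shift_coeff weights_times_shift_coeff')
    then have "W * shift_coeff J (w z) z = kernel J z (1 / w z)" using w by auto
    moreover have "Psi n p q t b z = rest_weight l z * W" unfolding Psi_isolate[OF l] J_def W_def ..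
    moreover have "R * W * (C * T) = R * T * (W * C)" for R C T :: complex by (simp only: mult_ac)
    ultimately show ?thesis unfolding f_def by (simp only:)
  qed
  have "torus_bounded (\<lambda>z. kernel J z (1 / w z))" using w kernel_torus_bounded[of J l] by auto
  then have "torus_bounded (\<lambda>z. rest_weight l z * test_fun \<gamma> x N J z * kernel J z (1 / w z))"
    by (intro torus_bounded_mult rest_weight_torus_bounded test_fun_torus_bounded x)
  then show bd: "torus_bounded f" by (rule torus_bounded_cong) (simp add: eq)
  show "torus_average {1..n} f = 0"
  proof (rule torus_average_eq_0[OF finite_atLeastAtMost l m bd])
    fix z :: "nat \<Rightarrow> complex" assume z: "z \<in> unimodular"
    have "z(l := cis y) \<in> unimodular" for y using z by (auto simp: unimodular_def)
    moreover have "rest_weight l (z(l := y)) = rest_weight l z" for y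
      unfolding rest_weight_def by (intro arg_cong2[where f = "(*)"] prod.cong refl) auto
    moreover have "test_fun \<gamma> x N J (z(l := y)) = test_fun \<gamma> x N J z" for y
      by (rule test_fun_cong) (use J in auto)
    moreover have "kernel J (z(l := y)) u = kernel J z u" for y u
      unfolding kernel_def by (intro arg_cong2[where f = "(*)"] prod.cong refl) (use J in auto)
    ultimately have "f (z(l := cis y)) = rest_weight l z * test_fun \<gamma> x N J z * kernel J z (1 / w (z(l := cis y)))" for y
      using eq by simp
    moreover have "(LINT y:{0..2 * pi}|lborel. kernel J z (1 / w (z(l := cis y)))) = 0"
      using w kernel_average[of J z] z by (auto simp: unimodular_def)
    ultimately show "(LINT y:{0..2 * pi}|lborel. f (z(l := cis y))) = 0" by simp
  qed
qed

end

section \<open>Averages of coboundaries\<close>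

lemma unimodularD: assumes "z \<in> unimodular" shows "norm (z i) = 1" "z i \<noteq> 0"
proof -
  show "norm (z i) = 1" using assms by (simp add: unimodular_def)
  then show "z i \<noteq> 0" by auto
qed

lemma torus_average_sum_eq_0:
  assumes "finite K" "finite A"
    and "\<And>i. i \<in> A \<Longrightarrow> torus_measurable K (f i)" "\<And>i. i \<in> A \<Longrightarrow> torus_bounded (f i)"
    and "\<And>i. i \<in> A \<Longrightarrow> torus_average K (f i) = 0"
  shows "torus_average K (\<lambda>z. \<Sum>i\<in>A. f i z) = 0"
  using assms(2-)
proof (induction A rule: finite_induct)
  case empty
  then show ?case by (simp add: torus_average_def set_lebesgue_integral_def)
next
  case (insert i A)
  have "torus_average K (\<lambda>z. f i z + (\<Sum>i\<in>A. f i z)) =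
      torus_average K (f i) + torus_average K (\<lambda>z. \<Sum>i\<in>A. f i z)"
  proof (rule torus_average_add[OF assms(1)])
    show "torus_measurable K (\<lambda>z. \<Sum>i\<in>A. f i z)"
      using insert.prems(1) unfolding torus_measurable_def by (intro borel_measurable_sum) auto
    show "torus_bounded (\<lambda>z. \<Sum>i\<in>A. f i z)" using insert.prems(2) by (intro torus_bounded_sum) auto
  qed (use insert.prems in auto)
  then show ?case using insert by simp
qed

context bc_integral
begin

lemma coboundary_average:
  assumes x: "\<And>i. i < N \<Longrightarrow> x i \<noteq> 0"
  shows "torus_average {1..n} (\<lambda>z. Psi n p q t b z * coboundary (test_fun \<gamma> x N) z) = 0"
proof -
  define f where "f i z = Psi n p q t b z * (shift_coeff ({1..n} - {i}) (z i) z * test_fun \<gamma> x N ({1..n} - {i}) z)" for i z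
  define h where "h i z = Psi n p q t b z * (shift_coeff ({1..n} - {i}) (1 / z i) z * test_fun \<gamma> x N ({1..n} - {i}) z)" for i z
  have fh: "torus_measurable {1..n} (f i)" "torus_bounded (f i)" "torus_average {1..n} (f i) = 0"
    "torus_measurable {1..n} (h i)" "torus_bounded (h i)" "torus_average {1..n} (h i) = 0" if i: "i \<in> {1..n}" for i
    using coboundary_term_average[where w = "\<lambda>z. z i" and \<gamma> = \<gamma>, OF i x]
      coboundary_term_average[where w = "\<lambda>z. 1 / z i" and \<gamma> = \<gamma>, OF i x]
    unfolding f_def[abs_def] h_def[abs_def] by auto
  have "Psi n p q t b z * coboundary (test_fun \<gamma> x N) z = (\<Sum>i=1..n. f i z + h i z)" for z
    unfolding coboundary_def f_def h_def by (simp add: sum_distrib_left distrib_left distrib_right)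
  moreover have "torus_average {1..n} (\<lambda>z. \<Sum>i=1..n. f i z + h i z) = 0"
  proof (rule torus_average_sum_eq_0)
    fix i assume i: "i \<in> {1..n}"
    show "torus_measurable {1..n} (\<lambda>z. f i z + h i z)"
      using fh(1,4)[OF i] unfolding torus_measurable_def by (rule borel_measurable_add)
    show "torus_bounded (\<lambda>z. f i z + h i z)" by (rule torus_bounded_add[OF fh(2,5)[OF i]])
    show "torus_average {1..n} (\<lambda>z. f i z + h i z) = 0"
      using torus_average_add[OF finite_atLeastAtMost fh(1)[OF i] fh(2)[OF i] fh(4)[OF i] fh(5)[OF i]] fh(3,6)[OF i] by simp
  qed auto
  ultimately show ?thesis by simp
qed

lemma weight1_eq_0:
  assumes y: "norm y = 1" "\<theta> (y\<^sup>2) = 0" shows "weight1 p q b y = 0"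
proof -
  have n: "norm (y\<^sup>2) = 1" using y by (simp add: norm_power)
  have "1 / (\<Gamma> (y\<^sup>2) * \<Gamma> (1 / y\<^sup>2)) = 0"
    using inverse_egamma_reflection[OF p q n] theta_q_zero[OF n y(2)] by simp
  then show ?thesis by (simp add: weight1_def)
qed

lemma weight2_eq_0:
  assumes n: "norm u = 1" "norm w = 1" and v: "v u w = 0" shows "weight2 p q t u w = 0"
proof -
  have n1: "norm (u * w) = 1" and n2: "norm (w / u) = 1" and n3: "norm (u / w) = 1"
    using n by (simp_all add: norm_mult norm_divide)
  consider "\<theta> (u * w) = 0" | "\<theta> (u / w) = 0" using v by (auto simp: theta_pair_def)
  then have "1 / (\<Gamma> (u * w) * \<Gamma> (1 / (u * w))) = 0 \<or> 1 / (\<Gamma> (w / u) * \<Gamma> (1 / (w / u))) = 0"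
  proof cases
    case 1
    then show ?thesis using inverse_egamma_reflection[OF p q n1] theta_q_zero[OF n1 1] by simp
  next
    case 2
    then have "theta (w / u) q = 0" using theta_q_zero(2)[OF n3 2] by simp
    then show ?thesis using inverse_egamma_reflection[OF p q n2] by simp
  qed
  then show ?thesis by (auto simp: weight2_def)
qed

text \<open>
  At points that are not generic the weight is zero, so that an identity between functions at
  generic points may be integrated against it over the whole torus.
\<close>

lemma Psi_eq_0:
  assumes z: "z \<in> unimodular" and ng: "\<not> generic_point p {1..n} z"
  shows "Psi n p q t b z = 0"
proof -
  have nz: "norm (z j) = 1" "z j \<noteq> 0" for j
    using unimodularD[OF z] by auto
  consider j where "j \<in> {1..n}" "\<theta> ((z j)\<^sup>2) = 0"
    | j k where "j \<in> {1..n}" "k \<in> {1..n}" "j \<noteq> k" "v (z j) (z k) = 0"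
    using ng nz by (auto simp: generic_point_def)
  then show ?thesis
  proof cases
    case 1
    then show ?thesis unfolding Psi_isolate[OF 1(1)] using weight1_eq_0[OF nz(1)] by simp
  next
    case 2
    have "weight2 p q t (z j) (z k) = 0" by (rule weight2_eq_0[OF nz(1) nz(1) 2(4)])
    then have "(\<Prod>k\<in>{1..n} - {j}. weight2 p q t (z j) (z k)) = 0"
      using 2 by (intro prod_zero) auto
    then show ?thesis unfolding Psi_isolate[OF 2(1)] by simp
  qed
qed

lemma average_relation_generic:
  assumes "bc_generic p t b {1..n} k0 k1"
  shows "torus_average {1..n} (\<lambda>z. Psi n p q t b z * (\<Prod>i=1..n. v (b k1) (z i))) =
    torus_average {1..n} (\<lambda>z. Psi n p q t b z * (\<Prod>i=1..n. v (b k0) (z i))) *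
    (\<Prod>i<n. \<Prod>m\<in>{1..6} - {k0, k1}. \<theta> (b m * b k1 * t ^ i) / \<theta> (b m * b k0 * t ^ i))"
proof -
  interpret gen: bc_generic p t b "{1..n}" k0 k1 by fact
  define V where "V k z = (\<Prod>i=1..n. v (b k) (z i))" for k z
  obtain \<gamma> x :: "nat \<Rightarrow> complex" and N :: nat and c d where x: "\<forall>l<N. x l \<noteq> 0" and d: "d \<noteq> 0"
    and rel: "\<forall>z. (\<forall>i\<in>{1..n}. norm (z i) = 1) \<longrightarrow> generic_point p {1..n} z \<longrightarrow>
       coboundary (test_fun \<gamma> x N) z = c * (\<Prod>i=1..n. v (b k0) (z i)) + d * (\<Prod>i=1..n. v (b k1) (z i))"
    and cd': "- (c / d) = (\<Prod>i<card {1..n}. \<Prod>m\<in>{1..6} - {k0, k1}. \<theta> (b m * b k1 * t ^ i) / \<theta> (b m * b k0 * t ^ i))"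
    by (rule gen.coboundary_relation, rule that)
  have cd: "- (c / d) = (\<Prod>i<n. \<Prod>m\<in>{1..6} - {k0, k1}. \<theta> (b m * b k1 * t ^ i) / \<theta> (b m * b k0 * t ^ i))"
    using cd' by simp
  have V: "torus_measurable {1..n} (\<lambda>z. w * (Psi n p q t b z * V k z))" "torus_bounded (\<lambda>z. w * (Psi n p q t b z * V k z))"
    if "k \<in> {1..6}" for k w
  proof -
    show "torus_measurable {1..n} (\<lambda>z. w * (Psi n p q t b z * V k z))"
      unfolding V_def by (intro torus_measurable_mult Psi_torus_measurable pair_prod_torus_measurable p q)
        (simp add: torus_measurable_def)
    show "torus_bounded (\<lambda>z. w * (Psi n p q t b z * V k z))"
      unfolding V_def by (intro torus_bounded_mult torus_bounded_const Psi_torus_bounded pair_prod_torus_bounded b that)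
  qed
  have "0 = torus_average {1..n} (\<lambda>z. Psi n p q t b z * coboundary (test_fun \<gamma> x N) z)"
    using coboundary_average[of N x] x by simp
  also have "\<dots> = torus_average {1..n} (\<lambda>z. c * (Psi n p q t b z * V k0 z) + d * (Psi n p q t b z * V k1 z))"
  proof (rule torus_average_cong)
    fix z assume z: "z \<in> unimodular"
    show "Psi n p q t b z * coboundary (test_fun \<gamma> x N) z = c * (Psi n p q t b z * V k0 z) + d * (Psi n p q t b z * V k1 z)"
    proof (cases "generic_point p {1..n} z")
      case True
      then show ?thesis using rel z by (simp add: V_def unimodular_def algebra_simps)
    qed (simp add: Psi_eq_0[OF z])
  qed
  also have "\<dots> = c * torus_average {1..n} (\<lambda>z. Psi n p q t b z * V k0 z) + d * torus_average {1..n} (\<lambda>z. Psi n p q t b z * V k1 z)"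
    by (subst torus_average_add) (use V gen.k01 in \<open>auto simp: torus_average_cmult\<close>)
  finally have "d * torus_average {1..n} (\<lambda>z. Psi n p q t b z * V k1 z) = - c * torus_average {1..n} (\<lambda>z. Psi n p q t b z * V k0 z)"
    by (simp add: eq_neg_iff_add_eq_0 add.commute)
  then have "torus_average {1..n} (\<lambda>z. Psi n p q t b z * V k1 z) = torus_average {1..n} (\<lambda>z. Psi n p q t b z * V k0 z) * - (c / d)"
    using d by (simp add: field_simps)
  then show ?thesis unfolding cd V_def .
qed

lemma Psi_shift_parameter:
  assumes k: "k \<in> {1..6}" and z: "z \<in> unimodular"
  shows "Psi n p q t (b(k := q * b k)) z = Psi n p q t b z * (\<Prod>i=1..n. v (b k) (z i))"
proof -
  have w: "weight1 p q (b(k := q * b k)) (z i) = weight1 p q b (z i) * v (b k) (z i)" for i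
  proof -
    define g where "g a = \<Gamma> (a * z i) * \<Gamma> (a / z i)" for a
    have zi: "norm (z i) = 1" "z i \<noteq> 0"
      using unimodularD[OF z] by auto
    have "\<Gamma> (q * (b k * z i)) = \<theta> (b k * z i) * \<Gamma> (b k * z i)" "\<Gamma> (q * (b k / z i)) = \<theta> (b k / z i) * \<Gamma> (b k / z i)"
      by (rule egamma_times_q[OF p q]; use b[OF k] b1[OF k] zi in \<open>simp add: norm_mult norm_divide\<close>)+
    then have gq: "g (q * b k) = g (b k) * v (b k) (z i)"
      by (simp add: g_def theta_pair_def mult_ac)
    have "(\<Prod>m=1..6. g ((b(k := q * b k)) m)) = g (q * b k) * (\<Prod>m\<in>{1..6} - {k}. g ((b(k := q * b k)) m))"
      using prod.remove[OF _ k, of "\<lambda>m. g ((b(k := q * b k)) m)"] by simp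
    also have "(\<Prod>m\<in>{1..6} - {k}. g ((b(k := q * b k)) m)) = (\<Prod>m\<in>{1..6} - {k}. g (b m))"
      by (rule prod.cong) auto
    also have "g (q * b k) * (\<Prod>m\<in>{1..6} - {k}. g (b m)) = (\<Prod>m=1..6. g (b m)) * v (b k) (z i)"
      using prod.remove[OF _ k, of "\<lambda>m. g (b m)"] by (simp add: gq mult_ac)
    finally show ?thesis unfolding weight1_def g_def by simp
  qed
  show ?thesis unfolding Psi_eq_weights w prod.distrib by (simp only: mult_ac)
qed

end

lemma BC_integral_eq_torus_average:
  "BC_integral n p q t a = \<i> ^ n / (2 * of_real pi * \<i>) ^ n * torus_average {1..n} (Psi n p q t a)"
proof -
  have "Psi n p q t a (\<lambda>i. cis (x i)) / (\<Prod>i=1..n. cis (x i)) * (\<Prod>i=1..n. \<i> * cis (x i)) =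
      \<i> ^ n * Psi n p q t a (\<lambda>i. cis (x i))" for x :: "nat \<Rightarrow> real"
    by (simp add: prod.distrib)
  then show ?thesis
    unfolding BC_integral_def torus_integral_def torus_average_def by simp
qed

section \<open>Continuity in the parameters\<close>

text \<open>
  A bound that is uniform on the torus and valid from some index on, as dominated convergence
  requires.
\<close>

definition ev_bounded :: "(nat \<Rightarrow> (nat \<Rightarrow> complex) \<Rightarrow> complex) \<Rightarrow> bool" where
  "ev_bounded f \<longleftrightarrow> (\<exists>C. \<forall>\<^sub>F j in sequentially. \<forall>z\<in>unimodular. norm (f j z) \<le> C)"

lemma ev_bounded_torus_bounded: "torus_bounded f \<Longrightarrow> ev_bounded (\<lambda>_. f)"
  unfolding torus_bounded_def ev_bounded_def by (auto intro: always_eventually)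

lemma ev_bounded_mult:
  assumes "ev_bounded f" "ev_bounded g" shows "ev_bounded (\<lambda>j z. f j z * g j z)"
proof -
  obtain C D where "\<forall>\<^sub>F j in sequentially. \<forall>z\<in>unimodular. norm (f j z) \<le> C"
    "\<forall>\<^sub>F j in sequentially. \<forall>z\<in>unimodular. norm (g j z) \<le> D"
    using assms by (auto simp: ev_bounded_def)
  then have "\<forall>\<^sub>F j in sequentially. \<forall>z\<in>unimodular. norm (f j z * g j z) \<le> \<bar>C\<bar> * \<bar>D\<bar>"
  proof eventually_elim
    case (elim j)
    show ?case unfolding norm_mult
      using elim by (intro ballI mult_mono) (auto intro: order_trans[OF _ abs_ge_self])
  qed
  then show ?thesis unfolding ev_bounded_def by blast
qed

lemma ev_bounded_prod:
  assumes "\<And>i. i \<in> A \<Longrightarrow> ev_bounded (f i)" shows "ev_bounded (\<lambda>j z. \<Prod>i\<in>A. f i j z)"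
  using assms
proof (induction A rule: infinite_finite_induct)
  case (insert i A)
  then show ?case using ev_bounded_mult[of "f i" "\<lambda>j z. \<Prod>i\<in>A. f i j z"] by simp
qed (auto intro: ev_bounded_torus_bounded torus_bounded_const)

lemma egamma_ev_bounded:
  assumes p: "norm p < 1" "p \<noteq> 0" and q: "norm q < 1" "q \<noteq> 0"
    and A: "A \<longlonglongrightarrow> a" "a \<noteq> 0" "norm a < 1" and m: "\<And>z. z \<in> unimodular \<Longrightarrow> norm (m z) = 1"
  shows "ev_bounded (\<lambda>j z. egamma (A j * m z) p q)"
proof -
  define C where "C = {u :: complex. norm a / 2 \<le> norm u \<and> norm u \<le> (1 + norm a) / 2}"
  have "C = cball 0 ((1 + norm a) / 2) - ball 0 (norm a / 2)" by (auto simp: C_def)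
  then have "compact C" by (simp add: compact_diff)
  moreover have "continuous_on C (\<lambda>u. egamma u p q)"
    by (intro holomorphic_on_imp_continuous_on egamma_holomorphic p q holomorphic_intros)
       (use A in \<open>auto simp: C_def\<close>)
  ultimately have "bounded ((\<lambda>u. egamma u p q) ` C)"
    by (intro compact_imp_bounded compact_continuous_image)
  then obtain B where B: "\<And>u. u \<in> C \<Longrightarrow> norm (egamma u p q) \<le> B" unfolding bounded_iff by blast
  have n: "(\<lambda>j. norm (A j)) \<longlonglongrightarrow> norm a" using A(1) by (rule tendsto_norm)
  have "\<forall>\<^sub>F j in sequentially. norm a / 2 < norm (A j)" "\<forall>\<^sub>F j in sequentially. norm (A j) < (1 + norm a) / 2"
    by (rule order_tendstoD[OF n]; use A in simp)+
  then have "\<forall>\<^sub>F j in sequentially. \<forall>z\<in>unimodular. norm (egamma (A j * m z) p q) \<le> B"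
  proof eventually_elim
    case (elim j)
    show ?case using elim m by (intro ballI B) (simp add: C_def norm_mult)
  qed
  then show ?thesis unfolding ev_bounded_def by blast
qed

lemma torus_average_tendsto:
  assumes K: "finite K" and meas: "\<And>j. torus_measurable K (f j)" "torus_measurable K g"
    and bd: "ev_bounded f" and lim: "\<And>z. z \<in> unimodular \<Longrightarrow> (\<lambda>j. f j z) \<longlonglongrightarrow> g z"
  shows "(\<lambda>j. torus_average K (f j)) \<longlonglongrightarrow> torus_average K g"
proof -
  obtain C J where C: "\<And>j z. j \<ge> J \<Longrightarrow> z \<in> unimodular \<Longrightarrow> norm (f j z) \<le> C"
    using bd unfolding ev_bounded_def eventually_sequentially by blast
  note box = torus_box_finite_measurable[OF K]
  have cm: "(\<lambda>i. cis (x i)) \<in> unimodular" for x by (simp add: unimodular_def)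
  have "(\<lambda>j. torus_average K (f (j + J))) \<longlonglongrightarrow> torus_average K g"
    unfolding torus_average_def set_lebesgue_integral_def
  proof (rule integral_dominated_convergence[where w = "\<lambda>x. C * indicator (torus_box K) x"])
    note [measurable] = box(2)
    have [measurable]: "(\<lambda>x. f j (\<lambda>i. cis (x i))) \<in> borel_measurable (torus_measure K)"
      "(\<lambda>x. g (\<lambda>i. cis (x i))) \<in> borel_measurable (torus_measure K)" for j
      using meas by (simp_all add: torus_measurable_def)
    show "(\<lambda>x. indicator (torus_box K) x *\<^sub>R g (\<lambda>i. cis (x i))) \<in> borel_measurable (torus_measure K)"
      by measurable
    show "(\<lambda>x. indicator (torus_box K) x *\<^sub>R f (j + J) (\<lambda>i. cis (x i))) \<in> borel_measurable (torus_measure K)" for j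
      by measurable
    show "integrable (torus_measure K) (\<lambda>x. C * indicator (torus_box K) x)"
      using box by (intro integrable_mult_right integrable_real_indicator) auto
    show "AE x in (torus_measure K). (\<lambda>j. indicator (torus_box K) x *\<^sub>R f (j + J) (\<lambda>i. cis (x i)))
        \<longlonglongrightarrow> indicator (torus_box K) x *\<^sub>R g (\<lambda>i. cis (x i))"
      by (intro AE_I2 tendsto_intros LIMSEQ_ignore_initial_segment lim cm)
    show "AE x in (torus_measure K). norm (indicator (torus_box K) x *\<^sub>R f (j + J) (\<lambda>i. cis (x i)))
        \<le> C * indicator (torus_box K) x" for j
      using C cm by (intro AE_I2) (simp add: indicator_def)
  qed
  then show ?thesis by (rule LIMSEQ_offset)
qed

context bc_integral
begin

lemma BC_integral_tendsto:
  assumes A: "\<And>m. m \<in> {1..6} \<Longrightarrow> (\<lambda>j. A j m) \<longlonglongrightarrow> a m" and a: "\<And>m. m \<in> {1..6} \<Longrightarrow> a m \<noteq> 0 \<and> norm (a m) < 1"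
  shows "(\<lambda>j. BC_integral n p q t (A j)) \<longlonglongrightarrow> BC_integral n p q t a"
  unfolding BC_integral_eq_torus_average
proof (intro tendsto_intros torus_average_tendsto)
  show "torus_measurable {1..n} (Psi n p q t (A j))" "torus_measurable {1..n} (Psi n p q t a)" for j
    by (intro Psi_torus_measurable p q)+
  show "ev_bounded (\<lambda>j. Psi n p q t (A j))"
  proof -
    have refl: "torus_bounded (\<lambda>z. 1 / (\<Gamma> ((z i)\<^sup>2) * \<Gamma> (1 / (z i)\<^sup>2)))" for i
    proof (rule torus_bounded_cong)
      show "torus_bounded (\<lambda>z. theta (1 * (1 / (z i)\<^sup>2)) p * theta (1 * (z i)\<^sup>2) q)"
        by (intro torus_bounded_mult theta_torus_bounded) (use p q in \<open>auto simp: unimodular_def norm_divide norm_power\<close>)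
      fix z :: "nat \<Rightarrow> complex" assume "z \<in> unimodular"
      then have "norm ((z i)\<^sup>2) = 1" by (simp add: unimodular_def norm_power)
      from inverse_egamma_reflection[OF p q this]
      show "theta (1 * (1 / (z i)\<^sup>2)) p * theta (1 * (z i)\<^sup>2) q = 1 / (\<Gamma> ((z i)\<^sup>2) * \<Gamma> (1 / (z i)\<^sup>2))" by simp
    qed
    have "ev_bounded (\<lambda>j z. (\<Prod>i=1..n. (\<Prod>m=1..6. \<Gamma> (A j m * z i) * \<Gamma> (A j m * (1 / z i))) * (1 / (\<Gamma> ((z i)\<^sup>2) * \<Gamma> (1 / (z i)\<^sup>2)))) *
        (\<Prod>k=1..n. \<Prod>j=1..<k. weight2 p q t (z j) (z k)))"
      by (intro ev_bounded_mult ev_bounded_prod egamma_ev_bounded[OF p q A] ev_bounded_torus_bounded refl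
          torus_bounded_prod weight2_torus_bounded) (use a in \<open>auto simp: unimodular_def norm_divide\<close>)
    then show ?thesis
      unfolding Psi_eq_weights[abs_def] weight1_def by (simp add: divide_inverse)
  qed
  fix z :: "nat \<Rightarrow> complex" assume z: "z \<in> unimodular"
  have zi: "norm (z i) = 1" "z i \<noteq> 0" for i
    using unimodularD[OF z] by auto
  have cont: "isCont \<Gamma> u" if "u \<noteq> 0" "norm u < 1" for u
  proof -
    have "\<Gamma> holomorphic_on (ball 0 1 - {0})"
      using egamma_holomorphic[OF p q, of "\<lambda>u. u" "ball 0 1 - {0}"] by (auto intro: holomorphic_intros)
    then have "continuous_on (ball 0 1 - {0}) \<Gamma>" by (rule holomorphic_on_imp_continuous_on)
    then show ?thesis using that by (subst (asm) continuous_on_eq_continuous_at) (auto intro: open_delete)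
  qed
  have "(\<lambda>j. \<Gamma> (A j m * z i)) \<longlonglongrightarrow> \<Gamma> (a m * z i)" "(\<lambda>j. \<Gamma> (A j m / z i)) \<longlonglongrightarrow> \<Gamma> (a m / z i)" if "m \<in> {1..6}" for m i
    using a[OF that] zi by (auto intro!: isCont_tendsto_compose[OF cont] tendsto_intros A that simp: norm_mult norm_divide)
  then show "(\<lambda>j. Psi n p q t (A j) z) \<longlonglongrightarrow> Psi n p q t a z"
    unfolding Psi_eq_weights weight1_def divide_inverse[of _ "_ * _"] by (intro tendsto_intros) auto
qed auto

end

section \<open>Removal of the genericity assumptions\<close>

lemma finite_square_roots: "finite {s :: real. (complex_of_real s)\<^sup>2 = c}"
proof (cases "\<exists>s0 :: real. (complex_of_real s0)\<^sup>2 = c")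
  case True
  then obtain s0 :: real where s0: "(complex_of_real s0)\<^sup>2 = c" by blast
  have "{s :: real. (complex_of_real s)\<^sup>2 = c} \<subseteq> {s0, - s0}"
  proof
    fix s :: real assume "s \<in> {s. (complex_of_real s)\<^sup>2 = c}"
    then have "(complex_of_real s)\<^sup>2 = (complex_of_real s0)\<^sup>2" using s0 by simp
    then have "complex_of_real s = complex_of_real s0 \<or> complex_of_real s = - complex_of_real s0"
      by (simp only: power2_eq_iff)
    then have "s = s0 \<or> s = - s0" by (metis of_real_eq_iff of_real_minus)
    then show "s \<in> {s0, - s0}" by simp
  qed
  then show ?thesis using finite_subset by blast
qed auto

text \<open>
  Countably many values of \<open>s\<^sup>2\<close>, hence countably many \<open>s\<close>, are excluded.
\<close>

lemma generic_scaling_sequence: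
  fixes c1 c2 c3 :: "int \<Rightarrow> int \<Rightarrow> complex"
  obtains s :: "nat \<Rightarrow> real" where "s \<longlonglongrightarrow> 1" "\<And>j. s j > 1"
    "\<And>j e l. (complex_of_real (s j))\<^sup>2 \<notin> {c1 e l, c2 e l, c3 e l}"
proof -
  define bad where "bad = (\<Union>e. \<Union>l. {s :: real. (complex_of_real s)\<^sup>2 \<in> {c1 e l, c2 e l, c3 e l}})"
  have fin: "finite {s :: real. (complex_of_real s)\<^sup>2 \<in> {c1 e l, c2 e l, c3 e l}}" for e l
  proof -
    have "{s :: real. (complex_of_real s)\<^sup>2 \<in> {c1 e l, c2 e l, c3 e l}} =
        {s. (complex_of_real s)\<^sup>2 = c1 e l} \<union> {s. (complex_of_real s)\<^sup>2 = c2 e l} \<union> {s. (complex_of_real s)\<^sup>2 = c3 e l}"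
      by auto
    then show ?thesis using finite_square_roots by simp
  qed
  have "countable bad"
    unfolding bad_def
    by (rule countable_UN, rule countableI_type, rule countable_UN, rule countableI_type, rule countable_finite, rule fin)
  have "\<exists>s. s \<in> {1<..<1 + 1 / real (Suc j)} - bad" for j
  proof -
    have "uncountable {1<..<1 + 1 / real (Suc j)}" by (simp add: uncountable_open_interval)
    then have "{1<..<1 + 1 / real (Suc j)} - bad \<noteq> {}"
      using \<open>countable bad\<close> by (metis countable_subset Diff_eq_empty_iff)
    then show ?thesis by blast
  qed
  then obtain s where s: "\<And>j. s j \<in> {1<..<1 + 1 / real (Suc j)} - bad" by metis
  have "(\<lambda>j. 1 + 1 / real (Suc j)) \<longlonglongrightarrow> 1 + 0"
    by (intro tendsto_intros LIMSEQ_inverse_real_of_nat[unfolded inverse_eq_divide])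
  then have "s \<longlonglongrightarrow> 1"
    by (intro tendsto_sandwich[of "\<lambda>_. 1" s sequentially "\<lambda>j. 1 + 1 / real (Suc j)" 1])
       (use s in \<open>auto intro!: always_eventually less_imp_le\<close>)
  then show ?thesis
    by (rule that) (use s in \<open>auto simp: bad_def\<close>)
qed

context bc_integral
begin

text \<open>
  The product of \<open>|b\<^sub>m b\<^sub>m\<^sub>' t\<^sup>j|\<close> with the absolute values of the other four parameters and a power
  of \<open>|t|\<close> is \<open>|p|\<close> by the balancing condition, and these further factors have product less than \<open>1\<close>.
\<close>

lemma pair_annulus:
  assumes m: "m \<in> {1..6}" "m' \<in> {1..6}" "m \<noteq> m'" and j: "j \<le> 2 * n - 2"
  shows "norm p < norm (b m * b m' * t ^ j)" "norm (b m * b m' * t ^ j) < 1"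
proof -
  define R where "R = (\<Prod>i\<in>{1..6} - {m} - {m'}. norm (b i))"
  have nb: "0 < norm (b i)" "norm (b i) < 1" if "i \<in> {1..6}" for i using b b1 that by auto
  have R: "0 < R" "R < 1"
  proof -
    show "0 < R" unfolding R_def using b by (intro prod_pos) auto
    obtain m'' where m'': "m'' \<in> {1..6} - {m} - {m'}"
    proof -
      have "card ({1..6} - {m} - {m'}) = 4" using m by simp
      then show ?thesis using that by (metis card.empty equals0I zero_neq_numeral)
    qed
    then have "R = norm (b m'') * (\<Prod>i\<in>{1..6} - {m} - {m'} - {m''}. norm (b i))"
      unfolding R_def by (intro prod.remove) auto
    also have "\<dots> \<le> norm (b m'') * 1"
      using nb by (intro mult_left_mono prod_le_1) (auto intro: less_imp_le)
    also have "\<dots> < 1" using nb(2)[of m''] m'' by auto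
    finally show "R < 1" .
  qed
  have tj: "norm (t ^ j) > 0" "norm (t ^ j) \<le> 1" "norm (t ^ (2 * n - 2 - j)) > 0" "norm (t ^ (2 * n - 2 - j)) \<le> 1"
    using t t1 by (auto simp: norm_power intro!: power_le_one)
  have "(\<Prod>i=1..6. norm (b i)) = norm (b m) * (norm (b m') * R)"
    unfolding R_def
    using prod.remove[of "{1..6}" m "\<lambda>i. norm (b i)"] prod.remove[of "{1..6} - {m}" m' "\<lambda>i. norm (b i)"] m by simp
  moreover have "norm p = (\<Prod>i=1..6. norm (b i)) * norm t ^ (2 * n - 2)"
    using arg_cong[OF balancing, of norm] by (simp add: norm_mult norm_power prod_norm)
  moreover have "t ^ (2 * n - 2) = t ^ j * t ^ (2 * n - 2 - j)" by (simp only: power_add[symmetric] le_add_diff_inverse[OF j])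
  then have "norm t ^ (2 * n - 2) = norm (t ^ j) * norm (t ^ (2 * n - 2 - j))"
    by (metis norm_mult norm_power)
  ultimately have eq: "norm p = norm (b m * b m' * t ^ j) * (R * norm (t ^ (2 * n - 2 - j)))"
    by (simp add: norm_mult mult_ac)
  have pos: "norm (b m * b m' * t ^ j) > 0" using nb m tj t by (simp add: norm_mult)
  have "R * norm (t ^ (2 * n - 2 - j)) < 1 * 1"
    using R tj by (intro mult_less_le_imp_less) auto
  then have "norm (b m * b m' * t ^ j) * (R * norm (t ^ (2 * n - 2 - j))) < norm (b m * b m' * t ^ j) * 1"
    using pos by (intro mult_strict_left_mono) auto
  then show "norm p < norm (b m * b m' * t ^ j)" unfolding eq[symmetric] by simp
  have "norm (b m) * norm (b m') < 1 * 1" using nb m by (intro mult_strict_mono) (auto intro: less_imp_le)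
  then have "norm (b m) * norm (b m') * norm (t ^ j) < 1 * 1"
    using tj nb m by (intro mult_less_le_imp_less) (auto simp: less_imp_le)
  then show "norm (b m * b m' * t ^ j) < 1" by (simp add: norm_mult)
qed

lemma single_annulus:
  assumes m: "m \<in> {1..6}" and j: "j < n"
  shows "norm p < norm (b m * t ^ j)" "norm (b m * t ^ j) < 1"
proof -
  obtain m' where m': "m' \<in> {1..6}" "m \<noteq> m'" by (cases "m = 1") (auto intro: that[of 1] that[of 2])
  have "norm p < norm (b m * b m' * t ^ j)" using pair_annulus(1)[OF m m', of j] j by simp
  also have "norm (b m * b m' * t ^ j) = norm (b m') * norm (b m * t ^ j)"
    by (simp add: norm_mult mult_ac)
  also have "\<dots> \<le> 1 * norm (b m * t ^ j)"
    using b1[OF m'(1)] by (intro mult_right_mono) auto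
  finally show "norm p < norm (b m * t ^ j)" by simp
  have "norm (b m) * norm t ^ j < 1 * 1"
    using b1[OF m] b[OF m] t t1 by (intro mult_less_le_imp_less) (auto intro!: power_le_one)
  then show "norm (b m * t ^ j) < 1" by (simp add: norm_mult norm_power)
qed

lemma pair_theta_nonzero:
  "m \<in> {1..6} \<Longrightarrow> m' \<in> {1..6} \<Longrightarrow> m \<noteq> m' \<Longrightarrow> j \<le> 2 * n - 2 \<Longrightarrow> \<theta> (b m * b m' * t ^ j) \<noteq> 0"
  using theta_nonzero_annulus[OF p pair_annulus] .

lemma bc_genericI:
  assumes k: "k0 \<in> {1..6}" "k1 \<in> {1..6}" "k0 \<noteq> k1" and pt: "norm p < norm t ^ (2 * n - 2)"
    and gen: "\<And>j l. (b k0)\<^sup>2 * t powi j \<noteq> p powi l" "\<And>j l. (b k1)\<^sup>2 * t powi j \<noteq> p powi l"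
      "\<And>j l. b k0 / b k1 * t powi j \<noteq> p powi l"
  shows "bc_generic p t b {1..n} k0 k1"
proof unfold_locales
  have th: "\<theta> u \<noteq> 0" if "u \<noteq> 0" "\<And>l. u \<noteq> p powi l" for u using theta_eq_0_iff[OF p that(1)] that(2) by blast
  have b0: "b k0 \<noteq> 0" "b k1 \<noteq> 0" using b k by auto
  show "norm t < 1" by (rule t1)
  show "norm p < norm (b k0 * t ^ j) \<and> norm (b k0 * t ^ j) < 1" if "j < card {1..n}" for j
    using single_annulus[OF k(1)] that by auto
  show "norm p < norm (b k1 * t ^ j) \<and> norm (b k1 * t ^ j) < 1" if "j < card {1..n}" for j
    using single_annulus[OF k(2)] that by auto
  show "\<theta> (b k0 * b k1 * t ^ j) \<noteq> 0" if "j \<le> 2 * card {1..n} - 2" for j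
    using pair_theta_nonzero[OF k, of j] that by simp
  show "\<theta> ((b k0)\<^sup>2 * t ^ j) \<noteq> 0" for j using gen(1)[of "int j"] b0 t by (intro th) auto
  show "\<theta> ((b k1)\<^sup>2 * t ^ j) \<noteq> 0" for j using gen(2)[of "int j"] b0 t by (intro th) auto
  show "\<theta> (b k0 / b k1 * t powi e) \<noteq> 0" for e using gen(3)[of e] b0 t by (intro th) auto
  show "\<theta> (t ^ j) \<noteq> 0" if "1 \<le> j" "j \<le> 2 * card {1..n} - 2" for j
  proof (rule theta_nonzero_annulus[OF p])
    have "norm t ^ (2 * n - 2) \<le> norm t ^ j" using that t1 by (intro power_decreasing) auto
    then show "norm p < norm (t ^ j)" using pt by (simp add: norm_power)
    have "norm t ^ j \<le> norm t ^ 1" using that t1 by (intro power_decreasing) auto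
    then show "norm (t ^ j) < 1" using t1 by (simp add: norm_power)
  qed
  show "\<theta> (b m * b k0 * t ^ j) \<noteq> 0 \<and> \<theta> (b m * b k1 * t ^ j) \<noteq> 0" if "m \<in> {1..6} - {k0, k1}" "j < card {1..n}" for m j
    using pair_theta_nonzero[of m k0 j] pair_theta_nonzero[of m k1 j] that k by auto
qed (use k in auto)

lemma BC_integral_relation_generic:
  assumes "bc_generic p t b {1..n} k0 k1"
  shows "BC_integral n p q t (b(k1 := q * b k1)) = BC_integral n p q t (b(k0 := q * b k0)) *
    (\<Prod>i<n. \<Prod>m\<in>{1..6} - {k0, k1}. \<theta> (b m * b k1 * t ^ i) / \<theta> (b m * b k0 * t ^ i))"
proof -
  interpret gen: bc_generic p t b "{1..n}" k0 k1 by fact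
  have "torus_average {1..n} (Psi n p q t (b(k := q * b k))) =
      torus_average {1..n} (\<lambda>z. Psi n p q t b z * (\<Prod>i=1..n. v (b k) (z i)))" if "k \<in> {1..6}" for k
    by (rule torus_average_cong) (rule Psi_shift_parameter[OF that])
  then show ?thesis
    unfolding BC_integral_eq_torus_average using average_relation_generic[OF assms] gen.k01 by simp
qed

end

theorem proposition3p1:
  fixes n k :: nat and p q t :: complex and a :: "nat \<Rightarrow> complex"
  assumes "n \<ge> 1"
    and "p \<noteq> 0" and "q \<noteq> 0" and "t \<noteq> 0"
    and "norm p < 1" and "norm q < 1" and "norm t < 1"
    and "norm p < norm t ^ (2 * n - 2)"
    and "\<forall>m\<in>{1..6}. a m \<noteq> 0"
    and "(\<Prod>m=1..6. a m) * t ^ (2 * n - 2) = p * q"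
    and "\<forall>m\<in>{1..5}. norm (a m) < 1" and "norm (a 6) < norm q"
    and "k \<in> {1..5}"
    and "\<forall>i\<in>{1..n}. \<forall>m\<in>{1..5} - {k}. theta (a m * a k * t ^ (i - 1)) p \<noteq> 0"
  shows "BC_integral n p q t a =
    BC_integral n p q t (a(k := q * a k, 6 := a 6 / q)) *
    (\<Prod>i=1..n. \<Prod>m\<in>{1..5} - {k}.
       theta (a m * a 6 * t ^ (i - 1) / q) p / theta (a m * a k * t ^ (i - 1)) p)"
proof -
  have k: "k \<in> {1..6}" "k \<noteq> 6" "6 \<in> {1..6::nat}" using assms(13) by auto
  have a0: "a m \<noteq> 0" if "m \<in> {1..6}" for m using assms(9) that by blast
  have a1: "norm (a m) < 1" if "m \<in> {1..6}" "m \<noteq> 6" for m using assms(11) that by auto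
  have a6: "norm (a 6 / q) < 1" using assms(3,12) by (simp add: norm_divide)
  \<comment> \<open>This deformation keeps the balancing condition and multiplies \<open>b\<^sub>k / b\<^sub>6\<close> by \<open>s\<^sup>-\<^sup>2\<close>.\<close>
  define B where "B s = a(k := a k / s, 6 := a 6 / q * s)" for s :: complex
  have prodB: "(\<Prod>m=1..6. B s m) * t ^ (2 * card {1..n} - 2) = p" if "s \<noteq> 0" for s
  proof -
    have split: "(\<Prod>m=1..6. f m) = f k * (f 6 * (\<Prod>m\<in>{1..6} - {k} - {6}. f m))" for f :: "nat \<Rightarrow> complex"
      using prod.remove[of "{1..6}" k f] prod.remove[of "{1..6} - {k}" 6 f] k by simp
    have "(\<Prod>m\<in>{1..6} - {k} - {6}. B s m) = (\<Prod>m\<in>{1..6} - {k} - {6}. a m)"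
      by (rule prod.cong) (auto simp: B_def)
    moreover have "B s k = a k / s" "B s 6 = a 6 / q * s" using k by (auto simp: B_def)
    ultimately have "(\<Prod>m=1..6. B s m) = (\<Prod>m=1..6. a m) / q"
      unfolding split[of "B s"] split[of a] using that assms(3) by simp
    then show ?thesis using assms(3,10) by simp
  qed
  have bc: "bc_integral p t (B s) n q" if "s \<noteq> 0" "norm (a k / s) < 1" "norm (a 6 / q * s) < 1" for s
  proof unfold_locales
    show "B s m \<noteq> 0" "norm (B s m) < 1" if "m \<in> {1..6}" for m
      using a0[OF that] a0[OF k(1)] a0[OF k(3)] a1[OF that] \<open>s \<noteq> 0\<close> assms(3) \<open>norm (a k / s) < 1\<close> \<open>norm (a 6 / q * s) < 1\<close>
      unfolding B_def by auto
    show "(\<Prod>m=1..6. B s m) * t ^ (2 * card {1..n} - 2) = p" by (rule prodB[OF that(1)])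
  qed (use assms in auto)
  obtain s where s: "s \<longlonglongrightarrow> 1" "\<And>j. s j > 1"
    and sgen: "\<And>j e l. (complex_of_real (s j))\<^sup>2 \<notin> {(a k)\<^sup>2 * t powi e / p powi l,
       p powi l / ((a 6 / q)\<^sup>2 * t powi e), a k / (a 6 / q) * t powi e / p powi l}"
    using generic_scaling_sequence[of "\<lambda>e l. (a k)\<^sup>2 * t powi e / p powi l"
       "\<lambda>e l. p powi l / ((a 6 / q)\<^sup>2 * t powi e)" "\<lambda>e l. a k / (a 6 / q) * t powi e / p powi l"] by metis
  define S where "S j = complex_of_real (s j)" for j
  have S0: "S j \<noteq> 0" for j using s(2)[of j] by (simp add: S_def)
  have S1: "S \<longlonglongrightarrow> 1" using tendsto_of_real[OF s(1)] by (simp add: S_def[abs_def])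
  define R where "R s = (\<Prod>i<n. \<Prod>m\<in>{1..6} - {k, 6}. theta (B s m * B s 6 * t ^ i) p / theta (B s m * B s k * t ^ i) p)" for s
  have "(\<lambda>j. norm (a 6 / q * S j)) \<longlonglongrightarrow> norm (a 6 / q * 1)" "(\<lambda>j. norm (a k / S j)) \<longlonglongrightarrow> norm (a k / 1)"
    by (intro tendsto_intros S1; simp)+
  then have "\<forall>\<^sub>F j in sequentially. norm (a 6 / q * S j) < 1" "\<forall>\<^sub>F j in sequentially. norm (a k / S j) < 1"
    using a6 a1[OF k(1,2)] by (auto intro: order_tendstoD(2))
  then have ev: "\<forall>\<^sub>F j in sequentially. BC_integral n p q t ((B (S j))(6 := q * B (S j) 6)) =
      BC_integral n p q t ((B (S j))(k := q * B (S j) k)) * R (S j)"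
  proof eventually_elim
    case (elim j)
    interpret bc_integral p t "B (S j)" n q by (rule bc) (use elim S0 in auto)
    have Bk: "B (S j) k = a k / S j" "B (S j) 6 = a 6 / q * S j" using k by (auto simp: B_def)
    have g: "(S j)\<^sup>2 \<noteq> (a k)\<^sup>2 * t powi e / p powi l" "(S j)\<^sup>2 \<noteq> p powi l / ((a 6 / q)\<^sup>2 * t powi e)"
       "(S j)\<^sup>2 \<noteq> a k / (a 6 / q) * t powi e / p powi l" for e l
      using sgen[of j e l] by (auto simp: S_def)
    have nz: "p powi l \<noteq> 0" "t powi l \<noteq> 0" "a 6 \<noteq> 0" "a k \<noteq> 0" for l using assms(2,4) a0 k by auto
    have "bc_generic p t (B (S j)) {1..n} k 6"
    proof (rule bc_genericI[OF k(1,3,2) assms(8)])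
      show "(B (S j) k)\<^sup>2 * t powi e \<noteq> p powi l" for e l
        using g(1)[of e l] nz S0[of j] unfolding Bk by (auto simp: power_divide field_simps)
      show "(B (S j) 6)\<^sup>2 * t powi e \<noteq> p powi l" for e l
        using g(2)[of l e] nz S0[of j] assms(3) unfolding Bk by (auto simp: power_divide power_mult_distrib field_simps)
      show "B (S j) k / B (S j) 6 * t powi e \<noteq> p powi l" for e l
        using g(3)[of e l] nz S0[of j] assms(3) unfolding Bk by (auto simp: power2_eq_square field_simps)
    qed
    from BC_integral_relation_generic[OF this] show ?case by (simp add: R_def)
  qed
  interpret lim: bc_integral p t "B 1" n q by (rule bc) (use a6 a1 k in auto)
  have B1: "B 1 = a(6 := a 6 / q)" by (auto simp: B_def)
  have Blim: "(\<lambda>j. B (S j) m) \<longlonglongrightarrow> B 1 m" for m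
  proof -
    have "(\<lambda>j. a k / S j) \<longlonglongrightarrow> a k / 1" "(\<lambda>j. a 6 / q * S j) \<longlonglongrightarrow> a 6 / q * 1"
      by (intro tendsto_intros S1; simp)+
    then show ?thesis by (cases "m = 6"; cases "m = k") (simp_all add: B_def)
  qed
  have lim_nz: "B 1 m \<noteq> 0" "norm (B 1 m) < 1" if "m \<in> {1..6}" for m
    using lim.b[OF that] lim.b1[OF that] by auto
  have I: "(\<lambda>j. BC_integral n p q t ((B (S j))(l := q * B (S j) l))) \<longlonglongrightarrow> BC_integral n p q t ((B 1)(l := q * B 1 l))"
    if l: "l \<in> {1..6}" for l
  proof (rule lim.BC_integral_tendsto)
    fix m :: nat assume m: "m \<in> {1..6}"
    show "(\<lambda>j. ((B (S j))(l := q * B (S j) l)) m) \<longlonglongrightarrow> ((B 1)(l := q * B 1 l)) m"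
      using Blim by (auto intro!: tendsto_intros)
    have "norm q * norm (B 1 l) < 1 * 1"
      using lim_nz[OF l] assms(3,6) by (intro mult_strict_mono) auto
    then show "((B 1)(l := q * B 1 l)) m \<noteq> 0 \<and> norm (((B 1)(l := q * B 1 l)) m) < 1"
      using lim_nz[OF l] lim_nz[OF m] assms(3) by (auto simp: norm_mult)
  qed
  have theta_cont: "isCont (\<lambda>u. theta u p) u" if "u \<noteq> 0" for u
  proof -
    have "continuous_on (- {0}) (\<lambda>u. theta u p)"
      using theta_shift_holomorphic[OF assms(5,2), of 1] by (simp add: holomorphic_on_imp_continuous_on)
    then show ?thesis using that by (subst (asm) continuous_on_eq_continuous_at) auto
  qed
  have "(\<lambda>j. R (S j)) \<longlonglongrightarrow> R 1"
    unfolding R_def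
  proof (intro tendsto_intros)
    fix i m assume i: "i \<in> {..<n}" and m: "m \<in> {1..6} - {k, 6}"
    have "(\<lambda>j. theta (B (S j) m * B (S j) l * t ^ i) p) \<longlonglongrightarrow> theta (B 1 m * B 1 l * t ^ i) p" if "l \<in> {1..6}" for l
      by (rule isCont_tendsto_compose[OF theta_cont])
         (use lim_nz(1)[of m] lim_nz(1)[OF that] m assms(4) Blim in \<open>auto intro!: tendsto_intros\<close>)
    then show "(\<lambda>j. theta (B (S j) m * B (S j) 6 * t ^ i) p) \<longlonglongrightarrow> theta (B 1 m * B 1 6 * t ^ i) p"
      "(\<lambda>j. theta (B (S j) m * B (S j) k * t ^ i) p) \<longlonglongrightarrow> theta (B 1 m * B 1 k * t ^ i) p"
      using k by auto
    show "theta (B 1 m * B 1 k * t ^ i) p \<noteq> 0"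
      by (rule lim.pair_theta_nonzero) (use m k i in auto)
  qed
  then have "(\<lambda>j. BC_integral n p q t ((B (S j))(k := q * B (S j) k)) * R (S j)) \<longlonglongrightarrow>
      BC_integral n p q t ((B 1)(k := q * B 1 k)) * R 1"
    by (intro tendsto_mult I k)
  then have "(\<lambda>j. BC_integral n p q t ((B (S j))(6 := q * B (S j) 6))) \<longlonglongrightarrow>
      BC_integral n p q t ((B 1)(k := q * B 1 k)) * R 1"
    by (subst tendsto_cong[OF ev])
  then have "BC_integral n p q t ((B 1)(6 := q * B 1 6)) = BC_integral n p q t ((B 1)(k := q * B 1 k)) * R 1"
    by (rule LIMSEQ_unique[OF I[OF k(3)]])
  moreover have "(B 1)(6 := q * B 1 6) = a" "(B 1)(k := q * B 1 k) = a(k := q * a k, 6 := a 6 / q)"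
    using k assms(3) by (auto simp: B1)
  moreover have "R 1 = (\<Prod>i=1..n. \<Prod>m\<in>{1..5} - {k}.
       theta (a m * a 6 * t ^ (i - 1) / q) p / theta (a m * a k * t ^ (i - 1)) p)"
  proof -
    have set: "{1..6} - {k, 6} = {1..5} - {k}" by auto
    have "R 1 = (\<Prod>i<n. \<Prod>m\<in>{1..5} - {k}. theta (a m * a 6 * t ^ i / q) p / theta (a m * a k * t ^ i) p)"
      unfolding R_def B1 set using k by (intro prod.cong refl) auto
    also have "\<dots> = (\<Prod>i=1..n. \<Prod>m\<in>{1..5} - {k}.
       theta (a m * a 6 * t ^ (i - 1) / q) p / theta (a m * a k * t ^ (i - 1)) p)"
      by (simp add: prod.atLeast1_atMost_eq)
    finally show ?thesis .
  qed
  ultimately show ?thesis by simp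
qed

end
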